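(* Let $k$ be a ring and $X$ a topological space. Any locally constant sheaf of $k$-modules on $X$ is quasi-coherent. Moreover, if $X$ is locally connected, the converse also holds (every quasi-coherent sheaf of $k$-modules on $X$ is locally constant), and then $\operatorname{Qcoh}_k(X)=\operatorname{LConst}_k(X)$ is an abelian subcategory of $\operatorname{Shv}_k(X)$.
   Context: $\operatorname{Shv}_k(X)$ is the category of sheaves of $k$-modules on $X$. For a $k$-module $M$, $M_X=\pi^{-1}M$ is the constant sheaf, where $\pi\colon X\to\{*\}$. $\operatorname{LConst}_k(X)$ is the full subcategory of locally constant sheaves (those such that each point has an open neighbourhood on which the sheaf is isomorphic to a constant sheaf). A sheaf of $k$-modules $F$ on $X$ is quasi-coherent if for each point $x\in X$ there exist an open neighbourhood $U_x$ and an exact sequence of sheaves on $U_x$, $k_{U_x}^{\oplus I}\to k_{U_x}^{\oplus J}\to F|_{U_x}\to 0$, where $I$ and $J$ are arbitrary index sets; $\operatorname{Qcoh}_k(X)$ is the full subcategory of quasi-coherent sheaves. An abelian subcategory is a full subcategory which is abelian and whose inclusion functor is exact. *)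

theory Defs
  imports "HOL-Analysis.Analysis" "HOL-Algebra.Module"
begin

section \<open>Modules over a ring\<close>

text \<open>The library locale \<open>module\<close> requires a commutative ring of scalars. The ring is not assumed
  commutative here, so we use left modules, with the same axioms and the same record type. (The
  fields \<open>mult\<close> and \<open>one\<close> of that record play no role for modules.)\<close>

locale left_module = R?: ring R + M?: abelian_group M for R (structure) and M (structure) +
  assumes smult_closed:
      "\<lbrakk>a \<in> carrier R; x \<in> carrier M\<rbrakk> \<Longrightarrow> a \<odot>\<^bsub>M\<^esub> x \<in> carrier M"
    and smult_l_distr:
      "\<lbrakk>a \<in> carrier R; b \<in> carrier R; x \<in> carrier M\<rbrakk> \<Longrightarrow>
        (a \<oplus> b) \<odot>\<^bsub>M\<^esub> x = a \<odot>\<^bsub>M\<^esub> x \<oplus>\<^bsub>M\<^esub> b \<odot>\<^bsub>M\<^esub> x"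
    and smult_r_distr:
      "\<lbrakk>a \<in> carrier R; x \<in> carrier M; y \<in> carrier M\<rbrakk> \<Longrightarrow>
        a \<odot>\<^bsub>M\<^esub> (x \<oplus>\<^bsub>M\<^esub> y) = a \<odot>\<^bsub>M\<^esub> x \<oplus>\<^bsub>M\<^esub> a \<odot>\<^bsub>M\<^esub> y"
    and smult_assoc:
      "\<lbrakk>a \<in> carrier R; b \<in> carrier R; x \<in> carrier M\<rbrakk> \<Longrightarrow>
        (a \<otimes> b) \<odot>\<^bsub>M\<^esub> x = a \<odot>\<^bsub>M\<^esub> (b \<odot>\<^bsub>M\<^esub> x)"
    and smult_one: "x \<in> carrier M \<Longrightarrow> \<one> \<odot>\<^bsub>M\<^esub> x = x"

definition linear_map ::
  "('k, 'r) ring_scheme \<Rightarrow> ('k, 'a) module \<Rightarrow> ('k, 'b) module \<Rightarrow> ('a \<Rightarrow> 'b) \<Rightarrow> bool" where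
  "linear_map k M N f \<longleftrightarrow>
     f \<in> carrier M \<rightarrow> carrier N \<and>
     (\<forall>x\<in>carrier M. \<forall>y\<in>carrier M. f (x \<oplus>\<^bsub>M\<^esub> y) = f x \<oplus>\<^bsub>N\<^esub> f y) \<and>
     (\<forall>c\<in>carrier k. \<forall>x\<in>carrier M. f (c \<odot>\<^bsub>M\<^esub> x) = c \<odot>\<^bsub>N\<^esub> f x)"

definition regular_module :: "('k, 'r) ring_scheme \<Rightarrow> ('k, 'k) module" where
  "regular_module k =
     \<lparr>carrier = carrier k, mult = mult k, one = one k, zero = zero k, add = add k, smult = mult k\<rparr>"


section \<open>Sheaves of modules\<close>

text \<open>A presheaf is a family of modules of sections \<open>sec F V\<close> with restriction maps
  \<open>res F V W\<close> from \<open>V\<close> to \<open>W\<close>. Only the values at open sets \<open>W \<subseteq> V\<close> of the space at hand matter.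
  Hence the restriction of \<open>F\<close> to an open subset \<open>U\<close> of \<open>X\<close> is given by the same data \<open>F\<close>,
  considered on the space \<open>subtopology X U\<close>.\<close>

record ('x, 'k, 'a) presheaf =
  sec :: "'x set \<Rightarrow> ('k, 'a) module"
  res :: "'x set \<Rightarrow> 'x set \<Rightarrow> 'a \<Rightarrow> 'a"

definition presheaf :: "('k, 'r) ring_scheme \<Rightarrow> 'x topology \<Rightarrow> ('x, 'k, 'a) presheaf \<Rightarrow> bool" where
  "presheaf k X F \<longleftrightarrow>
     (\<forall>V. openin X V \<longrightarrow> left_module k (sec F V)) \<and>
     (\<forall>V W. openin X V \<and> openin X W \<and> W \<subseteq> V \<longrightarrow> linear_map k (sec F V) (sec F W) (res F V W)) \<and>
     (\<forall>V. openin X V \<longrightarrow> (\<forall>s\<in>carrier (sec F V). res F V V s = s)) \<and>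
     (\<forall>V W W'. openin X V \<and> openin X W \<and> openin X W' \<and> W' \<subseteq> W \<and> W \<subseteq> V \<longrightarrow>
        (\<forall>s\<in>carrier (sec F V). res F W W' (res F V W s) = res F V W' s))"

definition sheaf :: "('k, 'r) ring_scheme \<Rightarrow> 'x topology \<Rightarrow> ('x, 'k, 'a) presheaf \<Rightarrow> bool" where
  "sheaf k X F \<longleftrightarrow> presheaf k X F \<and>
     (\<forall>\<U>. (\<forall>U\<in>\<U>. openin X U) \<longrightarrow>
        (\<forall>s\<in>carrier (sec F (\<Union>\<U>)). \<forall>t\<in>carrier (sec F (\<Union>\<U>)).
           (\<forall>U\<in>\<U>. res F (\<Union>\<U>) U s = res F (\<Union>\<U>) U t) \<longrightarrow> s = t) \<and>
        (\<forall>\<sigma>. (\<forall>U\<in>\<U>. \<sigma> U \<in> carrier (sec F U)) \<and>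
             (\<forall>U\<in>\<U>. \<forall>V\<in>\<U>. res F U (U \<inter> V) (\<sigma> U) = res F V (U \<inter> V) (\<sigma> V)) \<longrightarrow>
             (\<exists>s\<in>carrier (sec F (\<Union>\<U>)). \<forall>U\<in>\<U>. res F (\<Union>\<U>) U s = \<sigma> U)))"

text \<open>Morphisms are extensional functions, so that morphisms that agree on all sections over open
  sets are equal.\<close>

definition sheaf_hom ::
  "('k, 'r) ring_scheme \<Rightarrow> 'x topology \<Rightarrow> ('x, 'k, 'a) presheaf \<Rightarrow> ('x, 'k, 'b) presheaf \<Rightarrow>
    ('x set \<Rightarrow> 'a \<Rightarrow> 'b) set" where
  "sheaf_hom k X F G =
     {\<phi> \<in> (\<Pi>\<^sub>E V\<in>{V. openin X V}. carrier (sec F V) \<rightarrow>\<^sub>E carrier (sec G V)).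
        (\<forall>V. openin X V \<longrightarrow> linear_map k (sec F V) (sec G V) (\<phi> V)) \<and>
        (\<forall>V W. openin X V \<and> openin X W \<and> W \<subseteq> V \<longrightarrow>
           (\<forall>s\<in>carrier (sec F V). \<phi> W (res F V W s) = res G V W (\<phi> V s)))}"

definition sheaf_id :: "'x topology \<Rightarrow> ('x, 'k, 'a) presheaf \<Rightarrow> 'x set \<Rightarrow> 'a \<Rightarrow> 'a" where
  "sheaf_id X F = (\<lambda>V\<in>{V. openin X V}. \<lambda>s\<in>carrier (sec F V). s)"

definition sheaf_comp ::
  "'x topology \<Rightarrow> ('x, 'k, 'a) presheaf \<Rightarrow> ('x set \<Rightarrow> 'b \<Rightarrow> 'c) \<Rightarrow> ('x set \<Rightarrow> 'a \<Rightarrow> 'b) \<Rightarrow>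
    'x set \<Rightarrow> 'a \<Rightarrow> 'c" where
  "sheaf_comp X F \<psi> \<phi> = (\<lambda>V\<in>{V. openin X V}. \<lambda>s\<in>carrier (sec F V). \<psi> V (\<phi> V s))"

definition sheaf_iso ::
  "('k, 'r) ring_scheme \<Rightarrow> 'x topology \<Rightarrow> ('x, 'k, 'a) presheaf \<Rightarrow> ('x, 'k, 'b) presheaf \<Rightarrow> bool" where
  "sheaf_iso k X F G \<longleftrightarrow>
     (\<exists>\<phi>\<in>sheaf_hom k X F G. \<exists>\<psi>\<in>sheaf_hom k X G F.
        sheaf_comp X F \<psi> \<phi> = sheaf_id X F \<and> sheaf_comp X G \<phi> \<psi> = sheaf_id X G)"

text \<open>Exactness of \<open>F \<rightarrow> G \<rightarrow> H\<close> in the category of sheaves means that the image sheaf of the first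
  map is the kernel of the second. The image sheaf (the sheafification of the presheaf image) has
  as sections those sections of \<open>G\<close> that locally come from \<open>F\<close>.\<close>

definition image_sections ::
  "'x topology \<Rightarrow> ('x, 'k, 'a) presheaf \<Rightarrow> ('x, 'k, 'b) presheaf \<Rightarrow> ('x set \<Rightarrow> 'a \<Rightarrow> 'b) \<Rightarrow>
    'x set \<Rightarrow> 'b set" where
  "image_sections X F G \<phi> V =
     {t \<in> carrier (sec G V).
        \<forall>x\<in>V. \<exists>W. openin X W \<and> x \<in> W \<and> W \<subseteq> V \<and> res G V W t \<in> \<phi> W ` carrier (sec F W)}"

definition kernel_sections ::
  "('x, 'k, 'a) presheaf \<Rightarrow> ('x, 'k, 'b) presheaf \<Rightarrow> ('x set \<Rightarrow> 'a \<Rightarrow> 'b) \<Rightarrow> 'x set \<Rightarrow> 'a set" where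
  "kernel_sections F G \<phi> V = {s \<in> carrier (sec F V). \<phi> V s = \<zero>\<^bsub>sec G V\<^esub>}"

text \<open>Exactness of \<open>F \<rightarrow> G \<rightarrow> H \<rightarrow> 0\<close>; the kernel of \<open>H \<rightarrow> 0\<close> is all of \<open>H\<close>.\<close>

definition right_exact_seq ::
  "('k, 'r) ring_scheme \<Rightarrow> 'x topology \<Rightarrow>
    ('x, 'k, 'a) presheaf \<Rightarrow> ('x, 'k, 'b) presheaf \<Rightarrow> ('x, 'k, 'c) presheaf \<Rightarrow>
    ('x set \<Rightarrow> 'a \<Rightarrow> 'b) \<Rightarrow> ('x set \<Rightarrow> 'b \<Rightarrow> 'c) \<Rightarrow> bool" where
  "right_exact_seq k X F G H \<phi> \<psi> \<longleftrightarrow>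
     \<phi> \<in> sheaf_hom k X F G \<and> \<psi> \<in> sheaf_hom k X G H \<and>
     (\<forall>V. openin X V \<longrightarrow>
        image_sections X F G \<phi> V = kernel_sections G H \<psi> V \<and>
        image_sections X G H \<psi> V = carrier (sec H V))"


section \<open>Constant sheaves, locally constant and quasi-coherent sheaves\<close>

text \<open>The constant sheaf \<open>M\<^sub>X\<close>, the inverse image of \<open>M\<close> under \<open>X \<rightarrow> {*}\<close>. Its espace etale is
  \<open>X \<times> M\<close> with \<open>M\<close> discrete, so its sections over \<open>V\<close> are the continuous functions from \<open>V\<close> to the
  discrete space \<open>M\<close>. See \<open>const_sheaf_adjunction\<close> below for the universal property.\<close>

definition const_sheaf :: "'x topology \<Rightarrow> ('k, 'm) module \<Rightarrow> ('x, 'k, 'x \<Rightarrow> 'm) presheaf" where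
  "const_sheaf X M =
     \<lparr>sec = (\<lambda>V.
        \<lparr>carrier = {s \<in> extensional V.
            continuous_map (subtopology X V) (discrete_topology (carrier M)) s},
         mult = undefined, one = undefined,
         zero = (\<lambda>x\<in>V. \<zero>\<^bsub>M\<^esub>),
         add = (\<lambda>s t. \<lambda>x\<in>V. s x \<oplus>\<^bsub>M\<^esub> t x),
         smult = (\<lambda>c s. \<lambda>x\<in>V. c \<odot>\<^bsub>M\<^esub> s x)\<rparr>),
      res = (\<lambda>V W s. restrict s W)\<rparr>"

lemma sheaf_separate:
  assumes F: "sheaf k X F" and V: "openin X V"
    and s: "s \<in> carrier (sec F V)" and t: "t \<in> carrier (sec F V)"
    and loc: "\<And>x. x \<in> V \<Longrightarrow> \<exists>W. openin X W \<and> x \<in> W \<and> W \<subseteq> V \<and> res F V W s = res F V W t"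
  shows "s = t"
proof -
  let ?\<U> = "{W. openin X W \<and> W \<subseteq> V \<and> res F V W s = res F V W t}"
  have "\<Union>?\<U> = V"
    using loc by blast
  moreover have "\<forall>s\<in>carrier (sec F (\<Union>?\<U>)). \<forall>t\<in>carrier (sec F (\<Union>?\<U>)).
      (\<forall>U\<in>?\<U>. res F (\<Union>?\<U>) U s = res F (\<Union>?\<U>) U t) \<longrightarrow> s = t"
    using F[unfolded sheaf_def, THEN conjunct2, rule_format, of ?\<U>] by blast
  ultimately show ?thesis
    using s t by simp
qed

lemma sheaf_glue:
  assumes F: "sheaf k X F" and U: "\<And>U. U \<in> \<U> \<Longrightarrow> openin X U"
    and \<sigma>: "\<And>U. U \<in> \<U> \<Longrightarrow> \<sigma> U \<in> carrier (sec F U)"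
    and compat: "\<And>U V. \<lbrakk>U \<in> \<U>; V \<in> \<U>\<rbrakk> \<Longrightarrow> res F U (U \<inter> V) (\<sigma> U) = res F V (U \<inter> V) (\<sigma> V)"
  obtains s where "s \<in> carrier (sec F (\<Union>\<U>))" "\<And>U. U \<in> \<U> \<Longrightarrow> res F (\<Union>\<U>) U s = \<sigma> U"
proof -
  have "\<exists>s\<in>carrier (sec F (\<Union>\<U>)). \<forall>U\<in>\<U>. res F (\<Union>\<U>) U s = \<sigma> U"
    using F[unfolded sheaf_def, THEN conjunct2, rule_format, of \<U>] U \<sigma> compat by blast
  then show ?thesis
    using that by blast
qed

lemma sheaf_res_closed:
  assumes "sheaf k X F" "openin X V" "openin X W" "W \<subseteq> V" "s \<in> carrier (sec F V)"
  shows "res F V W s \<in> carrier (sec F W)"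
  using assms by (auto simp: sheaf_def presheaf_def linear_map_def Pi_iff)

lemma sheaf_res_res:
  assumes "sheaf k X F" "openin X V" "openin X W" "openin X W'" "W' \<subseteq> W" "W \<subseteq> V"
    "s \<in> carrier (sec F V)"
  shows "res F W W' (res F V W s) = res F V W' s"
  using assms by (auto simp: sheaf_def presheaf_def)

lemma sheaf_sec: "\<lbrakk>sheaf k X F; openin X V\<rbrakk> \<Longrightarrow> left_module k (sec F V)"
  by (auto simp: sheaf_def presheaf_def)

lemma sheaf_res_linear:
  "\<lbrakk>sheaf k X F; openin X V; openin X W; W \<subseteq> V\<rbrakk> \<Longrightarrow> linear_map k (sec F V) (sec F W) (res F V W)"
  by (auto simp: sheaf_def presheaf_def)

lemma const_sheaf_res [simp]: "res (const_sheaf X M) V W s = restrict s W"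
  by (simp add: const_sheaf_def)

lemma const_sheaf_carrier:
  assumes "openin X V"
  shows "s \<in> carrier (sec (const_sheaf X M) V) \<longleftrightarrow>
     s \<in> V \<rightarrow>\<^sub>E carrier M \<and> (\<forall>m. openin X {x \<in> V. s x = m})" (is "?L \<longleftrightarrow> ?R")
proof -
  let ?c = "continuous_map (subtopology X V) (discrete_topology (carrier M)) s"
  have L: "?L \<longleftrightarrow> s \<in> extensional V \<and> ?c"
    by (simp add: const_sheaf_def)
  have top: "topspace (subtopology X V) = V"
    using assms openin_subset by fastforce
  have sub: "openin (subtopology X V) W \<longleftrightarrow> openin X W \<and> W \<subseteq> V" for W
    using assms by (simp add: openin_open_subtopology)
  have c: "?c \<longleftrightarrow> s \<in> V \<rightarrow> carrier M \<and> (\<forall>T. T \<subseteq> carrier M \<longrightarrow> openin X {x \<in> V. s x \<in> T})"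
    unfolding continuous_map_def top sub openin_discrete_topology topspace_discrete_topology by blast
  show ?thesis
  proof
    assume ?L
    then have s: "s \<in> extensional V" "s \<in> V \<rightarrow> carrier M"
      and op: "\<And>T. T \<subseteq> carrier M \<Longrightarrow> openin X {x \<in> V. s x \<in> T}"
      using L c by blast+
    have "openin X {x \<in> V. s x = m}" for m
    proof -
      have "{x \<in> V. s x = m} = {x \<in> V. s x \<in> carrier M \<inter> {m}}"
        using s(2) by blast
      then show ?thesis
        using op[of "carrier M \<inter> {m}"] by simp
    qed
    then show ?R
      using s by (simp add: PiE_def)
  next
    assume R: ?R
    have "openin X {x \<in> V. s x \<in> T}" for T
    proof -
      have "{x \<in> V. s x \<in> T} = (\<Union>m\<in>T. {x \<in> V. s x = m})"
        by blast
      moreover have "openin X (\<Union>m\<in>T. {x \<in> V. s x = m})"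
        by (rule openin_Union) (use R in blast)
      ultimately show ?thesis
        by (rule ssubst)
    qed
    then show ?L
      using R by (simp add: L c PiE_def)
  qed
qed

lemma const_sheaf_carrierI:
  assumes V: "openin X V" and s: "s \<in> V \<rightarrow>\<^sub>E carrier M"
    and loc: "\<And>x. x \<in> V \<Longrightarrow> \<exists>W. openin X W \<and> x \<in> W \<and> W \<subseteq> V \<and> (\<forall>y\<in>W. s y = s x)"
  shows "s \<in> carrier (sec (const_sheaf X M) V)"
proof -
  have "openin X {x \<in> V. s x = m}" for m
  proof (subst openin_subopen, intro ballI)
    fix x assume "x \<in> {x \<in> V. s x = m}"
    then show "\<exists>T. openin X T \<and> x \<in> T \<and> T \<subseteq> {x \<in> V. s x = m}"
      using loc[of x] by blast
  qed
  with s show ?thesis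
    by (intro const_sheaf_carrier[OF V, THEN iffD2] conjI allI)
qed

lemma const_sheaf_fun:
  "\<lbrakk>openin X V; s \<in> carrier (sec (const_sheaf X M) V)\<rbrakk> \<Longrightarrow> s \<in> V \<rightarrow>\<^sub>E carrier M"
  by (rule const_sheaf_carrier[THEN iffD1, THEN conjunct1])

lemma const_sheaf_fibre:
  "\<lbrakk>openin X V; s \<in> carrier (sec (const_sheaf X M) V)\<rbrakk> \<Longrightarrow> openin X {x \<in> V. s x = m}"
  by (rule const_sheaf_carrier[THEN iffD1, THEN conjunct2, THEN spec])

lemma const_sheaf_locally:
  assumes V: "openin X V" and s: "s \<in> carrier (sec (const_sheaf X M) V)" and x: "x \<in> V"
  obtains W c where "openin X W" "x \<in> W" "W \<subseteq> V" "c \<in> carrier M" "\<And>y. y \<in> W \<Longrightarrow> s y = c"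
proof
  show "openin X {y \<in> V. s y = s x}"
    by (rule const_sheaf_fibre[OF V s])
  show "s x \<in> carrier M"
    using const_sheaf_fun[OF V s] x by blast
qed (use x in auto)

lemma const_sheaf_locally2:
  assumes V: "openin X V" and s: "s \<in> carrier (sec (const_sheaf X M) V)"
    and t: "t \<in> carrier (sec (const_sheaf X M) V)" and x: "x \<in> V"
  obtains W c d where "openin X W" "x \<in> W" "W \<subseteq> V" "c \<in> carrier M" "d \<in> carrier M"
    "\<And>y. y \<in> W \<Longrightarrow> s y = c" "\<And>y. y \<in> W \<Longrightarrow> t y = d"
proof -
  obtain W c where W: "openin X W" "x \<in> W" "W \<subseteq> V" "c \<in> carrier M" "\<And>y. y \<in> W \<Longrightarrow> s y = c"
    by (rule const_sheaf_locally[OF V s x]) blast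
  obtain W' d where W': "openin X W'" "x \<in> W'" "W' \<subseteq> V" "d \<in> carrier M" "\<And>y. y \<in> W' \<Longrightarrow> t y = d"
    by (rule const_sheaf_locally[OF V t x]) blast
  show ?thesis
    by (rule that[of "W \<inter> W'" c d]) (use W W' in auto)
qed

lemma const_sheaf_ops [simp]:
  "zero (sec (const_sheaf X M) V) = (\<lambda>x\<in>V. \<zero>\<^bsub>M\<^esub>)"
  "add (sec (const_sheaf X M) V) s t = (\<lambda>x\<in>V. s x \<oplus>\<^bsub>M\<^esub> t x)"
  "smult (sec (const_sheaf X M) V) c s = (\<lambda>x\<in>V. c \<odot>\<^bsub>M\<^esub> s x)"
  by (simp_all add: const_sheaf_def)

lemma const_sheaf_sec:
  assumes M: "left_module k M" and V: "openin X V"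
  shows "left_module k (sec (const_sheaf X M) V)"
proof -
  interpret left_module k M by fact
  let ?N = "sec (const_sheaf X M) V"
  have fn: "s \<in> V \<rightarrow>\<^sub>E carrier M" if "s \<in> carrier ?N" for s
    using that by (rule const_sheaf_fun[OF V])
  have val: "s x \<in> carrier M" if "s \<in> carrier ?N" "x \<in> V" for s x
    using fn[OF that(1)] that(2) by blast
  have ext: "s x = undefined" if "s \<in> carrier ?N" "x \<notin> V" for s x
    using fn[OF that(1)] that(2) by (rule PiE_arb)
  have add: "s \<oplus>\<^bsub>?N\<^esub> t \<in> carrier ?N" if s: "s \<in> carrier ?N" and t: "t \<in> carrier ?N" for s t
  proof (rule const_sheaf_carrierI[OF V])
    show "s \<oplus>\<^bsub>?N\<^esub> t \<in> V \<rightarrow>\<^sub>E carrier M"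
      using val s t by auto
    fix x assume x: "x \<in> V"
    obtain W c d where "openin X W" "x \<in> W" "W \<subseteq> V" "c \<in> carrier M" "d \<in> carrier M"
      "\<And>y. y \<in> W \<Longrightarrow> s y = c" "\<And>y. y \<in> W \<Longrightarrow> t y = d"
      by (rule const_sheaf_locally2[OF V s t x]) blast
    then show "\<exists>W. openin X W \<and> x \<in> W \<and> W \<subseteq> V \<and> (\<forall>y\<in>W. (s \<oplus>\<^bsub>?N\<^esub> t) y = (s \<oplus>\<^bsub>?N\<^esub> t) x)"
      by (intro exI[of _ W]) (auto simp: subset_iff)
  qed
  have smult: "c \<odot>\<^bsub>?N\<^esub> s \<in> carrier ?N" if c: "c \<in> carrier k" and s: "s \<in> carrier ?N" for c s
  proof (rule const_sheaf_carrierI[OF V])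
    show "c \<odot>\<^bsub>?N\<^esub> s \<in> V \<rightarrow>\<^sub>E carrier M"
      using val s c smult_closed by auto
    fix x assume x: "x \<in> V"
    obtain W a where "openin X W" "x \<in> W" "W \<subseteq> V" "a \<in> carrier M" "\<And>y. y \<in> W \<Longrightarrow> s y = a"
      by (rule const_sheaf_locally[OF V s x]) blast
    then show "\<exists>W. openin X W \<and> x \<in> W \<and> W \<subseteq> V \<and> (\<forall>y\<in>W. (c \<odot>\<^bsub>?N\<^esub> s) y = (c \<odot>\<^bsub>?N\<^esub> s) x)"
      by (intro exI[of _ W]) (auto simp: subset_iff)
  qed
  have zero: "\<zero>\<^bsub>?N\<^esub> \<in> carrier ?N"
    by (rule const_sheaf_carrierI[OF V]) (use V in auto)
  have neg: "(\<lambda>x\<in>V. \<ominus>\<^bsub>M\<^esub> s x) \<in> carrier ?N" if s: "s \<in> carrier ?N" for s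
  proof (rule const_sheaf_carrierI[OF V])
    show "(\<lambda>x\<in>V. \<ominus>\<^bsub>M\<^esub> s x) \<in> V \<rightarrow>\<^sub>E carrier M"
      using val s by auto
    fix x assume x: "x \<in> V"
    obtain W a where "openin X W" "x \<in> W" "W \<subseteq> V" "a \<in> carrier M" "\<And>y. y \<in> W \<Longrightarrow> s y = a"
      by (rule const_sheaf_locally[OF V s x]) blast
    then show "\<exists>W. openin X W \<and> x \<in> W \<and> W \<subseteq> V \<and>
        (\<forall>y\<in>W. (\<lambda>x\<in>V. \<ominus>\<^bsub>M\<^esub> s x) y = (\<lambda>x\<in>V. \<ominus>\<^bsub>M\<^esub> s x) x)"
      by (intro exI[of _ W]) (auto simp: subset_iff)
  qed
  have "abelian_group ?N"
  proof (rule abelian_groupI)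
    fix s assume s: "s \<in> carrier ?N"
    show "\<zero>\<^bsub>?N\<^esub> \<oplus>\<^bsub>?N\<^esub> s = s"
      using ext[OF s] val[OF s] by (auto simp: fun_eq_iff restrict_def)
    have "(\<lambda>x\<in>V. \<ominus>\<^bsub>M\<^esub> s x) \<oplus>\<^bsub>?N\<^esub> s = \<zero>\<^bsub>?N\<^esub>"
      using val[OF s] by (auto simp: fun_eq_iff restrict_def M.l_neg)
    then show "\<exists>t\<in>carrier ?N. t \<oplus>\<^bsub>?N\<^esub> s = \<zero>\<^bsub>?N\<^esub>"
      using neg[OF s] by blast
  next
    fix s t u assume "s \<in> carrier ?N" "t \<in> carrier ?N" "u \<in> carrier ?N"
    then show "s \<oplus>\<^bsub>?N\<^esub> t \<oplus>\<^bsub>?N\<^esub> u = s \<oplus>\<^bsub>?N\<^esub> (t \<oplus>\<^bsub>?N\<^esub> u)"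
      using val by (auto simp: fun_eq_iff restrict_def M.a_assoc)
  next
    fix s t assume "s \<in> carrier ?N" "t \<in> carrier ?N"
    then show "s \<oplus>\<^bsub>?N\<^esub> t = t \<oplus>\<^bsub>?N\<^esub> s"
      using val by (auto simp: fun_eq_iff restrict_def M.a_comm)
  qed (use add zero in auto)
  moreover have "left_module_axioms k ?N"
  proof
    fix a s assume "a \<in> carrier k" "s \<in> carrier ?N"
    then show "a \<odot>\<^bsub>?N\<^esub> s \<in> carrier ?N"
      by (rule smult)
  next
    fix s assume s: "s \<in> carrier ?N"
    show "\<one>\<^bsub>k\<^esub> \<odot>\<^bsub>?N\<^esub> s = s"
      using ext[OF s] val[OF s] by (auto simp: fun_eq_iff restrict_def smult_one)
  qed (use val in \<open>auto simp: fun_eq_iff restrict_def smult_l_distr smult_r_distr smult_assoc\<close>)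
  ultimately show ?thesis
    by (simp add: left_module_def R.ring_axioms)
qed

lemma const_sheaf_sheaf:
  assumes M: "left_module k M"
  shows "sheaf k X (const_sheaf X M)"
proof -
  let ?F = "const_sheaf X M"
  have ext: "s \<in> V \<rightarrow>\<^sub>E carrier M" if "openin X V" "s \<in> carrier (sec ?F V)" for s V
    using that by (rule const_sheaf_fun)
  have restr: "restrict s W \<in> carrier (sec ?F W)"
    if VW: "openin X V" "openin X W" "W \<subseteq> V" and s: "s \<in> carrier (sec ?F V)" for V W s
  proof (rule const_sheaf_carrierI[OF VW(2)])
    show "restrict s W \<in> W \<rightarrow>\<^sub>E carrier M"
      using ext[OF VW(1) s] VW(3) by auto
    fix x assume x: "x \<in> W"
    then have "x \<in> V"
      using VW(3) by blast
    then obtain A a where "openin X A" "x \<in> A" "A \<subseteq> V" "a \<in> carrier M" "\<And>y. y \<in> A \<Longrightarrow> s y = a"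
      by (rule const_sheaf_locally[OF VW(1) s]) blast
    then show "\<exists>A. openin X A \<and> x \<in> A \<and> A \<subseteq> W \<and> (\<forall>y\<in>A. restrict s W y = restrict s W x)"
      using VW(2) x by (intro exI[of _ "A \<inter> W"]) auto
  qed
  have "presheaf k X ?F"
    unfolding presheaf_def
  proof (intro conjI allI impI ballI; (elim conjE)?)
    fix V W assume VW: "openin X V" "openin X W" "W \<subseteq> V"
    show "linear_map k (sec ?F V) (sec ?F W) (res ?F V W)"
      using VW restr[OF VW] by (auto simp: linear_map_def fun_eq_iff restrict_def subset_iff)
  next
    fix V s assume "openin X V" "s \<in> carrier (sec ?F V)"
    then show "res ?F V V s = s"
      using ext by (auto simp: PiE_def extensional_restrict)
  qed (use const_sheaf_sec[OF M] in \<open>auto simp: fun_eq_iff restrict_def subset_iff\<close>)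
  moreover have "s = t" if U: "\<forall>U\<in>\<U>. openin X U"
    and s: "s \<in> carrier (sec ?F (\<Union>\<U>))" and t: "t \<in> carrier (sec ?F (\<Union>\<U>))"
    and eq: "\<forall>U\<in>\<U>. res ?F (\<Union>\<U>) U s = res ?F (\<Union>\<U>) U t" for \<U> s t
  proof (rule PiE_ext)
    have "openin X (\<Union>\<U>)"
      using U by blast
    then show "s \<in> \<Union>\<U> \<rightarrow>\<^sub>E carrier M" "t \<in> \<Union>\<U> \<rightarrow>\<^sub>E carrier M"
      using ext s t by blast+
    fix x assume "x \<in> \<Union>\<U>"
    then obtain U where "U \<in> \<U>" "x \<in> U"
      by blast
    then show "s x = t x"
      using eq by (auto dest!: bspec[of _ _ U] dest: fun_cong[of _ _ x])
  qed
  moreover have "\<exists>s\<in>carrier (sec ?F (\<Union>\<U>)). \<forall>U\<in>\<U>. res ?F (\<Union>\<U>) U s = \<sigma> U"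
    if U: "\<forall>U\<in>\<U>. openin X U" and \<sigma>: "\<forall>U\<in>\<U>. \<sigma> U \<in> carrier (sec ?F U)"
      and eq: "\<forall>U\<in>\<U>. \<forall>V\<in>\<U>. res ?F U (U \<inter> V) (\<sigma> U) = res ?F V (U \<inter> V) (\<sigma> V)" for \<U> \<sigma>
  proof -
    define s where "s = (\<lambda>x\<in>\<Union>\<U>. \<sigma> (SOME U. U \<in> \<U> \<and> x \<in> U) x)"
    have s: "s x = \<sigma> U x" if "U \<in> \<U>" "x \<in> U" for U x
    proof -
      define V where "V = (SOME U. U \<in> \<U> \<and> x \<in> U)"
      have V: "V \<in> \<U> \<and> x \<in> V"
        unfolding V_def by (rule someI[of _ U]) (use that in simp)
      have "restrict (\<sigma> U) (U \<inter> V) = restrict (\<sigma> V) (U \<inter> V)"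
        using eq that V by auto
      from fun_cong[OF this, of x] have "\<sigma> U x = \<sigma> V x"
        using that V by simp
      then show ?thesis
        using that V by (auto simp: s_def V_def)
    qed
    have op: "openin X (\<Union>\<U>)"
      using U by blast
    have "s \<in> carrier (sec ?F (\<Union>\<U>))"
    proof (rule const_sheaf_carrierI[OF op])
      have "s x \<in> carrier M" if x: "x \<in> \<Union>\<U>" for x
      proof -
        obtain U where U': "U \<in> \<U>" "x \<in> U"
          using x by blast
        then have "\<sigma> U \<in> U \<rightarrow>\<^sub>E carrier M"
          using ext U \<sigma> by blast
        then show ?thesis
          using s[OF U'] U'(2) by auto
      qed
      moreover have "s \<in> extensional (\<Union>\<U>)"
        by (simp add: s_def)
      ultimately show "s \<in> \<Union>\<U> \<rightarrow>\<^sub>E carrier M"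
        by (auto simp: PiE_def)
      fix x assume "x \<in> \<Union>\<U>"
      then obtain V where V: "V \<in> \<U>" "x \<in> V"
        by blast
      moreover have "openin X V" "\<sigma> V \<in> carrier (sec ?F V)"
        using V U \<sigma> by auto
      ultimately obtain W a where "openin X W" "x \<in> W" "W \<subseteq> V" "a \<in> carrier M" "\<And>y. y \<in> W \<Longrightarrow> \<sigma> V y = a"
        using const_sheaf_locally[of X V "\<sigma> V" M x] by blast
      then show "\<exists>W. openin X W \<and> x \<in> W \<and> W \<subseteq> \<Union>\<U> \<and> (\<forall>y\<in>W. s y = s x)"
        using s V by (intro exI[of _ W]) (auto simp: subset_iff)
    qed
    moreover have "restrict s U = \<sigma> U" if "U \<in> \<U>" for U
    proof (rule PiE_ext)
      show "\<sigma> U \<in> U \<rightarrow>\<^sub>E carrier M"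
        using ext U \<sigma> that by blast
      then show "restrict s U \<in> U \<rightarrow>\<^sub>E carrier M"
        using s[OF that] by auto
    qed (use s that in auto)
    ultimately show ?thesis
      by auto
  qed
  ultimately show ?thesis
    unfolding sheaf_def by blast
qed

text \<open>The adjunction \<open>Hom(M\<^sub>X, G) = Hom(M, G(X))\<close> that characterizes \<open>M\<^sub>X\<close> as the inverse image of \<open>M\<close>
  under \<open>X \<rightarrow> {*}\<close>.\<close>

lemma const_sheaf_adjunction:
  assumes M: "left_module k M" and G: "sheaf k X G"
  shows "bij_betw (\<lambda>\<phi>. \<lambda>m\<in>carrier M. \<phi> (topspace X) (\<lambda>x\<in>topspace X. m))
    (sheaf_hom k X (const_sheaf X M) G)
    {f \<in> extensional (carrier M). linear_map k M (sec G (topspace X)) f}"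
    (is "bij_betw ?\<Phi> ?H ?L")
proof -
  let ?F = "const_sheaf X M" and ?T = "topspace X"
  interpret left_module k M by fact
  have F: "sheaf k X ?F"
    by (rule const_sheaf_sheaf[OF M])
  have ext: "s \<in> V \<rightarrow>\<^sub>E carrier M" if "openin X V" "s \<in> carrier (sec ?F V)" for s V
    using that by (rule const_sheaf_fun)
  have const: "(\<lambda>x\<in>V. m) \<in> carrier (sec ?F V)" if "openin X V" "m \<in> carrier M" for V m
    by (rule const_sheaf_carrierI) (use that in auto)
  have sub: "V \<subseteq> ?T" if "openin X V" for V
    using that openin_subset by blast
  have top: "openin X ?T"
    by simp
  have hom_val: "\<phi> V s \<in> carrier (sec G V)"
    if "\<phi> \<in> ?H" "openin X V" "s \<in> carrier (sec ?F V)" for \<phi> V s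
    using that by (auto simp: sheaf_hom_def PiE_iff)
  have hom_res: "\<phi> W (restrict s W) = res G V W (\<phi> V s)"
    if "\<phi> \<in> ?H" "openin X V" "openin X W" "W \<subseteq> V" "s \<in> carrier (sec ?F V)" for \<phi> V W s
    using that by (auto simp: sheaf_hom_def)
  have hom_const: "\<phi> W (\<lambda>x\<in>W. m) = res G ?T W (?\<Phi> \<phi> m)"
    if "\<phi> \<in> ?H" "openin X W" "m \<in> carrier M" for \<phi> W m
  proof -
    have "(\<lambda>x\<in>W. m) = restrict (\<lambda>x\<in>?T. m) W"
      using sub[OF that(2)] by (auto simp: fun_eq_iff restrict_def)
    then show ?thesis
      using hom_res[OF that(1) top that(2) sub[OF that(2)] const[OF top that(3)]] that(3) by simp
  qed
  have inj: "inj_on ?\<Phi> ?H"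
  proof (rule inj_onI)
    fix \<phi> \<psi> assume \<phi>: "\<phi> \<in> ?H" and \<psi>: "\<psi> \<in> ?H" and eq: "?\<Phi> \<phi> = ?\<Phi> \<psi>"
    have "\<phi> V s = \<psi> V s" if V: "openin X V" and s: "s \<in> carrier (sec ?F V)" for V s
    proof (rule sheaf_separate[OF G V hom_val[OF \<phi> V s] hom_val[OF \<psi> V s]])
      fix x assume x: "x \<in> V"
      obtain W a where W: "openin X W" "x \<in> W" "W \<subseteq> V" and sx: "a \<in> carrier M"
          and sa: "\<And>y. y \<in> W \<Longrightarrow> s y = a"
        by (rule const_sheaf_locally[OF V s x]) blast
      have "restrict s W = (\<lambda>y\<in>W. a)"
        using sa by (auto simp: fun_eq_iff restrict_def)
      then have "res G V W (\<phi> V s) = res G V W (\<psi> V s)"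
        using hom_res[OF \<phi> V W(1,3) s] hom_res[OF \<psi> V W(1,3) s]
          hom_const[OF \<phi> W(1) sx] hom_const[OF \<psi> W(1) sx] eq by simp
      then show "\<exists>W. openin X W \<and> x \<in> W \<and> W \<subseteq> V \<and> res G V W (\<phi> V s) = res G V W (\<psi> V s)"
        using W by blast
    qed
    then have "\<phi> V = \<psi> V" if "openin X V" for V
      using \<phi> \<psi> that by (intro PiE_ext[of _ "carrier (sec ?F V)" "\<lambda>_. carrier (sec G V)"])
        (auto simp: sheaf_hom_def PiE_iff)
    then show "\<phi> = \<psi>"
      using \<phi> \<psi> by (intro PiE_ext[of _ "{V. openin X V}"]) (auto simp: sheaf_hom_def)
  qed
  have into: "?\<Phi> \<phi> \<in> ?L" if \<phi>: "\<phi> \<in> ?H" for \<phi>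
  proof -
    have lin: "linear_map k (sec ?F ?T) (sec G ?T) (\<phi> ?T)"
      using \<phi> top by (simp add: sheaf_hom_def)
    have "(\<lambda>x\<in>?T. m \<oplus>\<^bsub>M\<^esub> n) = (\<lambda>x\<in>?T. m) \<oplus>\<^bsub>sec ?F ?T\<^esub> (\<lambda>x\<in>?T. n)" for m n
      by (auto simp: fun_eq_iff restrict_def)
    moreover have "(\<lambda>x\<in>?T. c \<odot>\<^bsub>M\<^esub> m) = c \<odot>\<^bsub>sec ?F ?T\<^esub> (\<lambda>x\<in>?T. m)" for c m
      by (auto simp: fun_eq_iff restrict_def)
    ultimately show ?thesis
      using lin const[OF top] smult_closed by (auto simp: linear_map_def Pi_iff simp del: const_sheaf_ops)
  qed
  have surj: "\<exists>\<phi>\<in>?H. ?\<Phi> \<phi> = f" if f: "f \<in> ?L" for f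
  proof -
    have fval: "f m \<in> carrier (sec G ?T)" if "m \<in> carrier M" for m
      using f that by (auto simp: linear_map_def)
    define P where "P V s t \<longleftrightarrow> t \<in> carrier (sec G V) \<and>
      (\<forall>W m. openin X W \<and> W \<subseteq> V \<and> m \<in> carrier M \<and> (\<forall>x\<in>W. s x = m) \<longrightarrow>
        res G V W t = res G ?T W (f m))" for V s t
    have P_uniq: "t = t'" if V: "openin X V" and s: "s \<in> carrier (sec ?F V)"
      and t: "t \<in> carrier (sec G V)" and t': "t' \<in> carrier (sec G V)"
      and loc: "\<And>W m. \<lbrakk>openin X W; W \<subseteq> V; m \<in> carrier M; \<forall>x\<in>W. s x = m\<rbrakk> \<Longrightarrow>
        res G V W t = res G V W t'" for V s t t'
    proof (rule sheaf_separate[OF G V t t'])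
      fix x assume x: "x \<in> V"
      obtain W a where W: "openin X W" "x \<in> W" "W \<subseteq> V" and sx: "a \<in> carrier M"
          and sa: "\<And>y. y \<in> W \<Longrightarrow> s y = a"
        by (rule const_sheaf_locally[OF V s x]) blast
      then show "\<exists>W. openin X W \<and> x \<in> W \<and> W \<subseteq> V \<and> res G V W t = res G V W t'"
        using W loc[of W a] sx sa by blast
    qed
    have empty_eq: "t = t'" if "t \<in> carrier (sec G {})" "t' \<in> carrier (sec G {})" for t t'
      using that by (intro sheaf_separate[OF G, of "{}"]) auto
    have P_ex: "\<exists>t. P V s t" if V: "openin X V" and s: "s \<in> carrier (sec ?F V)" for V s
    proof -
      define A where "A x = {y \<in> V. s y = s x}" for x
      define pt where "pt U = (SOME x. x \<in> V \<and> U = A x)" for U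
      define \<sigma> where "\<sigma> U = res G ?T U (f (s (pt U)))" for U
      have opA: "openin X (A x)" for x
        unfolding A_def by (rule const_sheaf_fibre[OF V s])
      have pt: "pt U \<in> V \<and> U = A (pt U)" if "U \<in> A ` V" for U
        unfolding pt_def by (rule someI_ex) (use that in blast)
      have sv: "s x \<in> carrier M" if "x \<in> V" for x
        using ext[OF V s] that by auto
      have un: "\<Union>(A ` V) = V"
        by (auto simp: A_def)
      have \<sigma>: "\<sigma> U \<in> carrier (sec G U)" if "U \<in> A ` V" for U
      proof -
        have "openin X U"
          using that opA by blast
        moreover have "s (pt U) \<in> carrier M"
          using pt[OF that] sv by blast
        ultimately show ?thesis
          unfolding \<sigma>_def by (intro sheaf_res_closed[OF G top] sub fval)
      qed
      obtain t where t: "t \<in> carrier (sec G (\<Union>(A ` V)))"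
        "\<And>U. U \<in> A ` V \<Longrightarrow> res G (\<Union>(A ` V)) U t = \<sigma> U"
      proof (rule sheaf_glue[OF G, of "A ` V" \<sigma>])
        fix U U' assume U: "U \<in> A ` V" and U': "U' \<in> A ` V"
        show "res G U (U \<inter> U') (\<sigma> U) = res G U' (U \<inter> U') (\<sigma> U')"
        proof (cases "U = U'")
          case False
          then have "U \<inter> U' = {}"
            using U U' by (auto simp: A_def)
          moreover have "openin X U" "openin X U'"
            using U U' opA by auto
          ultimately show ?thesis
            using sheaf_res_closed[OF G, of U "{}"] sheaf_res_closed[OF G, of U' "{}"] \<sigma> U U'
            by (auto intro!: empty_eq)
        qed simp
      qed (use \<sigma> opA in auto)
      have "res G V W t = res G ?T W (f m)"
        if W: "openin X W" "W \<subseteq> V" and m: "m \<in> carrier M" "\<forall>x\<in>W. s x = m" for W m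
      proof (cases "W = {}")
        case True
        then show ?thesis
          using t(1) un V fval[OF m(1)] sub
            sheaf_res_closed[OF G V, of "{}" t] sheaf_res_closed[OF G top, of "{}" "f m"]
          by (auto intro: empty_eq)
      next
        case False
        then obtain x where x: "x \<in> W"
          by blast
        have AU: "A x \<in> A ` V"
          using x W by blast
        have WA: "W \<subseteq> A x" and AV: "A x \<subseteq> V"
          using x W m by (auto simp: A_def subset_iff)
        have "s (pt (A x)) = s x"
          using pt[OF AU] by (auto simp: A_def)
        then have "\<sigma> (A x) = res G ?T (A x) (f m)"
          using x m by (simp add: \<sigma>_def)
        then have "res G V (A x) t = res G ?T (A x) (f m)"
          using t(2)[OF AU] un by simp
        then have "res G (A x) W (res G V (A x) t) = res G (A x) W (res G ?T (A x) (f m))"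
          by simp
        then show ?thesis
          using sheaf_res_res[OF G V opA W(1) WA AV] t(1) un
            sheaf_res_res[OF G top opA W(1) WA sub[OF opA] fval[OF m(1)]] by simp
      qed
      then show ?thesis
        using t(1) un unfolding P_def by auto
    qed
    define \<phi> where "\<phi> = (\<lambda>V\<in>{V. openin X V}. \<lambda>s\<in>carrier (sec ?F V). SOME t. P V s t)"
    have P: "P V s (\<phi> V s)" if "openin X V" "s \<in> carrier (sec ?F V)" for V s
      using someI_ex[OF P_ex[OF that]] that by (simp add: \<phi>_def)
    have \<phi>_val: "\<phi> V s \<in> carrier (sec G V)" if "openin X V" "s \<in> carrier (sec ?F V)" for V s
      using P[OF that] by (simp add: P_def)
    have \<phi>_loc: "res G V W (\<phi> V s) = res G ?T W (f m)"
      if "openin X V" "s \<in> carrier (sec ?F V)" "openin X W" "W \<subseteq> V" "m \<in> carrier M"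
        "\<And>x. x \<in> W \<Longrightarrow> s x = m" for V W s m
      using P[OF that(1,2)] that(3-) by (simp add: P_def)
    have lin: "linear_map k (sec ?F V) (sec G V) (\<phi> V)" if V: "openin X V" for V
    proof -
      interpret FV: left_module k "sec ?F V" by (rule sheaf_sec[OF F V])
      interpret GV: left_module k "sec G V" by (rule sheaf_sec[OF G V])
      have "\<phi> V (s \<oplus>\<^bsub>sec ?F V\<^esub> t) = \<phi> V s \<oplus>\<^bsub>sec G V\<^esub> \<phi> V t"
        if s: "s \<in> carrier (sec ?F V)" and t: "t \<in> carrier (sec ?F V)" for s t
      proof (rule sheaf_separate[OF G V])
        have st: "s \<oplus>\<^bsub>sec ?F V\<^esub> t \<in> carrier (sec ?F V)"
          using s t by (rule FV.M.a_closed)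
        then show "\<phi> V (s \<oplus>\<^bsub>sec ?F V\<^esub> t) \<in> carrier (sec G V)"
          by (rule \<phi>_val[OF V])
        show "\<phi> V s \<oplus>\<^bsub>sec G V\<^esub> \<phi> V t \<in> carrier (sec G V)"
          using \<phi>_val[OF V] s t by (intro GV.M.a_closed)
        fix x assume x: "x \<in> V"
        obtain W a b where W: "openin X W" "x \<in> W" "W \<subseteq> V"
          and sx: "a \<in> carrier M" and tx: "b \<in> carrier M"
          and sa: "\<And>y. y \<in> W \<Longrightarrow> s y = a" and tb: "\<And>y. y \<in> W \<Longrightarrow> t y = b"
          by (rule const_sheaf_locally2[OF V s t x]) blast
        have "res G V W (\<phi> V (s \<oplus>\<^bsub>sec ?F V\<^esub> t)) = res G ?T W (f (a \<oplus>\<^bsub>M\<^esub> b))"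
          by (rule \<phi>_loc[OF V st W(1,3)]) (use sx tx W sa tb in auto)
        also have "f (a \<oplus>\<^bsub>M\<^esub> b) = f a \<oplus>\<^bsub>sec G ?T\<^esub> f b"
          using f sx tx by (simp add: linear_map_def)
        also have "res G ?T W \<dots> = res G ?T W (f a) \<oplus>\<^bsub>sec G W\<^esub> res G ?T W (f b)"
          using sheaf_res_linear[OF G top W(1) sub[OF W(1)]] fval[OF sx] fval[OF tx]
          by (simp add: linear_map_def)
        also have "\<dots> = res G V W (\<phi> V s) \<oplus>\<^bsub>sec G W\<^esub> res G V W (\<phi> V t)"
          using \<phi>_loc[OF V s W(1,3) sx sa] \<phi>_loc[OF V t W(1,3) tx tb] by simp
        also have "\<dots> = res G V W (\<phi> V s \<oplus>\<^bsub>sec G V\<^esub> \<phi> V t)"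
          using sheaf_res_linear[OF G V W(1,3)] \<phi>_val[OF V s] \<phi>_val[OF V t]
          by (simp add: linear_map_def)
        finally show "\<exists>W. openin X W \<and> x \<in> W \<and> W \<subseteq> V \<and>
            res G V W (\<phi> V (s \<oplus>\<^bsub>sec ?F V\<^esub> t)) = res G V W (\<phi> V s \<oplus>\<^bsub>sec G V\<^esub> \<phi> V t)"
          using W by blast
      qed
      moreover have "\<phi> V (c \<odot>\<^bsub>sec ?F V\<^esub> s) = c \<odot>\<^bsub>sec G V\<^esub> \<phi> V s"
        if c: "c \<in> carrier k" and s: "s \<in> carrier (sec ?F V)" for c s
      proof (rule sheaf_separate[OF G V])
        have cs: "c \<odot>\<^bsub>sec ?F V\<^esub> s \<in> carrier (sec ?F V)"
          using c s by (rule FV.smult_closed)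
        then show "\<phi> V (c \<odot>\<^bsub>sec ?F V\<^esub> s) \<in> carrier (sec G V)"
          by (rule \<phi>_val[OF V])
        show "c \<odot>\<^bsub>sec G V\<^esub> \<phi> V s \<in> carrier (sec G V)"
          using \<phi>_val[OF V] s c by (intro GV.smult_closed)
        fix x assume x: "x \<in> V"
        obtain W a where W: "openin X W" "x \<in> W" "W \<subseteq> V" and sx: "a \<in> carrier M"
          and sa: "\<And>y. y \<in> W \<Longrightarrow> s y = a"
          by (rule const_sheaf_locally[OF V s x]) blast
        have "res G V W (\<phi> V (c \<odot>\<^bsub>sec ?F V\<^esub> s)) = res G ?T W (f (c \<odot>\<^bsub>M\<^esub> a))"
          by (rule \<phi>_loc[OF V cs W(1,3)]) (use sx c W sa smult_closed in auto)
        also have "f (c \<odot>\<^bsub>M\<^esub> a) = c \<odot>\<^bsub>sec G ?T\<^esub> f a"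
          using f sx c by (simp add: linear_map_def)
        also have "res G ?T W \<dots> = c \<odot>\<^bsub>sec G W\<^esub> res G ?T W (f a)"
          using sheaf_res_linear[OF G top W(1) sub[OF W(1)]] fval[OF sx] c
          by (simp add: linear_map_def)
        also have "\<dots> = c \<odot>\<^bsub>sec G W\<^esub> res G V W (\<phi> V s)"
          using \<phi>_loc[OF V s W(1,3) sx sa] by simp
        also have "\<dots> = res G V W (c \<odot>\<^bsub>sec G V\<^esub> \<phi> V s)"
          using sheaf_res_linear[OF G V W(1,3)] \<phi>_val[OF V s] c
          by (simp add: linear_map_def)
        finally show "\<exists>W. openin X W \<and> x \<in> W \<and> W \<subseteq> V \<and>
            res G V W (\<phi> V (c \<odot>\<^bsub>sec ?F V\<^esub> s)) = res G V W (c \<odot>\<^bsub>sec G V\<^esub> \<phi> V s)"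
          using W by blast
      qed
      ultimately show ?thesis
        using \<phi>_val[OF V] by (simp add: linear_map_def)
    qed
    have nat: "\<phi> W (res ?F V W s) = res G V W (\<phi> V s)"
      if V: "openin X V" and W: "openin X W" "W \<subseteq> V" and s: "s \<in> carrier (sec ?F V)" for V W s
    proof (rule P_uniq[OF W(1) sheaf_res_closed[OF F V W s]])
      have r: "res ?F V W s \<in> carrier (sec ?F W)"
        by (rule sheaf_res_closed[OF F V W s])
      show "\<phi> W (res ?F V W s) \<in> carrier (sec G W)"
        by (rule \<phi>_val[OF W(1) r])
      show "res G V W (\<phi> V s) \<in> carrier (sec G W)"
        by (rule sheaf_res_closed[OF G V W \<phi>_val[OF V s]])
      fix A m assume A: "openin X A" "A \<subseteq> W" "m \<in> carrier M" "\<forall>x\<in>A. res ?F V W s x = m"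
      have sm: "s x = m" if "x \<in> A" for x
        using A that by (auto simp: subset_iff)
      have "res G W A (\<phi> W (res ?F V W s)) = res G ?T A (f m)"
        by (rule \<phi>_loc[OF W(1) r A(1,2,3)]) (use A in auto)
      also have "\<dots> = res G V A (\<phi> V s)"
        by (rule \<phi>_loc[OF V s A(1) _ A(3) sm, symmetric]) (use A W in auto)
      also have "\<dots> = res G W A (res G V W (\<phi> V s))"
        by (rule sheaf_res_res[OF G V W(1) A(1,2) W(2) \<phi>_val[OF V s], symmetric])
      finally show "res G W A (\<phi> W (res ?F V W s)) = res G W A (res G V W (\<phi> V s))" .
    qed
    have "\<phi> \<in> ?H"
      using lin nat \<phi>_val unfolding sheaf_hom_def by (auto simp: \<phi>_def PiE_iff)
    moreover have "?\<Phi> \<phi> = f"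
    proof (rule extensionalityI[of _ "carrier M"])
      fix m assume m: "m \<in> carrier M"
      have id: "res G ?T ?T t = t" if "t \<in> carrier (sec G ?T)" for t
        using G that by (simp add: sheaf_def presheaf_def)
      have "res G ?T ?T (\<phi> ?T (\<lambda>x\<in>?T. m)) = res G ?T ?T (f m)"
        by (rule \<phi>_loc[OF top const[OF top m]]) (use m in auto)
      then show "?\<Phi> \<phi> m = f m"
        using id fval[OF m] \<phi>_val[OF top const[OF top m]] m by simp
    qed (use f in auto)
    ultimately show ?thesis
      by blast
  qed
  have "?\<Phi> ` ?H = ?L"
  proof
    show "?\<Phi> ` ?H \<subseteq> ?L"
      by (rule image_subsetI) (rule into)
    show "?L \<subseteq> ?\<Phi> ` ?H"
    proof
      fix f assume "f \<in> ?L"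
      then obtain \<phi> where "\<phi> \<in> ?H" "?\<Phi> \<phi> = f"
        using surj by meson
      then show "f \<in> ?\<Phi> ` ?H"
        by (intro image_eqI[where f = ?\<Phi>]) (rule sym)
    qed
  qed
  then show ?thesis
    unfolding bij_betw_def using inj by (intro conjI)
qed

text \<open>The direct sum of a family of sheaves, i.e. the sheafification of the presheaf
  \<open>V \<mapsto> \<Oplus>\<^sub>i F\<^sub>i(V)\<close>: the sections of the product sheaf that locally have only finitely many nonzero
  components.\<close>

definition sheaf_dsum ::
  "'x topology \<Rightarrow> 'i set \<Rightarrow> ('i \<Rightarrow> ('x, 'k, 'a) presheaf) \<Rightarrow> ('x, 'k, 'i \<Rightarrow> 'a) presheaf" where
  "sheaf_dsum X I F =
     \<lparr>sec = (\<lambda>V.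
        \<lparr>carrier = {s \<in> (\<Pi>\<^sub>E i\<in>I. carrier (sec (F i) V)).
            \<forall>x\<in>V. \<exists>W. openin X W \<and> x \<in> W \<and> W \<subseteq> V \<and>
              finite {i\<in>I. res (F i) V W (s i) \<noteq> \<zero>\<^bsub>sec (F i) W\<^esub>}},
         mult = undefined, one = undefined,
         zero = (\<lambda>i\<in>I. \<zero>\<^bsub>sec (F i) V\<^esub>),
         add = (\<lambda>s t. \<lambda>i\<in>I. s i \<oplus>\<^bsub>sec (F i) V\<^esub> t i),
         smult = (\<lambda>c s. \<lambda>i\<in>I. c \<odot>\<^bsub>sec (F i) V\<^esub> s i)\<rparr>),
      res = (\<lambda>V W s. \<lambda>i\<in>I. res (F i) V W (s i))\<rparr>"

definition free_sheaf ::
  "('k, 'r) ring_scheme \<Rightarrow> 'x topology \<Rightarrow> 'i set \<Rightarrow> ('x, 'k, 'i \<Rightarrow> 'x \<Rightarrow> 'k) presheaf" where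
  "free_sheaf k X I = sheaf_dsum X I (\<lambda>_. const_sheaf X (regular_module k))"

text \<open>If \<open>F\<close> is isomorphic to \<open>M\<^sub>U\<close> with \<open>U\<close> nonempty, then \<open>M\<close> embeds into the sections of \<open>F\<close>
  over \<open>U\<close>. So it is no restriction to take the elements of \<open>M\<close> in the type \<open>'a\<close>.\<close>

definition locally_constant ::
  "('k, 'r) ring_scheme \<Rightarrow> 'x topology \<Rightarrow> ('x, 'k, 'a) presheaf \<Rightarrow> bool" where
  "locally_constant k X F \<longleftrightarrow> sheaf k X F \<and>
     (\<forall>x\<in>topspace X. \<exists>U. openin X U \<and> x \<in> U \<and>
        (\<exists>M :: ('k, 'a) module. left_module k M \<and>
           sheaf_iso k (subtopology X U) F (const_sheaf (subtopology X U) M)))"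

text \<open>Quasi-coherence with respect to index sets \<open>I\<close> and \<open>J\<close> in given types.\<close>

definition quasi_coherent_ix ::
  "'i itself \<Rightarrow> 'j itself \<Rightarrow> ('k, 'r) ring_scheme \<Rightarrow> 'x topology \<Rightarrow> ('x, 'k, 'a) presheaf \<Rightarrow> bool" where
  "quasi_coherent_ix _ _ k X F \<longleftrightarrow> sheaf k X F \<and>
     (\<forall>x\<in>topspace X. \<exists>U. openin X U \<and> x \<in> U \<and>
        (\<exists>(I :: 'i set) (J :: 'j set) \<phi> \<psi>.
           right_exact_seq k (subtopology X U)
             (free_sheaf k (subtopology X U) I) (free_sheaf k (subtopology X U) J) F \<phi> \<psi>))"

text \<open>The existence of an exact sequence with arbitrary index sets is equivalent to its existence
  with \<open>J\<close> in the type of sections of \<open>F\<close> and \<open>I\<close> in the type of sections of the free sheaf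
  \<open>k\<^sub>U\<^sup>J\<close>: replace \<open>J\<close> by the set of images of its basis sections in \<open>F(U)\<close>; this changes neither
  the image, nor the fact that the kernel is generated by a family of sections over \<open>U\<close> (the old
  relations, with basis sections of equal image identified). Then replace \<open>I\<close> by the set of these
  generators.\<close>

definition quasi_coherent ::
  "('k, 'r) ring_scheme \<Rightarrow> 'x topology \<Rightarrow> ('x, 'k, 'a) presheaf \<Rightarrow> bool" where
  "quasi_coherent k X F \<longleftrightarrow> quasi_coherent_ix TYPE('a \<Rightarrow> 'x \<Rightarrow> 'k) TYPE('a) k X F"


section \<open>Preadditive and abelian categories\<close>

text \<open>\<open>Comp C A B D g f\<close> is the composite of \<open>f : A \<rightarrow> B\<close> and \<open>g : B \<rightarrow> D\<close>.\<close>

record ('o, 'm) preadditive =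
  Obj :: "'o set"
  Hom :: "'o \<Rightarrow> 'o \<Rightarrow> 'm set"
  Ident :: "'o \<Rightarrow> 'm"
  Comp :: "'o \<Rightarrow> 'o \<Rightarrow> 'o \<Rightarrow> 'm \<Rightarrow> 'm \<Rightarrow> 'm"
  Plus :: "'o \<Rightarrow> 'o \<Rightarrow> 'm \<Rightarrow> 'm \<Rightarrow> 'm"
  Null :: "'o \<Rightarrow> 'o \<Rightarrow> 'm"

definition Hom_group :: "('o, 'm) preadditive \<Rightarrow> 'o \<Rightarrow> 'o \<Rightarrow> 'm monoid" where
  "Hom_group C A B = \<lparr>carrier = Hom C A B, monoid.mult = Plus C A B, one = Null C A B\<rparr>"

locale preadditive_category =
  fixes C :: "('o, 'm) preadditive"
  assumes ident: "A \<in> Obj C \<Longrightarrow> Ident C A \<in> Hom C A A"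
    and comp: "\<lbrakk>A \<in> Obj C; B \<in> Obj C; D \<in> Obj C; f \<in> Hom C A B; g \<in> Hom C B D\<rbrakk> \<Longrightarrow>
      Comp C A B D g f \<in> Hom C A D"
    and comp_ident_right: "\<lbrakk>A \<in> Obj C; B \<in> Obj C; f \<in> Hom C A B\<rbrakk> \<Longrightarrow> Comp C A A B f (Ident C A) = f"
    and comp_ident_left: "\<lbrakk>A \<in> Obj C; B \<in> Obj C; f \<in> Hom C A B\<rbrakk> \<Longrightarrow> Comp C A B B (Ident C B) f = f"
    and comp_assoc: "\<lbrakk>A \<in> Obj C; B \<in> Obj C; D \<in> Obj C; E \<in> Obj C;
        f \<in> Hom C A B; g \<in> Hom C B D; h \<in> Hom C D E\<rbrakk> \<Longrightarrow>
      Comp C A D E h (Comp C A B D g f) = Comp C A B E (Comp C B D E h g) f"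
    and hom_group: "\<lbrakk>A \<in> Obj C; B \<in> Obj C\<rbrakk> \<Longrightarrow> comm_group (Hom_group C A B)"
    and comp_plus_right: "\<lbrakk>A \<in> Obj C; B \<in> Obj C; D \<in> Obj C;
        f \<in> Hom C A B; f' \<in> Hom C A B; g \<in> Hom C B D\<rbrakk> \<Longrightarrow>
      Comp C A B D g (Plus C A B f f') = Plus C A D (Comp C A B D g f) (Comp C A B D g f')"
    and comp_plus_left: "\<lbrakk>A \<in> Obj C; B \<in> Obj C; D \<in> Obj C;
        f \<in> Hom C A B; g \<in> Hom C B D; g' \<in> Hom C B D\<rbrakk> \<Longrightarrow>
      Comp C A B D (Plus C B D g g') f = Plus C A D (Comp C A B D g f) (Comp C A B D g' f)"

definition zero_object :: "('o, 'm) preadditive \<Rightarrow> 'o \<Rightarrow> bool" where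
  "zero_object C Z \<longleftrightarrow> Z \<in> Obj C \<and>
     (\<forall>A\<in>Obj C. (\<exists>!f. f \<in> Hom C A Z) \<and> (\<exists>!f. f \<in> Hom C Z A))"

definition product :: "('o, 'm) preadditive \<Rightarrow> 'o \<Rightarrow> 'o \<Rightarrow> 'o \<Rightarrow> 'm \<Rightarrow> 'm \<Rightarrow> bool" where
  "product C A B P p q \<longleftrightarrow> P \<in> Obj C \<and> p \<in> Hom C P A \<and> q \<in> Hom C P B \<and>
     (\<forall>T\<in>Obj C. \<forall>f\<in>Hom C T A. \<forall>g\<in>Hom C T B.
        \<exists>!h. h \<in> Hom C T P \<and> Comp C T P A p h = f \<and> Comp C T P B q h = g)"

text \<open>\<open>i : K \<rightarrow> A\<close> is a kernel of \<open>f : A \<rightarrow> B\<close>.\<close>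

definition kernel_of :: "('o, 'm) preadditive \<Rightarrow> 'o \<Rightarrow> 'o \<Rightarrow> 'm \<Rightarrow> 'o \<Rightarrow> 'm \<Rightarrow> bool" where
  "kernel_of C A B f K i \<longleftrightarrow> K \<in> Obj C \<and> i \<in> Hom C K A \<and> Comp C K A B f i = Null C K B \<and>
     (\<forall>T\<in>Obj C. \<forall>g\<in>Hom C T A. Comp C T A B f g = Null C T B \<longrightarrow>
        (\<exists>!h. h \<in> Hom C T K \<and> Comp C T K A i h = g))"

text \<open>\<open>p : B \<rightarrow> Q\<close> is a cokernel of \<open>f : A \<rightarrow> B\<close>.\<close>

definition cokernel_of :: "('o, 'm) preadditive \<Rightarrow> 'o \<Rightarrow> 'o \<Rightarrow> 'm \<Rightarrow> 'o \<Rightarrow> 'm \<Rightarrow> bool" where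
  "cokernel_of C A B f Q p \<longleftrightarrow> Q \<in> Obj C \<and> p \<in> Hom C B Q \<and> Comp C A B Q p f = Null C A Q \<and>
     (\<forall>T\<in>Obj C. \<forall>g\<in>Hom C B T. Comp C A B T g f = Null C A T \<longrightarrow>
        (\<exists>!h. h \<in> Hom C Q T \<and> Comp C B Q T h p = g))"

definition monic :: "('o, 'm) preadditive \<Rightarrow> 'o \<Rightarrow> 'o \<Rightarrow> 'm \<Rightarrow> bool" where
  "monic C A B f \<longleftrightarrow>
     (\<forall>T\<in>Obj C. \<forall>g\<in>Hom C T A. \<forall>h\<in>Hom C T A. Comp C T A B f g = Comp C T A B f h \<longrightarrow> g = h)"

definition epic :: "('o, 'm) preadditive \<Rightarrow> 'o \<Rightarrow> 'o \<Rightarrow> 'm \<Rightarrow> bool" where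
  "epic C A B f \<longleftrightarrow>
     (\<forall>T\<in>Obj C. \<forall>g\<in>Hom C B T. \<forall>h\<in>Hom C B T. Comp C A B T g f = Comp C A B T h f \<longrightarrow> g = h)"

text \<open>In a preadditive category, binary products are automatically biproducts.\<close>

definition abelian_category :: "('o, 'm) preadditive \<Rightarrow> bool" where
  "abelian_category C \<longleftrightarrow> preadditive_category C \<and>
     (\<exists>Z. zero_object C Z) \<and>
     (\<forall>A\<in>Obj C. \<forall>B\<in>Obj C. \<exists>P p q. product C A B P p q) \<and>
     (\<forall>A\<in>Obj C. \<forall>B\<in>Obj C. \<forall>f\<in>Hom C A B.
        (\<exists>K i. kernel_of C A B f K i) \<and> (\<exists>Q p. cokernel_of C A B f Q p)) \<and>
     (\<forall>A\<in>Obj C. \<forall>B\<in>Obj C. \<forall>f\<in>Hom C A B. monic C A B f \<longrightarrow>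
        (\<exists>D\<in>Obj C. \<exists>g\<in>Hom C B D. kernel_of C B D g A f)) \<and>
     (\<forall>A\<in>Obj C. \<forall>B\<in>Obj C. \<forall>f\<in>Hom C A B. epic C A B f \<longrightarrow>
        (\<exists>D\<in>Obj C. \<exists>g\<in>Hom C D A. cokernel_of C D A g B f))"

definition short_exact :: "('o, 'm) preadditive \<Rightarrow> 'o \<Rightarrow> 'o \<Rightarrow> 'o \<Rightarrow> 'm \<Rightarrow> 'm \<Rightarrow> bool" where
  "short_exact C A B D f g \<longleftrightarrow> kernel_of C B D g A f \<and> cokernel_of C A B f D g"

definition full_subcategory :: "('o, 'm) preadditive \<Rightarrow> 'o set \<Rightarrow> ('o, 'm) preadditive" where
  "full_subcategory C S = C\<lparr>Obj := S\<rparr>"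

text \<open>A full subcategory that is abelian and whose inclusion functor is exact, i.e. sends short exact
  sequences to short exact sequences. (The inclusion is additive by construction.)\<close>

definition abelian_subcategory :: "('o, 'm) preadditive \<Rightarrow> ('o, 'm) preadditive \<Rightarrow> bool" where
  "abelian_subcategory D C \<longleftrightarrow>
     (\<exists>S \<subseteq> Obj C. D = full_subcategory C S) \<and>
     abelian_category D \<and>
     (\<forall>A\<in>Obj D. \<forall>B\<in>Obj D. \<forall>E\<in>Obj D. \<forall>f\<in>Hom D A B. \<forall>g\<in>Hom D B E.
        short_exact D A B E f g \<longrightarrow> short_exact C A B E f g)"


section \<open>The category of sheaves\<close>

definition Shv ::
  "('k, 'r) ring_scheme \<Rightarrow> 'x topology \<Rightarrow> (('x, 'k, 'u) presheaf, 'x set \<Rightarrow> 'u \<Rightarrow> 'u) preadditive"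
  where
  "Shv k X =
     \<lparr>Obj = {F. sheaf k X F},
      Hom = sheaf_hom k X,
      Ident = sheaf_id X,
      Comp = (\<lambda>F G H \<psi> \<phi>. sheaf_comp X F \<psi> \<phi>),
      Plus = (\<lambda>F G \<phi> \<psi>. \<lambda>V\<in>{V. openin X V}. \<lambda>s\<in>carrier (sec F V). \<phi> V s \<oplus>\<^bsub>sec G V\<^esub> \<psi> V s),
      Null = (\<lambda>F G. \<lambda>V\<in>{V. openin X V}. \<lambda>s\<in>carrier (sec F V). \<zero>\<^bsub>sec G V\<^esub>)\<rparr>"

definition LConst ::
  "('k, 'r) ring_scheme \<Rightarrow> 'x topology \<Rightarrow> (('x, 'k, 'u) presheaf, 'x set \<Rightarrow> 'u \<Rightarrow> 'u) preadditive"
  where "LConst k X = full_subcategory (Shv k X) {F. locally_constant k X F}"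

definition Qcoh ::
  "('k, 'r) ring_scheme \<Rightarrow> 'x topology \<Rightarrow> (('x, 'k, 'u) presheaf, 'x set \<Rightarrow> 'u \<Rightarrow> 'u) preadditive"
  where "Qcoh k X = full_subcategory (Shv k X) {F. quasi_coherent k X F}"

text \<open>The objects of \<open>Shv k X\<close> are the sheaves whose sections are elements of the type \<open>'u\<close>, which
  thus plays the role of the universe of the category of modules. The following is what makes \<open>'u\<close>
  closed under the formation of finite products and quotients of sheaves. Any type \<open>'a\<close> embeds
  into such a universe, namely \<open>'x \<times> nat \<Rightarrow> 'a\<close>.\<close>

definition sheaf_universe :: "'x itself \<Rightarrow> 'u itself \<Rightarrow> bool" where
  "sheaf_universe _ _ \<longleftrightarrow>
     (\<exists>e :: 'u \<times> 'u \<Rightarrow> 'u. inj e) \<and> (\<exists>e :: ('x \<Rightarrow> 'u) \<Rightarrow> 'u. inj e)"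

lemma sheaf_universe_fun: "sheaf_universe TYPE('x) TYPE('x \<times> nat \<Rightarrow> 'a)"
proof -
  have "inj (\<lambda>(f :: 'x \<times> nat \<Rightarrow> 'a, g) (x, n). if even n then f (x, n div 2) else g (x, n div 2))"
    (is "inj ?e")
  proof (rule injI)
    fix p q assume eq: "?e p = ?e q"
    obtain f g f' g' where pq: "p = (f, g)" "q = (f', g')"
      by fastforce
    have "f (x, n) = f' (x, n)" for x n
      using fun_cong[OF eq, of "(x, 2 * n)"] by (simp add: pq)
    moreover have "g (x, n) = g' (x, n)" for x n
      using fun_cong[OF eq, of "(x, 2 * n + 1)"] by (simp add: pq)
    ultimately show "p = q"
      by (auto simp: pq fun_eq_iff)
  qed
  moreover have "\<exists>h :: 'x \<times> nat \<Rightarrow> 'x \<times> 'x \<times> nat. surj h"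
  proof -
    have "\<exists>h :: 'x \<times> nat \<Rightarrow> 'x \<times> 'x. surj h"
    proof (cases "finite (UNIV :: 'x set)")
      case True
      then have "finite (UNIV :: ('x \<times> 'x) set)"
        by (simp add: finite_prod)
      then have "countable (UNIV :: ('x \<times> 'x) set)"
        by (rule countable_finite)
      then have "surj (from_nat_into (UNIV :: ('x \<times> 'x) set) \<circ> (snd :: 'x \<times> nat \<Rightarrow> nat))"
        by (simp add: comp_surj surj_def) (metis UNIV_I from_nat_into_surj)
      then show ?thesis
        by blast
    next
      case False
      then obtain b :: "'x \<times> 'x \<Rightarrow> 'x" where "bij b"
        using card_of_ordIso[THEN iffD2, OF card_of_Times_same_infinite] by fastforce
      then have "surj (inv_into UNIV b \<circ> (fst :: 'x \<times> nat \<Rightarrow> 'x))"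
        by (intro comp_surj bij_is_surj[OF bij_imp_bij_inv]) auto
      then show ?thesis
        by blast
    qed
    then obtain h :: "'x \<times> nat \<Rightarrow> 'x \<times> 'x" where h: "surj h"
      by blast
    have "surj (\<lambda>(x, n). case prod_decode n of (i, j) \<Rightarrow> case h (x, i) of (y, z) \<Rightarrow> (y, z, j))"
    proof (unfold surj_def, intro allI)
      fix w :: "'x \<times> 'x \<times> nat"
      obtain y z j where w: "w = (y, z, j)"
        by (cases w)
      obtain x i where "h (x, i) = (y, z)"
        using h by (metis surj_def surj_pair)
      then show "\<exists>p. w = (\<lambda>(x, n). case prod_decode n of (i, j) \<Rightarrow>
          case h (x, i) of (y, z) \<Rightarrow> (y, z, j)) p"
        by (intro exI[of _ "(x, prod_encode (i, j))"]) (simp add: w)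
    qed
    then show ?thesis
      by blast
  qed
  then obtain h :: "'x \<times> nat \<Rightarrow> 'x \<times> 'x \<times> nat" where h: "surj h"
    by blast
  have "inj (\<lambda>(F :: 'x \<Rightarrow> 'x \<times> nat \<Rightarrow> 'a) p. case h p of (x, q) \<Rightarrow> F x q)" (is "inj ?d")
  proof (rule injI, intro ext)
    fix F G :: "'x \<Rightarrow> 'x \<times> nat \<Rightarrow> 'a" and x q
    assume eq: "?d F = ?d G"
    obtain p where p: "h p = (x, q)"
      using h by (metis surj_def)
    show "F x q = G x q"
      using fun_cong[OF eq, of p] by (simp add: p)
  qed
  ultimately show ?thesis
    unfolding sheaf_universe_def by blast
qed

end

theory Submission
  imports Defs
begin

text \<open>Call a sheaf \<open>F\<close> rigid on a connected open set \<open>U\<close> if the restriction \<open>F(U) \<rightarrow> F(W)\<close> is bijective for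
  every nonempty connected open \<open>W \<subseteq> U\<close>. On a locally connected space the connected open sets form a
  base, and a sheaf is locally constant if and only if every point has a neighbourhood on which it is
  rigid (\<open>locally_constant_iff_rigid\<close>): a constant sheaf is rigid because locally constant functions
  are constant on connected sets, and conversely \<open>F\<close> is isomorphic on \<open>U\<close> to the constant sheaf with
  value \<open>F(U)\<close>. Rigidity speaks only of sections and restriction maps, so it can be chased through
  diagrams. In particular it passes to cokernels: if \<open>F \<rightarrow> G \<rightarrow> H \<rightarrow> 0\<close> is exact and \<open>F\<close> and \<open>G\<close> are rigid
  on \<open>U\<close>, then so is \<open>H\<close> (\<open>rigid_on_cokernel\<close>). The point there is that sections of \<open>H\<close> over a connected
  set lift to \<open>G\<close>.

  The free sheaf on \<open>I\<close> is the constant sheaf with value the free module \<open>k^(I)\<close>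
  (\<open>curry_hom_bijective\<close>), hence rigid. So a quasi-coherent sheaf on a locally connected space is
  locally a cokernel of a map of rigid sheaves, hence locally constant. Conversely, on any space,
  every module \<open>M\<close> has a presentation by free modules, and \<open>M \<mapsto> M\<^sub>X\<close> preserves its exactness since a
  section of a constant sheaf can be lifted value by value; so constant sheaves, and with them locally
  constant ones, are quasi-coherent.

  A class of sheaves that contains the zero sheaf and is closed under binary products, kernels and
  cokernels is an abelian subcategory: a monomorphism has zero kernel, so it is injective on sections
  and is the kernel of its cokernel, and dually; and a sequence that is exact in the class is exact as
  a sequence of sheaves (\<open>closed_sheaf_class.abelian_subcategory\<close>). On a locally connected space the
  locally constant sheaves form such a class, because rigidity passes to products, kernels and
  cokernels. Most of the work lies in the construction of these sheaves inside the given universe,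
  the cokernel being a sheaf of functions with values in the stalks \<open>B(U\<^sub>y) / f(A(U\<^sub>y))\<close>, where \<open>U\<^sub>y\<close> is a
  neighbourhood of \<open>y\<close> on which \<open>A\<close> and \<open>B\<close> are rigid.\<close>

section \<open>Left modules\<close>

context left_module
begin

lemma add_self_eq_zero:
  assumes "x \<in> carrier M" "x \<oplus>\<^bsub>M\<^esub> x = x"
  shows "x = \<zero>\<^bsub>M\<^esub>"
  using assms M.add.r_cancel_one by blast

lemma zero_smult: "x \<in> carrier M \<Longrightarrow> \<zero> \<odot>\<^bsub>M\<^esub> x = \<zero>\<^bsub>M\<^esub>"
  by (rule add_self_eq_zero) (simp_all add: smult_closed smult_l_distr[symmetric])

lemma smult_zero: "a \<in> carrier R \<Longrightarrow> a \<odot>\<^bsub>M\<^esub> \<zero>\<^bsub>M\<^esub> = \<zero>\<^bsub>M\<^esub>"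
  by (rule add_self_eq_zero) (simp_all add: smult_closed smult_r_distr[symmetric])

lemma neg_eq_smult:
  assumes x: "x \<in> carrier M"
  shows "\<ominus>\<^bsub>M\<^esub> x = (\<ominus> \<one>) \<odot>\<^bsub>M\<^esub> x"
proof -
  have "(\<ominus> \<one>) \<odot>\<^bsub>M\<^esub> x \<oplus>\<^bsub>M\<^esub> x = (\<ominus> \<one>) \<odot>\<^bsub>M\<^esub> x \<oplus>\<^bsub>M\<^esub> \<one> \<odot>\<^bsub>M\<^esub> x"
    using x by (simp add: smult_one)
  also have "\<dots> = \<zero>\<^bsub>M\<^esub>"
    using x by (simp add: smult_l_distr[symmetric] R.l_neg zero_smult)
  finally show ?thesis
    using x by (intro M.minus_equality) (simp_all add: smult_closed)
qed

lemma smult_neg: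
  "\<lbrakk>a \<in> carrier R; x \<in> carrier M\<rbrakk> \<Longrightarrow> a \<odot>\<^bsub>M\<^esub> (\<ominus>\<^bsub>M\<^esub> x) = \<ominus>\<^bsub>M\<^esub> (a \<odot>\<^bsub>M\<^esub> x)"
  by (rule M.minus_equality[symmetric]) (simp_all add: smult_closed smult_r_distr[symmetric] smult_zero M.l_neg)

end

text \<open>Additive inverses are multiples by \<open>-1\<close>, so that a module need only be checked to be closed under
  addition and scalar multiplication.\<close>

lemma left_moduleI:
  assumes k: "ring k"
    and zero: "\<zero>\<^bsub>M\<^esub> \<in> carrier M"
    and add: "\<And>x y. \<lbrakk>x \<in> carrier M; y \<in> carrier M\<rbrakk> \<Longrightarrow> x \<oplus>\<^bsub>M\<^esub> y \<in> carrier M"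
    and smult: "\<And>a x. \<lbrakk>a \<in> carrier k; x \<in> carrier M\<rbrakk> \<Longrightarrow> a \<odot>\<^bsub>M\<^esub> x \<in> carrier M"
    and assoc: "\<And>x y z. \<lbrakk>x \<in> carrier M; y \<in> carrier M; z \<in> carrier M\<rbrakk> \<Longrightarrow>
      x \<oplus>\<^bsub>M\<^esub> y \<oplus>\<^bsub>M\<^esub> z = x \<oplus>\<^bsub>M\<^esub> (y \<oplus>\<^bsub>M\<^esub> z)"
    and comm: "\<And>x y. \<lbrakk>x \<in> carrier M; y \<in> carrier M\<rbrakk> \<Longrightarrow> x \<oplus>\<^bsub>M\<^esub> y = y \<oplus>\<^bsub>M\<^esub> x"
    and l_zero: "\<And>x. x \<in> carrier M \<Longrightarrow> \<zero>\<^bsub>M\<^esub> \<oplus>\<^bsub>M\<^esub> x = x"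
    and zero_smult: "\<And>x. x \<in> carrier M \<Longrightarrow> \<zero>\<^bsub>k\<^esub> \<odot>\<^bsub>M\<^esub> x = \<zero>\<^bsub>M\<^esub>"
    and l_distr: "\<And>a b x. \<lbrakk>a \<in> carrier k; b \<in> carrier k; x \<in> carrier M\<rbrakk> \<Longrightarrow>
      (a \<oplus>\<^bsub>k\<^esub> b) \<odot>\<^bsub>M\<^esub> x = a \<odot>\<^bsub>M\<^esub> x \<oplus>\<^bsub>M\<^esub> b \<odot>\<^bsub>M\<^esub> x"
    and r_distr: "\<And>a x y. \<lbrakk>a \<in> carrier k; x \<in> carrier M; y \<in> carrier M\<rbrakk> \<Longrightarrow>
      a \<odot>\<^bsub>M\<^esub> (x \<oplus>\<^bsub>M\<^esub> y) = a \<odot>\<^bsub>M\<^esub> x \<oplus>\<^bsub>M\<^esub> a \<odot>\<^bsub>M\<^esub> y"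
    and smult_assoc: "\<And>a b x. \<lbrakk>a \<in> carrier k; b \<in> carrier k; x \<in> carrier M\<rbrakk> \<Longrightarrow>
      (a \<otimes>\<^bsub>k\<^esub> b) \<odot>\<^bsub>M\<^esub> x = a \<odot>\<^bsub>M\<^esub> (b \<odot>\<^bsub>M\<^esub> x)"
    and smult_one: "\<And>x. x \<in> carrier M \<Longrightarrow> \<one>\<^bsub>k\<^esub> \<odot>\<^bsub>M\<^esub> x = x"
  shows "left_module k M"
proof -
  interpret k: ring k by fact
  have "\<exists>y\<in>carrier M. y \<oplus>\<^bsub>M\<^esub> x = \<zero>\<^bsub>M\<^esub>" if x: "x \<in> carrier M" for x
  proof (rule bexI[of _ "(\<ominus>\<^bsub>k\<^esub> \<one>\<^bsub>k\<^esub>) \<odot>\<^bsub>M\<^esub> x"])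
    have "(\<ominus>\<^bsub>k\<^esub> \<one>\<^bsub>k\<^esub>) \<odot>\<^bsub>M\<^esub> x \<oplus>\<^bsub>M\<^esub> x = (\<ominus>\<^bsub>k\<^esub> \<one>\<^bsub>k\<^esub>) \<odot>\<^bsub>M\<^esub> x \<oplus>\<^bsub>M\<^esub> \<one>\<^bsub>k\<^esub> \<odot>\<^bsub>M\<^esub> x"
      using x by (simp add: smult_one)
    also have "\<dots> = \<zero>\<^bsub>M\<^esub>"
      using x by (simp add: l_distr[symmetric] k.l_neg zero_smult)
    finally show "(\<ominus>\<^bsub>k\<^esub> \<one>\<^bsub>k\<^esub>) \<odot>\<^bsub>M\<^esub> x \<oplus>\<^bsub>M\<^esub> x = \<zero>\<^bsub>M\<^esub>" .
  qed (use x smult in simp)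
  then have "abelian_group M"
    by (intro abelian_groupI) (use zero add assoc comm l_zero in auto)
  then show ?thesis
    using assms by (simp add: left_module_def left_module_axioms_def)
qed

lemma regular_module_simps [simp]:
  "carrier (regular_module k) = carrier k"
  "\<zero>\<^bsub>regular_module k\<^esub> = \<zero>\<^bsub>k\<^esub>"
  "x \<oplus>\<^bsub>regular_module k\<^esub> y = x \<oplus>\<^bsub>k\<^esub> y"
  "x \<odot>\<^bsub>regular_module k\<^esub> y = x \<otimes>\<^bsub>k\<^esub> y"
  by (simp_all add: regular_module_def)

lemma left_module_regular:
  assumes "ring k"
  shows "left_module k (regular_module k)"
proof -
  interpret k: ring k by fact
  show ?thesis
    by (rule left_moduleI) (auto simp: k.a_ac k.l_distr k.r_distr k.m_assoc assms)
qed

lemma left_module_submodule: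
  assumes N: "left_module k N" and C: "C \<subseteq> carrier N" "\<zero>\<^bsub>N\<^esub> \<in> C"
    and "\<And>x y. \<lbrakk>x \<in> C; y \<in> C\<rbrakk> \<Longrightarrow> x \<oplus>\<^bsub>N\<^esub> y \<in> C"
    and "\<And>a x. \<lbrakk>a \<in> carrier k; x \<in> C\<rbrakk> \<Longrightarrow> a \<odot>\<^bsub>N\<^esub> x \<in> C"
  shows "left_module k (N\<lparr>carrier := C\<rparr>)"
proof -
  interpret N: left_module k N by fact
  have sub: "x \<in> carrier N" if "x \<in> C" for x
    using that C by blast
  show ?thesis
    by (rule left_moduleI)
      (auto simp: assms N.R.ring_axioms sub N.M.a_ac N.smult_l_distr N.smult_r_distr
         N.smult_assoc N.smult_one N.zero_smult)
qed

definition prod_module :: "'i set \<Rightarrow> ('i \<Rightarrow> ('k, 'm) module) \<Rightarrow> ('k, 'i \<Rightarrow> 'm) module" where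
  "prod_module I M =
     \<lparr>carrier = (\<Pi>\<^sub>E i\<in>I. carrier (M i)), mult = undefined, one = undefined,
      zero = (\<lambda>i\<in>I. \<zero>\<^bsub>M i\<^esub>),
      add = (\<lambda>s t. \<lambda>i\<in>I. s i \<oplus>\<^bsub>M i\<^esub> t i),
      smult = (\<lambda>c s. \<lambda>i\<in>I. c \<odot>\<^bsub>M i\<^esub> s i)\<rparr>"

lemma prod_module_simps [simp]:
  "carrier (prod_module I M) = (\<Pi>\<^sub>E i\<in>I. carrier (M i))"
  "\<zero>\<^bsub>prod_module I M\<^esub> = (\<lambda>i\<in>I. \<zero>\<^bsub>M i\<^esub>)"
  "s \<oplus>\<^bsub>prod_module I M\<^esub> t = (\<lambda>i\<in>I. s i \<oplus>\<^bsub>M i\<^esub> t i)"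
  "c \<odot>\<^bsub>prod_module I M\<^esub> s = (\<lambda>i\<in>I. c \<odot>\<^bsub>M i\<^esub> s i)"
  by (simp_all add: prod_module_def)

lemma left_module_prod:
  assumes k: "ring k" and M: "\<And>i. i \<in> I \<Longrightarrow> left_module k (M i)"
  shows "left_module k (prod_module I M)"
proof -
  note mod = M[unfolded left_module_def left_module_axioms_def]
  have grp: "abelian_group (M i)" if "i \<in> I" for i
    using mod[OF that] by blast
  have mon: "abelian_monoid (M i)" if "i \<in> I" for i
    using grp[OF that] by (rule abelian_group.axioms)
  have eqI: "f = s" if "s \<in> (\<Pi>\<^sub>E i\<in>I. carrier (M i))" "f \<in> extensional I" "\<And>i. i \<in> I \<Longrightarrow> f i = s i" for f s
    by (rule extensionalityI[of _ I]) (use that in \<open>auto simp: PiE_def\<close>)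
  show ?thesis
  proof (rule left_moduleI[OF k], goal_cases)
    case 1 then show ?case using mon by (auto intro: abelian_monoid.zero_closed)
  next
    case 2 then show ?case using mon by (auto intro!: abelian_monoid.a_closed simp: PiE_iff)
  next
    case 3 then show ?case using M by (auto intro!: left_module.smult_closed simp: PiE_iff)
  next
    case (4 x y z) then show ?case using mon by (auto intro!: restrict_ext abelian_monoid.a_assoc simp: PiE_iff)
  next
    case (5 x y) then show ?case using mon by (auto intro!: restrict_ext abelian_monoid.a_comm simp: PiE_iff)
  next
    case (6 x) then show ?case using mon by (auto intro!: eqI abelian_monoid.l_zero)
  next
    case (7 x) then show ?case using M by (auto intro!: restrict_ext left_module.zero_smult simp: PiE_iff)
  next
    case (8 a b x) then show ?case using M by (auto intro!: restrict_ext left_module.smult_l_distr simp: PiE_iff)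
  next
    case (9 a x y) then show ?case using M by (auto intro!: restrict_ext left_module.smult_r_distr simp: PiE_iff)
  next
    case (10 a b x) then show ?case using M by (auto intro!: restrict_ext left_module.smult_assoc simp: PiE_iff)
  next
    case (11 x) then show ?case using M by (auto intro!: eqI left_module.smult_one)
  qed
qed

lemma linear_map_closed: "\<lbrakk>linear_map k M N f; x \<in> carrier M\<rbrakk> \<Longrightarrow> f x \<in> carrier N"
  by (auto simp: linear_map_def)

lemma linear_map_add:
  "\<lbrakk>linear_map k M N f; x \<in> carrier M; y \<in> carrier M\<rbrakk> \<Longrightarrow> f (x \<oplus>\<^bsub>M\<^esub> y) = f x \<oplus>\<^bsub>N\<^esub> f y"
  by (auto simp: linear_map_def)

lemma linear_map_smult:
  "\<lbrakk>linear_map k M N f; c \<in> carrier k; x \<in> carrier M\<rbrakk> \<Longrightarrow> f (c \<odot>\<^bsub>M\<^esub> x) = c \<odot>\<^bsub>N\<^esub> f x"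
  by (auto simp: linear_map_def)

lemma linear_map_zero:
  assumes "left_module k M" "left_module k N" "linear_map k M N f"
  shows "f \<zero>\<^bsub>M\<^esub> = \<zero>\<^bsub>N\<^esub>"
proof -
  interpret M: left_module k M by fact
  interpret N: left_module k N by fact
  show ?thesis
    by (rule N.add_self_eq_zero)
      (simp_all add: linear_map_closed[OF assms(3)] linear_map_add[OF assms(3), symmetric])
qed

lemma linear_map_minus:
  assumes "left_module k M" "left_module k N" "linear_map k M N f" "x \<in> carrier M" "y \<in> carrier M"
  shows "f (x \<ominus>\<^bsub>M\<^esub> y) = f x \<ominus>\<^bsub>N\<^esub> f y"
proof -
  interpret M: left_module k M by fact
  interpret N: left_module k N by fact
  note f = assms(3)
  have "f (\<ominus>\<^bsub>M\<^esub> y) = \<ominus>\<^bsub>N\<^esub> f y"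
    using assms(5) by (simp add: M.neg_eq_smult N.neg_eq_smult linear_map_smult[OF f] linear_map_closed[OF f])
  then show ?thesis
    using assms(4,5) by (simp add: a_minus_def linear_map_add[OF f])
qed

lemma left_module_minus_eq_zero:
  assumes "left_module k M" "x \<in> carrier M" "y \<in> carrier M"
  shows "x \<ominus>\<^bsub>M\<^esub> y = \<zero>\<^bsub>M\<^esub> \<longleftrightarrow> x = y"
proof -
  interpret M: left_module k M by fact
  show ?thesis
  proof
    assume "x \<ominus>\<^bsub>M\<^esub> y = \<zero>\<^bsub>M\<^esub>"
    then have "x \<oplus>\<^bsub>M\<^esub> \<ominus>\<^bsub>M\<^esub> y = \<zero>\<^bsub>M\<^esub>"
      by (simp add: a_minus_def)
    then show "x = y"
      using assms(2,3) M.M.minus_equality M.M.minus_minus M.M.a_inv_closed by metis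
  qed (use assms(3) in \<open>simp add: a_minus_def M.M.r_neg\<close>)
qed

section \<open>Morphisms of sheaves\<close>

abbreviation \<Gamma> :: "('x, 'k, 'a) presheaf \<Rightarrow> 'x set \<Rightarrow> 'a set" where
  "\<Gamma> F V \<equiv> carrier (sec F V)"

lemma presheafD:
  assumes "presheaf k X F" "openin X V"
  shows presheaf_sec: "left_module k (sec F V)"
    and presheaf_res_linear: "\<lbrakk>openin X W; W \<subseteq> V\<rbrakk> \<Longrightarrow> linear_map k (sec F V) (sec F W) (res F V W)"
    and presheaf_res_self: "s \<in> \<Gamma> F V \<Longrightarrow> res F V V s = s"
    and presheaf_res_res: "\<lbrakk>openin X W; openin X W'; W' \<subseteq> W; W \<subseteq> V; s \<in> \<Gamma> F V\<rbrakk> \<Longrightarrow>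
      res F W W' (res F V W s) = res F V W' s"
  by (use assms in \<open>simp_all add: presheaf_def\<close>)

lemma presheaf_zero_closed: "\<lbrakk>presheaf k X F; openin X V\<rbrakk> \<Longrightarrow> \<zero>\<^bsub>sec F V\<^esub> \<in> \<Gamma> F V"
  using presheaf_sec[of k X F V] by (simp add: left_module_def abelian_group_def abelian_monoid.zero_closed)

lemma presheaf_add_closed:
  "\<lbrakk>presheaf k X F; openin X V; s \<in> \<Gamma> F V; t \<in> \<Gamma> F V\<rbrakk> \<Longrightarrow> s \<oplus>\<^bsub>sec F V\<^esub> t \<in> \<Gamma> F V"
  using presheaf_sec[of k X F V] by (simp add: left_module_def abelian_group_def abelian_monoid.a_closed)

lemma presheaf_smult_closed:
  "\<lbrakk>presheaf k X F; openin X V; c \<in> carrier k; s \<in> \<Gamma> F V\<rbrakk> \<Longrightarrow> c \<odot>\<^bsub>sec F V\<^esub> s \<in> \<Gamma> F V"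
  using left_module.smult_closed[OF presheaf_sec] .

lemma presheaf_minus_closed:
  "\<lbrakk>presheaf k X F; openin X V; s \<in> \<Gamma> F V; t \<in> \<Gamma> F V\<rbrakk> \<Longrightarrow> s \<ominus>\<^bsub>sec F V\<^esub> t \<in> \<Gamma> F V"
  using presheaf_sec[of k X F V] by (simp add: left_module_def abelian_group.minus_closed)

lemma presheaf_res_closed:
  "\<lbrakk>presheaf k X F; openin X V; openin X W; W \<subseteq> V; s \<in> \<Gamma> F V\<rbrakk> \<Longrightarrow> res F V W s \<in> \<Gamma> F W"
  using linear_map_closed[OF presheaf_res_linear] .

lemma sheaf_presheaf: "sheaf k X F \<Longrightarrow> presheaf k X F"
  by (simp add: sheaf_def)

lemma presheafI:
  assumes "\<And>V. openin X V \<Longrightarrow> left_module k (sec F V)"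
    and "\<And>V W. \<lbrakk>openin X V; openin X W; W \<subseteq> V\<rbrakk> \<Longrightarrow> linear_map k (sec F V) (sec F W) (res F V W)"
    and "\<And>V s. \<lbrakk>openin X V; s \<in> \<Gamma> F V\<rbrakk> \<Longrightarrow> res F V V s = s"
    and "\<And>V W W' s. \<lbrakk>openin X V; openin X W; openin X W'; W' \<subseteq> W; W \<subseteq> V; s \<in> \<Gamma> F V\<rbrakk> \<Longrightarrow>
      res F W W' (res F V W s) = res F V W' s"
  shows "presheaf k X F"
  using assms unfolding presheaf_def by (intro conjI allI impI ballI) simp_all

lemma sheafI:
  assumes "presheaf k X F"
    and "\<And>\<U> s t. \<lbrakk>\<And>U. U \<in> \<U> \<Longrightarrow> openin X U; s \<in> \<Gamma> F (\<Union>\<U>); t \<in> \<Gamma> F (\<Union>\<U>);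
        \<And>U. U \<in> \<U> \<Longrightarrow> res F (\<Union>\<U>) U s = res F (\<Union>\<U>) U t\<rbrakk> \<Longrightarrow> s = t"
    and "\<And>\<U> \<sigma>. \<lbrakk>\<And>U. U \<in> \<U> \<Longrightarrow> openin X U; \<And>U. U \<in> \<U> \<Longrightarrow> \<sigma> U \<in> \<Gamma> F U;
        \<And>U V. \<lbrakk>U \<in> \<U>; V \<in> \<U>\<rbrakk> \<Longrightarrow> res F U (U \<inter> V) (\<sigma> U) = res F V (U \<inter> V) (\<sigma> V)\<rbrakk> \<Longrightarrow>
      \<exists>s\<in>\<Gamma> F (\<Union>\<U>). \<forall>U\<in>\<U>. res F (\<Union>\<U>) U s = \<sigma> U"
  shows "sheaf k X F"
  unfolding sheaf_def
proof (intro conjI allI impI ballI)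
  fix \<U> s t
  assume a: "\<forall>U\<in>\<U>. openin X U" "s \<in> \<Gamma> F (\<Union>\<U>)" "t \<in> \<Gamma> F (\<Union>\<U>)"
    "\<forall>U\<in>\<U>. res F (\<Union>\<U>) U s = res F (\<Union>\<U>) U t"
  show "s = t"
    by (rule assms(2)[of \<U>]) (use a in blast)+
next
  fix \<U> \<sigma>
  assume a: "\<forall>U\<in>\<U>. openin X U" "(\<forall>U\<in>\<U>. \<sigma> U \<in> \<Gamma> F U) \<and>
    (\<forall>U\<in>\<U>. \<forall>V\<in>\<U>. res F U (U \<inter> V) (\<sigma> U) = res F V (U \<inter> V) (\<sigma> V))"
  show "\<exists>s\<in>\<Gamma> F (\<Union>\<U>). \<forall>U\<in>\<U>. res F (\<Union>\<U>) U s = \<sigma> U"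
    by (rule assms(3)[of \<U>]) (use a in blast)+
qed (rule assms(1))

lemma sheaf_restrict_open:
  assumes F: "sheaf k X F" and U: "openin X U"
  shows "sheaf k (subtopology X U) F"
proof (rule sheafI)
  have sub: "openin X V" if "openin (subtopology X U) V" for V
    using that openin_open_subtopology[OF U] by blast
  show "presheaf k (subtopology X U) F"
    by (rule presheafI) (simp_all add: sub presheafD[OF sheaf_presheaf[OF F]])
  fix \<U> assume op: "\<And>V. V \<in> \<U> \<Longrightarrow> openin (subtopology X U) V"
  then have op': "\<And>V. V \<in> \<U> \<Longrightarrow> openin X V"
    using sub by blast
  show "s = t" if "s \<in> \<Gamma> F (\<Union>\<U>)" "t \<in> \<Gamma> F (\<Union>\<U>)"
      "\<And>V. V \<in> \<U> \<Longrightarrow> res F (\<Union>\<U>) V s = res F (\<Union>\<U>) V t" for s t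
    using F[unfolded sheaf_def, THEN conjunct2, THEN spec, of \<U>] op' that by blast
  show "\<exists>s\<in>\<Gamma> F (\<Union>\<U>). \<forall>V\<in>\<U>. res F (\<Union>\<U>) V s = \<sigma> V"
    if "\<And>V. V \<in> \<U> \<Longrightarrow> \<sigma> V \<in> \<Gamma> F V"
      "\<And>V W. \<lbrakk>V \<in> \<U>; W \<in> \<U>\<rbrakk> \<Longrightarrow> res F V (V \<inter> W) (\<sigma> V) = res F W (V \<inter> W) (\<sigma> W)" for \<sigma>
    by (rule sheaf_glue[OF F op' that]) blast+
qed

text \<open>Morphisms are extensional, so a formula for their values has to be cut down to the sections over
  open sets.\<close>

definition family_hom ::
  "'x topology \<Rightarrow> ('x, 'k, 'a) presheaf \<Rightarrow> ('x set \<Rightarrow> 'a \<Rightarrow> 'b) \<Rightarrow> 'x set \<Rightarrow> 'a \<Rightarrow> 'b" where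
  "family_hom X F f = (\<lambda>V\<in>{V. openin X V}. \<lambda>s\<in>\<Gamma> F V. f V s)"

lemma family_hom_apply [simp]: "\<lbrakk>openin X V; s \<in> \<Gamma> F V\<rbrakk> \<Longrightarrow> family_hom X F f V s = f V s"
  by (simp add: family_hom_def)

lemma family_hom_cong:
  "(\<And>V s. \<lbrakk>openin X V; s \<in> \<Gamma> F V\<rbrakk> \<Longrightarrow> f V s = g V s) \<Longrightarrow> family_hom X F f = family_hom X F g"
  unfolding family_hom_def by (intro restrict_ext) auto

lemma family_hom_in:
  assumes "\<And>V s. \<lbrakk>openin X V; s \<in> \<Gamma> F V\<rbrakk> \<Longrightarrow> f V s \<in> \<Gamma> G V"
    and "\<And>V s t. \<lbrakk>openin X V; s \<in> \<Gamma> F V; t \<in> \<Gamma> F V\<rbrakk> \<Longrightarrow>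
      f V (s \<oplus>\<^bsub>sec F V\<^esub> t) = f V s \<oplus>\<^bsub>sec G V\<^esub> f V t"
    and "\<And>V c s. \<lbrakk>openin X V; c \<in> carrier k; s \<in> \<Gamma> F V\<rbrakk> \<Longrightarrow>
      f V (c \<odot>\<^bsub>sec F V\<^esub> s) = c \<odot>\<^bsub>sec G V\<^esub> f V s"
    and "\<And>V W s. \<lbrakk>openin X V; openin X W; W \<subseteq> V; s \<in> \<Gamma> F V\<rbrakk> \<Longrightarrow>
      f W (res F V W s) = res G V W (f V s)"
    and F: "presheaf k X F"
  shows "family_hom X F f \<in> sheaf_hom k X F G"
proof -
  have lin: "linear_map k (sec F V) (sec G V) (family_hom X F f V)" if V: "openin X V" for V
  proof -
    interpret F: left_module k "sec F V"
      by (rule presheaf_sec[OF F V])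
    show ?thesis
      using V assms(1-3) F.smult_closed by (auto simp: linear_map_def)
  qed
  have nat: "family_hom X F f W (res F V W s) = res G V W (family_hom X F f V s)"
    if "openin X V" "openin X W" "W \<subseteq> V" "s \<in> \<Gamma> F V" for V W s
    using that assms(4) linear_map_closed[OF presheaf_res_linear[OF F that(1-3)] that(4)] by simp
  have "family_hom X F f \<in> (\<Pi>\<^sub>E V\<in>{V. openin X V}. \<Gamma> F V \<rightarrow>\<^sub>E \<Gamma> G V)"
    unfolding family_hom_def using assms(1) by (simp add: PiE_def Pi_iff)
  then show ?thesis
    unfolding sheaf_hom_def using lin nat by auto
qed

lemma sheaf_comp_eq: "sheaf_comp X F \<psi> \<phi> = family_hom X F (\<lambda>V s. \<psi> V (\<phi> V s))"
  by (simp add: sheaf_comp_def family_hom_def)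

lemma sheaf_id_eq: "sheaf_id X F = family_hom X F (\<lambda>V s. s)"
  by (simp add: sheaf_id_def family_hom_def)

lemma sheaf_homD:
  assumes "\<phi> \<in> sheaf_hom k X F G" "openin X V"
  shows hom_linear: "linear_map k (sec F V) (sec G V) (\<phi> V)"
    and hom_closed: "s \<in> \<Gamma> F V \<Longrightarrow> \<phi> V s \<in> \<Gamma> G V"
    and hom_add: "\<lbrakk>s \<in> \<Gamma> F V; t \<in> \<Gamma> F V\<rbrakk> \<Longrightarrow> \<phi> V (s \<oplus>\<^bsub>sec F V\<^esub> t) = \<phi> V s \<oplus>\<^bsub>sec G V\<^esub> \<phi> V t"
    and hom_smult: "\<lbrakk>c \<in> carrier k; s \<in> \<Gamma> F V\<rbrakk> \<Longrightarrow> \<phi> V (c \<odot>\<^bsub>sec F V\<^esub> s) = c \<odot>\<^bsub>sec G V\<^esub> \<phi> V s"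
    and hom_res: "\<lbrakk>openin X W; W \<subseteq> V; s \<in> \<Gamma> F V\<rbrakk> \<Longrightarrow> \<phi> W (res F V W s) = res G V W (\<phi> V s)"
  using assms by (auto simp: sheaf_hom_def linear_map_def)

lemma hom_eqI:
  assumes "\<phi> \<in> sheaf_hom k X F G" "\<psi> \<in> sheaf_hom k X F G"
    and eq: "\<And>V s. \<lbrakk>openin X V; s \<in> \<Gamma> F V\<rbrakk> \<Longrightarrow> \<phi> V s = \<psi> V s"
  shows "\<phi> = \<psi>"
proof (rule PiE_ext[of _ "{V. openin X V}" "\<lambda>V. \<Gamma> F V \<rightarrow>\<^sub>E \<Gamma> G V"])
  fix V assume "V \<in> {V. openin X V}"
  then show "\<phi> V = \<psi> V"
    using assms(1,2) eq by (intro PiE_ext[of _ "\<Gamma> F V" "\<lambda>_. \<Gamma> G V"]) (auto simp: sheaf_hom_def PiE_iff)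
qed (use assms(1,2) in \<open>auto simp: sheaf_hom_def\<close>)

lemma hom_zero:
  assumes "presheaf k X F" "presheaf k X G" "\<phi> \<in> sheaf_hom k X F G" "openin X V"
  shows "\<phi> V \<zero>\<^bsub>sec F V\<^esub> = \<zero>\<^bsub>sec G V\<^esub>"
  by (rule linear_map_zero[OF presheaf_sec[OF assms(1,4)] presheaf_sec[OF assms(2,4)] hom_linear[OF assms(3,4)]])

lemma hom_minus:
  assumes "presheaf k X F" "presheaf k X G" "\<phi> \<in> sheaf_hom k X F G" "openin X V" "s \<in> \<Gamma> F V" "t \<in> \<Gamma> F V"
  shows "\<phi> V (s \<ominus>\<^bsub>sec F V\<^esub> t) = \<phi> V s \<ominus>\<^bsub>sec G V\<^esub> \<phi> V t"
  by (rule linear_map_minus[OF presheaf_sec[OF assms(1,4)] presheaf_sec[OF assms(2,4)] hom_linear[OF assms(3,4)] assms(5,6)])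

lemma res_zero:
  assumes "presheaf k X F" "openin X V" "openin X W" "W \<subseteq> V"
  shows "res F V W \<zero>\<^bsub>sec F V\<^esub> = \<zero>\<^bsub>sec F W\<^esub>"
  by (rule linear_map_zero[OF presheaf_sec[OF assms(1,2)] presheaf_sec[OF assms(1,3)] presheaf_res_linear[OF assms]])

lemma res_minus:
  assumes "presheaf k X F" "openin X V" "openin X W" "W \<subseteq> V" "s \<in> \<Gamma> F V" "t \<in> \<Gamma> F V"
  shows "res F V W (s \<ominus>\<^bsub>sec F V\<^esub> t) = res F V W s \<ominus>\<^bsub>sec F W\<^esub> res F V W t"
  by (rule linear_map_minus[OF presheaf_sec[OF assms(1,2)] presheaf_sec[OF assms(1,3)] presheaf_res_linear[OF assms(1-4)] assms(5,6)])

lemma sheaf_comp_hom: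
  assumes "presheaf k X F" "\<phi> \<in> sheaf_hom k X F G" "\<psi> \<in> sheaf_hom k X G H"
  shows "sheaf_comp X F \<psi> \<phi> \<in> sheaf_hom k X F H"
  unfolding sheaf_comp_eq
  by (rule family_hom_in[OF _ _ _ _ assms(1)])
    (simp_all add: sheaf_homD[OF assms(2)] sheaf_homD[OF assms(3)])

lemma sheaf_id_hom: "presheaf k X F \<Longrightarrow> sheaf_id X F \<in> sheaf_hom k X F F"
  unfolding sheaf_id_eq by (rule family_hom_in) simp_all

section \<open>Isomorphisms\<close>

definition bijective_hom where
  "bijective_hom k X F G \<phi> \<longleftrightarrow> \<phi> \<in> sheaf_hom k X F G \<and> (\<forall>V. openin X V \<longrightarrow> bij_betw (\<phi> V) (\<Gamma> F V) (\<Gamma> G V))"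

definition inv_hom where
  "inv_hom X F G \<phi> = family_hom X G (\<lambda>V. inv_into (\<Gamma> F V) (\<phi> V))"

text \<open>The target inherits from the source, through \<open>\<phi>\<close>, that its sections are closed under the module
  operations and under restriction; this makes the inverse a morphism.\<close>

lemma inv_hom:
  assumes F: "presheaf k X F" and \<phi>: "bijective_hom k X F G \<phi>"
  shows "inv_hom X F G \<phi> \<in> sheaf_hom k X G F"
    and "\<And>V s. \<lbrakk>openin X V; s \<in> \<Gamma> F V\<rbrakk> \<Longrightarrow> inv_hom X F G \<phi> V (\<phi> V s) = s"
    and "\<And>V t. \<lbrakk>openin X V; t \<in> \<Gamma> G V\<rbrakk> \<Longrightarrow> \<phi> V (inv_hom X F G \<phi> V t) = t"
proof -
  have hom: "\<phi> \<in> sheaf_hom k X F G" and bij: "\<And>V. openin X V \<Longrightarrow> bij_betw (\<phi> V) (\<Gamma> F V) (\<Gamma> G V)"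
    using \<phi> by (auto simp: bijective_hom_def)
  let ?i = "\<lambda>V. inv_into (\<Gamma> F V) (\<phi> V)"
  have ex: "\<exists>s\<in>\<Gamma> F V. t = \<phi> V s" if "openin X V" "t \<in> \<Gamma> G V" for V t
    using bij[OF that(1)] that(2) by (auto simp: bij_betw_def)
  have i: "?i V (\<phi> V s) = s" if "openin X V" "s \<in> \<Gamma> F V" for V s
    using bij[OF that(1)] that(2) by (simp add: bij_betw_def)
  note addF = presheaf_add_closed[OF F] and smF = presheaf_smult_closed[OF F]
  note resF = presheaf_res_closed[OF F]
  show 2: "\<And>V s. \<lbrakk>openin X V; s \<in> \<Gamma> F V\<rbrakk> \<Longrightarrow> inv_hom X F G \<phi> V (\<phi> V s) = s"
    by (simp add: inv_hom_def hom_closed[OF hom] i)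
  show 3: "\<And>V t. \<lbrakk>openin X V; t \<in> \<Gamma> G V\<rbrakk> \<Longrightarrow> \<phi> V (inv_hom X F G \<phi> V t) = t"
    using ex by (fastforce simp: inv_hom_def hom_closed[OF hom] i)
  have closed: "?i V t \<in> \<Gamma> F V" if "openin X V" "t \<in> \<Gamma> G V" for V t
    using ex[OF that] i[OF that(1)] by auto
  have addG: "t \<oplus>\<^bsub>sec G V\<^esub> u \<in> \<Gamma> G V \<and> ?i V (t \<oplus>\<^bsub>sec G V\<^esub> u) = ?i V t \<oplus>\<^bsub>sec F V\<^esub> ?i V u"
    if V: "openin X V" and tu: "t \<in> \<Gamma> G V" "u \<in> \<Gamma> G V" for V t u
  proof -
    obtain s r where sr: "s \<in> \<Gamma> F V" "r \<in> \<Gamma> F V" "t = \<phi> V s" "u = \<phi> V r"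
      using ex[OF V] tu by meson
    then have eq: "t \<oplus>\<^bsub>sec G V\<^esub> u = \<phi> V (s \<oplus>\<^bsub>sec F V\<^esub> r)"
      by (simp add: hom_add[OF hom V])
    show ?thesis
      unfolding eq using sr addF[OF V] by (simp add: i[OF V] hom_closed[OF hom V])
  qed
  have smG: "c \<odot>\<^bsub>sec G V\<^esub> t \<in> \<Gamma> G V \<and> ?i V (c \<odot>\<^bsub>sec G V\<^esub> t) = c \<odot>\<^bsub>sec F V\<^esub> ?i V t"
    if V: "openin X V" and c: "c \<in> carrier k" and t: "t \<in> \<Gamma> G V" for V c t
  proof -
    obtain s where s: "s \<in> \<Gamma> F V" "t = \<phi> V s"
      using ex[OF V t] by blast
    then have eq: "c \<odot>\<^bsub>sec G V\<^esub> t = \<phi> V (c \<odot>\<^bsub>sec F V\<^esub> s)"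
      by (simp add: hom_smult[OF hom V c])
    show ?thesis
      unfolding eq using s smF[OF V c] by (simp add: i[OF V] hom_closed[OF hom V])
  qed
  have resG: "res G V W t \<in> \<Gamma> G W \<and> ?i W (res G V W t) = res F V W (?i V t)"
    if V: "openin X V" and W: "openin X W" "W \<subseteq> V" and t: "t \<in> \<Gamma> G V" for V W t
  proof -
    obtain s where s: "s \<in> \<Gamma> F V" "t = \<phi> V s"
      using ex[OF V t] by blast
    then have eq: "res G V W t = \<phi> W (res F V W s)"
      by (simp add: hom_res[OF hom V W])
    show ?thesis
      unfolding eq using s resF[OF V W s(1)] W by (simp add: i V hom_closed[OF hom])
  qed
  have lin: "linear_map k (sec G V) (sec F V) (inv_hom X F G \<phi> V)" if V: "openin X V" for V
    using addG[OF V] smG[OF V] closed[OF V] V by (simp add: linear_map_def inv_hom_def)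
  moreover have "inv_hom X F G \<phi> \<in> (\<Pi>\<^sub>E V\<in>{V. openin X V}. \<Gamma> G V \<rightarrow>\<^sub>E \<Gamma> F V)"
    unfolding inv_hom_def family_hom_def using closed by (simp add: PiE_def Pi_iff)
  moreover have "inv_hom X F G \<phi> W (res G V W t) = res F V W (inv_hom X F G \<phi> V t)"
    if "openin X V" "openin X W" "W \<subseteq> V" "t \<in> \<Gamma> G V" for V W t
    using resG[OF that] that by (simp add: inv_hom_def)
  ultimately show "inv_hom X F G \<phi> \<in> sheaf_hom k X G F"
    unfolding sheaf_hom_def by auto
qed

lemma bijective_inv_hom:
  assumes F: "presheaf k X F" and \<phi>: "bijective_hom k X F G \<phi>"
  shows "bijective_hom k X G F (inv_hom X F G \<phi>)"
proof -
  have hom: "\<phi> \<in> sheaf_hom k X F G"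
    using \<phi> by (auto simp: bijective_hom_def)
  have "bij_betw (inv_hom X F G \<phi> V) (\<Gamma> G V) (\<Gamma> F V)" if V: "openin X V" for V
    by (rule bij_betw_byWitness[where f' = "\<phi> V"])
      (use inv_hom[OF F \<phi>] hom V in \<open>auto simp: hom_closed[OF hom V] hom_closed[OF inv_hom(1)[OF F \<phi>] V]\<close>)
  then show ?thesis
    by (simp add: bijective_hom_def inv_hom(1)[OF F \<phi>])
qed

lemma sheaf_iso_iff_bijective:
  assumes F: "presheaf k X F"
  shows "sheaf_iso k X F G \<longleftrightarrow> (\<exists>\<phi>. bijective_hom k X F G \<phi>)"
proof
  assume "sheaf_iso k X F G"
  then obtain \<phi> \<psi> where hom: "\<phi> \<in> sheaf_hom k X F G" "\<psi> \<in> sheaf_hom k X G F"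
    and eq: "sheaf_comp X F \<psi> \<phi> = sheaf_id X F" "sheaf_comp X G \<phi> \<psi> = sheaf_id X G"
    by (auto simp: sheaf_iso_def)
  have "\<psi> V (\<phi> V s) = s" if "openin X V" "s \<in> \<Gamma> F V" for V s
    using fun_cong[OF fun_cong[OF eq(1)], of V s] that by (simp add: sheaf_comp_eq sheaf_id_eq)
  moreover have "\<phi> V (\<psi> V t) = t" if "openin X V" "t \<in> \<Gamma> G V" for V t
    using fun_cong[OF fun_cong[OF eq(2)], of V t] that by (simp add: sheaf_comp_eq sheaf_id_eq)
  ultimately have "bijective_hom k X F G \<phi>"
    unfolding bijective_hom_def using hom
    by (intro conjI allI impI bij_betw_byWitness[of _ "\<psi> _" "\<phi> _"]) (auto simp: hom_closed)
  then show "\<exists>\<phi>. bijective_hom k X F G \<phi>"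
    by blast
next
  assume "\<exists>\<phi>. bijective_hom k X F G \<phi>"
  then obtain \<phi> where \<phi>: "bijective_hom k X F G \<phi>" ..
  then have hom: "\<phi> \<in> sheaf_hom k X F G"
    by (simp add: bijective_hom_def)
  show "sheaf_iso k X F G"
    unfolding sheaf_iso_def
    by (intro bexI[of _ \<phi>] bexI[of _ "inv_hom X F G \<phi>"] conjI hom inv_hom(1)[OF F \<phi>])
      (auto simp: sheaf_comp_eq sheaf_id_eq inv_hom(2,3)[OF F \<phi>] intro!: family_hom_cong)
qed

text \<open>Bijectivity on a base of the topology suffices: a section of the target lifts uniquely over the
  members of the base, and the lifts glue by uniqueness.\<close>

lemma bijective_hom_of_base:
  assumes F: "sheaf k X F" and G: "sheaf k X G" and \<phi>: "\<phi> \<in> sheaf_hom k X F G"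
    and base: "\<And>V x. \<lbrakk>openin X V; x \<in> V\<rbrakk> \<Longrightarrow> \<exists>W. openin X W \<and> x \<in> W \<and> W \<subseteq> V \<and> bij_betw (\<phi> W) (\<Gamma> F W) (\<Gamma> G W)"
  shows "bijective_hom k X F G \<phi>"
proof -
  have inj: "s = t" if V: "openin X V" and st: "s \<in> \<Gamma> F V" "t \<in> \<Gamma> F V" and eq: "\<phi> V s = \<phi> V t" for V s t
  proof (rule sheaf_separate[OF F V st])
    fix x assume "x \<in> V"
    then obtain W where W: "openin X W" "x \<in> W" "W \<subseteq> V" "bij_betw (\<phi> W) (\<Gamma> F W) (\<Gamma> G W)"
      using base[OF V] by blast
    have "\<phi> W (res F V W s) = \<phi> W (res F V W t)"
      using eq by (simp add: hom_res[OF \<phi> V W(1,3)] st)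
    then have "res F V W s = res F V W t"
      using W(4) sheaf_res_closed[OF F V W(1,3)] st by (auto simp: bij_betw_def inj_on_def)
    then show "\<exists>W. openin X W \<and> x \<in> W \<and> W \<subseteq> V \<and> res F V W s = res F V W t"
      using W by blast
  qed
  have surj: "\<exists>s\<in>\<Gamma> F V. \<phi> V s = t" if V: "openin X V" and t: "t \<in> \<Gamma> G V" for V t
  proof -
    define \<U> where "\<U> = {W. openin X W \<and> W \<subseteq> V \<and> bij_betw (\<phi> W) (\<Gamma> F W) (\<Gamma> G W)}"
    have U: "\<Union>\<U> = V"
      unfolding \<U>_def using base[OF V] by blast
    have "\<exists>s. s \<in> \<Gamma> F W \<and> \<phi> W s = res G V W t" if "W \<in> \<U>" for W
    proof -
      have "res G V W t \<in> \<phi> W ` \<Gamma> F W"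
        using that sheaf_res_closed[OF G V, of W t] t by (auto simp: \<U>_def bij_betw_def)
      then show ?thesis
        by force
    qed
    then obtain \<sigma> where \<sigma>: "\<And>W. W \<in> \<U> \<Longrightarrow> \<sigma> W \<in> \<Gamma> F W" "\<And>W. W \<in> \<U> \<Longrightarrow> \<phi> W (\<sigma> W) = res G V W t"
      by metis
    have op: "openin X W" "W \<subseteq> V" if "W \<in> \<U>" for W
      using that by (auto simp: \<U>_def)
    have val: "\<phi> A (res F W A (\<sigma> W)) = res G V A t" if "W \<in> \<U>" "openin X A" "A \<subseteq> W" for W A
      using that op[OF that(1)] by (simp add: hom_res[OF \<phi>] \<sigma> sheaf_res_res[OF G V] t)
    obtain s where s: "s \<in> \<Gamma> F (\<Union>\<U>)" "\<And>W. W \<in> \<U> \<Longrightarrow> res F (\<Union>\<U>) W s = \<sigma> W"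
    proof (rule sheaf_glue[OF F, of \<U> \<sigma>])
      fix W W' assume W: "W \<in> \<U>" "W' \<in> \<U>"
      then have I: "openin X (W \<inter> W')"
        using op by blast
      show "res F W (W \<inter> W') (\<sigma> W) = res F W' (W \<inter> W') (\<sigma> W')"
        by (rule inj[OF I]) (use W I in \<open>simp_all add: val sheaf_res_closed[OF F op(1)] \<sigma>\<close>)
    qed (use op \<sigma> in auto)
    have sV: "s \<in> \<Gamma> F V"
      using s(1) U by simp
    have "\<phi> V s = t"
    proof (rule sheaf_separate[OF G V hom_closed[OF \<phi> V sV] t])
      fix x assume "x \<in> V"
      then obtain W where W: "W \<in> \<U>" "x \<in> W"
        using U by blast
      then have "res G V W (\<phi> V s) = res G V W t"
        using s(2)[OF W(1)] U by (simp add: hom_res[OF \<phi> V, symmetric] op sV \<sigma>)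
      then show "\<exists>W. openin X W \<and> x \<in> W \<and> W \<subseteq> V \<and> res G V W (\<phi> V s) = res G V W t"
        using W op by blast
    qed
    with sV show ?thesis by blast
  qed
  have "bij_betw (\<phi> V) (\<Gamma> F V) (\<Gamma> G V)" if V: "openin X V" for V
    unfolding bij_betw_def
  proof (intro conjI inj_onI)
    show "\<phi> V ` \<Gamma> F V = \<Gamma> G V"
      using surj[OF V] hom_closed[OF \<phi> V] by blast
  qed (use inj[OF V] in blast)
  then show ?thesis
    by (simp add: bijective_hom_def \<phi>)
qed

section \<open>Rigid open sets\<close>

text \<open>Being constant, seen from the sections over connected sets: no isomorphism with a constant sheaf
  has to be carried around.\<close>

definition rigid_on :: "'x topology \<Rightarrow> ('x, 'k, 'a) presheaf \<Rightarrow> 'x set \<Rightarrow> bool" where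
  "rigid_on X F U \<longleftrightarrow> openin X U \<and> connectedin X U \<and>
     (\<forall>W. openin X W \<and> connectedin X W \<and> W \<noteq> {} \<and> W \<subseteq> U \<longrightarrow>
        bij_betw (res F U W) (\<Gamma> F U) (\<Gamma> F W))"

lemma locally_connected_obtain:
  assumes "locally_connected_space X" "openin X V" "x \<in> V"
  obtains W where "openin X W" "connectedin X W" "x \<in> W" "W \<subseteq> V"
  using assms unfolding locally_connected_space by blast

lemma rigid_on_open: "rigid_on X F U \<Longrightarrow> openin X U"
  by (simp add: rigid_on_def)

lemma rigid_on_bij:
  "\<lbrakk>rigid_on X F U; openin X W; connectedin X W; W \<noteq> {}; W \<subseteq> U\<rbrakk> \<Longrightarrow>
    bij_betw (res F U W) (\<Gamma> F U) (\<Gamma> F W)"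
  by (simp add: rigid_on_def)

lemma rigid_on_mono:
  assumes F: "presheaf k X F" and U: "rigid_on X F U"
    and V: "openin X V" "connectedin X V" "V \<noteq> {}" "V \<subseteq> U"
  shows "rigid_on X F V"
  unfolding rigid_on_def
proof (intro conjI V allI impI; elim conjE)
  fix W assume W: "openin X W" "connectedin X W" "W \<noteq> {}" "W \<subseteq> V"
  have "bij_betw (res F V W \<circ> res F U V) (\<Gamma> F U) (\<Gamma> F W) \<longleftrightarrow> bij_betw (res F U W) (\<Gamma> F U) (\<Gamma> F W)"
    by (rule bij_betw_cong) (simp add: presheaf_res_res[OF F rigid_on_open[OF U] V(1) W(1,4) V(4)])
  moreover have "bij_betw (res F U W) (\<Gamma> F U) (\<Gamma> F W)"
    by (rule rigid_on_bij[OF U W(1-3)]) (use W(4) V(4) in blast)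
  ultimately have "bij_betw (res F V W \<circ> res F U V) (\<Gamma> F U) (\<Gamma> F W)"
    by (rule iffD2)
  then show "bij_betw (res F V W) (\<Gamma> F V) (\<Gamma> F W)"
    by (rule iffD2[OF bij_betw_comp_iff[OF rigid_on_bij[OF U V]]])
qed

lemma rigid_on_extend:
  assumes "rigid_on X F U" "openin X W" "connectedin X W" "W \<noteq> {}" "W \<subseteq> U" "t \<in> \<Gamma> F W"
  obtains s where "s \<in> \<Gamma> F U" "res F U W s = t"
proof -
  have "t \<in> res F U W ` \<Gamma> F U"
    using assms(6) by (simp add: bij_betw_imp_surj_on[OF rigid_on_bij[OF assms(1-5)]])
  then show ?thesis
    using that by auto
qed

lemma rigid_on_eqI:
  assumes "rigid_on X F U" "openin X W" "connectedin X W" "W \<noteq> {}" "W \<subseteq> U"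
    "s \<in> \<Gamma> F U" "t \<in> \<Gamma> F U" "res F U W s = res F U W t"
  shows "s = t"
  by (rule inj_onD[OF bij_betw_imp_inj_on[OF rigid_on_bij[OF assms(1-5)]] assms(8,6,7)])

lemma rigid_on_iso:
  assumes \<phi>: "bijective_hom k X F G \<phi>" and U: "rigid_on X F U"
  shows "rigid_on X G U"
  unfolding rigid_on_def
proof (intro conjI allI impI; (elim conjE)?)
  fix W assume W: "openin X W" "connectedin X W" "W \<noteq> {}" "W \<subseteq> U"
  have hom: "\<phi> \<in> sheaf_hom k X F G" and bij: "\<And>V. openin X V \<Longrightarrow> bij_betw (\<phi> V) (\<Gamma> F V) (\<Gamma> G V)"
    using \<phi> by (auto simp: bijective_hom_def)
  have "bij_betw (res G U W \<circ> \<phi> U) (\<Gamma> F U) (\<Gamma> G W) \<longleftrightarrow>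
      bij_betw (\<phi> W \<circ> res F U W) (\<Gamma> F U) (\<Gamma> G W)"
    by (rule bij_betw_cong) (simp add: hom_res[OF hom rigid_on_open[OF U] W(1,4)])
  moreover have "bij_betw (\<phi> W \<circ> res F U W) (\<Gamma> F U) (\<Gamma> G W)"
    by (rule bij_betw_trans[OF rigid_on_bij[OF U W] bij[OF W(1)]])
  ultimately have "bij_betw (res G U W \<circ> \<phi> U) (\<Gamma> F U) (\<Gamma> G W)"
    by (rule iffD2)
  then show "bij_betw (res G U W) (\<Gamma> G U) (\<Gamma> G W)"
    by (rule iffD2[OF bij_betw_comp_iff[OF bij[OF rigid_on_open[OF U]]]])
qed (use U in \<open>auto simp: rigid_on_def\<close>)

lemma rigid_on_subtopology:
  assumes U: "openin X U"
  shows "rigid_on (subtopology X U) F V \<longleftrightarrow> rigid_on X F V \<and> V \<subseteq> U"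
  unfolding rigid_on_def openin_open_subtopology[OF U] connectedin_subtopology by blast

lemma const_section:
  "\<lbrakk>openin X V; m \<in> carrier M\<rbrakk> \<Longrightarrow> (\<lambda>x\<in>V. m) \<in> \<Gamma> (const_sheaf X M) V"
  by (rule const_sheaf_carrierI) auto

lemma const_sheaf_connected:
  assumes V: "openin X V" "connectedin X V" "V \<noteq> {}" and s: "s \<in> \<Gamma> (const_sheaf X M) V"
  obtains m where "m \<in> carrier M" "s = (\<lambda>x\<in>V. m)"
proof -
  have s': "s \<in> V \<rightarrow>\<^sub>E carrier M"
    by (rule const_sheaf_fun[OF V(1) s])
  have "continuous_map (subtopology X V) (discrete_topology (carrier M)) s"
    using s by (simp add: const_sheaf_def)
  moreover have "connectedin (subtopology X V) V"
    using V(2) by (simp add: connectedin_subtopology)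
  ultimately have "connectedin (discrete_topology (carrier M)) (s ` V)"
    by (rule connectedin_continuous_map_image)
  then obtain m where m: "s ` V \<subseteq> {m}"
    by (auto simp: connectedin_discrete_topology)
  show ?thesis
  proof
    show "s = (\<lambda>x\<in>V. m)"
      by (rule extensionalityI[of _ V]) (use s' m in \<open>auto simp: PiE_def\<close>)
    show "m \<in> carrier M"
      using V(3) s' m by fastforce
  qed
qed

text \<open>Over nonempty connected sets the sections are the constant functions, that is, the elements of \<open>M\<close>.\<close>

lemma const_sheaf_rigid:
  assumes U: "openin X U" "connectedin X U"
  shows "rigid_on X (const_sheaf X M) U"
  unfolding rigid_on_def
proof (intro conjI U allI impI; elim conjE)
  fix W assume W: "openin X W" "connectedin X W" "W \<noteq> {}" "W \<subseteq> U"
  then have "U \<noteq> {}"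
    by blast
  have eq: "restrict (\<lambda>x\<in>U. m) W = (\<lambda>x\<in>W. m)" for m
    using W(4) by (auto simp: fun_eq_iff restrict_def)
  show "bij_betw (res (const_sheaf X M) U W) (\<Gamma> (const_sheaf X M) U) (\<Gamma> (const_sheaf X M) W)"
    unfolding bij_betw_def
  proof (intro conjI inj_onI subset_antisym subsetI)
    fix s t assume st: "s \<in> \<Gamma> (const_sheaf X M) U" "t \<in> \<Gamma> (const_sheaf X M) U"
      and rst: "res (const_sheaf X M) U W s = res (const_sheaf X M) U W t"
    obtain m where m: "s = (\<lambda>x\<in>U. m)"
      using const_sheaf_connected[OF U \<open>U \<noteq> {}\<close> st(1)] by blast
    obtain n where n: "t = (\<lambda>x\<in>U. n)"
      using const_sheaf_connected[OF U \<open>U \<noteq> {}\<close> st(2)] by blast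
    obtain x where "x \<in> W"
      using W(3) by blast
    then have "m = n"
      using fun_cong[OF rst, of x] W(4) by (auto simp: m n)
    then show "s = t"
      by (simp add: m n)
  next
    fix t assume "t \<in> res (const_sheaf X M) U W ` \<Gamma> (const_sheaf X M) U"
    then obtain s where s: "s \<in> \<Gamma> (const_sheaf X M) U" "t = restrict s W"
      by auto
    obtain m where "m \<in> carrier M" "s = (\<lambda>x\<in>U. m)"
      using const_sheaf_connected[OF U \<open>U \<noteq> {}\<close> s(1)] by blast
    then show "t \<in> \<Gamma> (const_sheaf X M) W"
      using const_section[OF W(1)] unfolding s(2) by (simp only: eq)
  next
    fix t assume "t \<in> \<Gamma> (const_sheaf X M) W"
    then obtain m where m: "m \<in> carrier M" "t = (\<lambda>x\<in>W. m)"
      using const_sheaf_connected[OF W(1-3)] by blast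
    then have "t = res (const_sheaf X M) U W (\<lambda>x\<in>U. m)"
      by (simp only: eq const_sheaf_res)
    then show "t \<in> res (const_sheaf X M) U W ` \<Gamma> (const_sheaf X M) U"
      using const_section[OF U(1) m(1)] by blast
  qed
qed

text \<open>If \<open>F\<close> is rigid on \<open>U\<close>, the constant sheaf with value \<open>F(U)\<close> maps to \<open>F\<close> by the adjunction. Over a
  connected open subset this map is the restriction from \<open>U\<close>, so it is bijective there.\<close>

lemma rigid_on_imp_iso_const:
  assumes X: "locally_connected_space X" and F: "sheaf k X F" and U: "rigid_on X F U"
  shows "sheaf_iso k (subtopology X U) F (const_sheaf (subtopology X U) (sec F U))"
proof -
  have opU: "openin X U"
    by (rule rigid_on_open[OF U])
  let ?Y = "subtopology X U" and ?M = "sec F U"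
  let ?C = "const_sheaf ?Y ?M"
  have op: "openin ?Y V \<longleftrightarrow> openin X V \<and> V \<subseteq> U" for V
    by (rule openin_open_subtopology[OF opU])
  have top: "topspace ?Y = U"
    using openin_subset[OF opU] by auto
  have FY: "sheaf k ?Y F"
    by (rule sheaf_restrict_open[OF F opU])
  have M: "left_module k ?M"
    by (rule sheaf_sec[OF F opU])
  have C: "sheaf k ?Y ?C"
    by (rule const_sheaf_sheaf[OF M])
  have "(\<lambda>m\<in>carrier ?M. m) \<in> {f \<in> extensional (carrier ?M). linear_map k ?M (sec F (topspace ?Y)) f}"
    using left_module.smult_closed[OF M] abelian_monoid.a_closed[OF abelian_group.axioms(1), of ?M] M
    unfolding top by (auto simp: linear_map_def left_module_def)
  then obtain \<phi> where \<phi>: "\<phi> \<in> sheaf_hom k ?Y ?C F"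
    and eq: "(\<lambda>m\<in>carrier ?M. \<phi> (topspace ?Y) (\<lambda>x\<in>topspace ?Y. m)) = (\<lambda>m\<in>carrier ?M. m)"
    using const_sheaf_adjunction[OF M FY] unfolding bij_betw_def image_iff by (metis (no_types, lifting) imageE)
  have \<phi>U: "\<phi> U (\<lambda>x\<in>U. m) = m" if "m \<in> \<Gamma> F U" for m
    using fun_cong[OF eq, of m] that unfolding top by simp
  have opUY: "openin ?Y U"
    using op opU by blast
  have \<phi>V: "\<phi> V (\<lambda>x\<in>V. m) = res F U V m" if V: "openin X V" "V \<subseteq> U" and m: "m \<in> \<Gamma> F U" for V m
  proof -
    have "\<phi> V (res ?C U V (\<lambda>x\<in>U. m)) = res F U V (\<phi> U (\<lambda>x\<in>U. m))"
      by (rule hom_res[OF \<phi>]) (use V op opU const_section[OF opUY m] in auto)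
    moreover have "res ?C U V (\<lambda>x\<in>U. m) = (\<lambda>x\<in>V. m)"
      using V(2) by (auto simp: fun_eq_iff restrict_def)
    ultimately show ?thesis
      by (simp add: \<phi>U m)
  qed
  have "bijective_hom k ?Y ?C F \<phi>"
  proof (rule bijective_hom_of_base[OF C FY \<phi>])
    fix V x assume V: "openin ?Y V" and x: "x \<in> V"
    then have "openin X V" "V \<subseteq> U"
      using op by auto
    then obtain W where W: "openin X W" "connectedin X W" "x \<in> W" "W \<subseteq> V"
      using locally_connected_obtain[OF X _ x] by metis
    have WU: "W \<subseteq> U" and ne: "W \<noteq> {}"
      using W \<open>V \<subseteq> U\<close> by auto
    have WY: "openin ?Y W" "connectedin ?Y W"
      using W WU by (auto simp: op connectedin_subtopology)
    have bij: "bij_betw (res F U W) (\<Gamma> F U) (\<Gamma> F W)"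
      by (rule rigid_on_bij[OF U W(1,2) ne WU])
    have "bij_betw (\<phi> W) (\<Gamma> ?C W) (\<Gamma> F W)"
      unfolding bij_betw_def
    proof (intro conjI inj_onI subset_antisym subsetI)
      fix s t assume st: "s \<in> \<Gamma> ?C W" "t \<in> \<Gamma> ?C W" "\<phi> W s = \<phi> W t"
      obtain m where m: "m \<in> \<Gamma> F U" "s = (\<lambda>x\<in>W. m)"
        using const_sheaf_connected[OF WY ne st(1)] by blast
      obtain n where n: "n \<in> \<Gamma> F U" "t = (\<lambda>x\<in>W. n)"
        using const_sheaf_connected[OF WY ne st(2)] by blast
      have "res F U W m = res F U W n"
        using st(3) by (simp add: m n \<phi>V W(1) WU)
      then have "m = n"
        using bij m n by (auto simp: bij_betw_def inj_on_def)
      then show "s = t"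
        by (simp add: m n)
    next
      fix t assume "t \<in> \<phi> W ` \<Gamma> ?C W"
      then show "t \<in> \<Gamma> F W"
        using hom_closed[OF \<phi> WY(1)] by blast
    next
      fix t assume "t \<in> \<Gamma> F W"
      then obtain m where m: "m \<in> \<Gamma> F U" "t = res F U W m"
        using bij by (auto simp: bij_betw_def)
      then have "t = \<phi> W (\<lambda>x\<in>W. m)"
        by (simp add: \<phi>V W(1) WU)
      then show "t \<in> \<phi> W ` \<Gamma> ?C W"
        using const_section[OF WY(1) m(1)] by blast
    qed
    then show "\<exists>W. openin ?Y W \<and> x \<in> W \<and> W \<subseteq> V \<and> bij_betw (\<phi> W) (\<Gamma> ?C W) (\<Gamma> F W)"
      using WY(1) W(3,4) by blast
  qed
  then have "bijective_hom k ?Y F ?C (inv_hom ?Y ?C F \<phi>)"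
    by (rule bijective_inv_hom[OF sheaf_presheaf[OF C]])
  then show ?thesis
    using sheaf_iso_iff_bijective[OF sheaf_presheaf[OF FY]] by blast
qed

text \<open>Connectedness enters in both directions through the base of connected open sets: it supplies a
  connected neighbourhood inside one on which \<open>F\<close> is constant, and it lets an isomorphism be tested
  on connected sets.\<close>

lemma locally_constant_iff_rigid:
  fixes k :: "('k, 'r) ring_scheme" and X :: "'x topology" and F :: "('x, 'k, 'a) presheaf"
  assumes X: "locally_connected_space X"
  shows "locally_constant k X F \<longleftrightarrow> sheaf k X F \<and> (\<forall>x\<in>topspace X. \<exists>U. x \<in> U \<and> rigid_on X F U)"
proof (intro iffI conjI ballI)
  assume F: "locally_constant k X F"
  show shF: "sheaf k X F"
    using F by (simp add: locally_constant_def)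
  fix x assume "x \<in> topspace X"
  then obtain U and M :: "('k, 'a) module" where U: "openin X U" "x \<in> U" and M: "left_module k M"
    and iso: "sheaf_iso k (subtopology X U) F (const_sheaf (subtopology X U) M)"
    using F unfolding locally_constant_def by blast
  obtain V where V: "openin X V" "connectedin X V" "x \<in> V" "V \<subseteq> U"
    using locally_connected_obtain[OF X U] by blast
  let ?Y = "subtopology X U"
  have FY: "presheaf k ?Y F"
    by (rule sheaf_presheaf[OF sheaf_restrict_open[OF shF U(1)]])
  obtain \<phi> where \<phi>: "bijective_hom k ?Y F (const_sheaf ?Y M) \<phi>"
    using iso sheaf_iso_iff_bijective[OF FY] by blast
  have "rigid_on ?Y (const_sheaf ?Y M) V"
    by (rule const_sheaf_rigid) (use V U in \<open>auto simp: openin_open_subtopology connectedin_subtopology\<close>)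
  then have "rigid_on ?Y F V"
    by (rule rigid_on_iso[OF bijective_inv_hom[OF FY \<phi>]])
  then show "\<exists>U. x \<in> U \<and> rigid_on X F U"
    using rigid_on_subtopology[OF U(1)] V(3) by blast
next
  assume F: "sheaf k X F \<and> (\<forall>x\<in>topspace X. \<exists>U. x \<in> U \<and> rigid_on X F U)"
  show "locally_constant k X F"
    unfolding locally_constant_def
  proof (intro conjI ballI)
    fix x assume "x \<in> topspace X"
    then obtain U where U: "x \<in> U" "rigid_on X F U"
      using F by meson
    have shF: "sheaf k X F"
      using F by blast
    show "\<exists>U. openin X U \<and> x \<in> U \<and> (\<exists>M :: ('k, 'a) module. left_module k M \<and>
        sheaf_iso k (subtopology X U) F (const_sheaf (subtopology X U) M))"
      by (intro exI[of _ U] exI[of _ "sec F U"] conjI rigid_on_open[OF U(2)] U(1)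
          sheaf_sec[OF shF rigid_on_open[OF U(2)]] rigid_on_imp_iso_const[OF X shF U(2)])
  qed (use F in blast)
qed

section \<open>Rigidity of cokernels\<close>

lemma right_exactD:
  assumes "right_exact_seq k X F G H \<phi> \<psi>"
  shows right_exact_hom: "\<phi> \<in> sheaf_hom k X F G" "\<psi> \<in> sheaf_hom k X G H"
    and right_exact_kernel: "openin X V \<Longrightarrow>
      t \<in> \<Gamma> G V \<and> \<psi> V t = \<zero>\<^bsub>sec H V\<^esub> \<longleftrightarrow>
      t \<in> \<Gamma> G V \<and> (\<forall>x\<in>V. \<exists>W. openin X W \<and> x \<in> W \<and> W \<subseteq> V \<and> res G V W t \<in> \<phi> W ` \<Gamma> F W)"
    and right_exact_surj: "\<lbrakk>openin X V; q \<in> \<Gamma> H V; x \<in> V\<rbrakk> \<Longrightarrow>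
      \<exists>W. openin X W \<and> x \<in> W \<and> W \<subseteq> V \<and> (\<exists>t\<in>\<Gamma> G W. res H V W q = \<psi> W t)"
proof -
  show "\<phi> \<in> sheaf_hom k X F G" "\<psi> \<in> sheaf_hom k X G H"
    using assms by (simp_all add: right_exact_seq_def)
  have im: "image_sections X F G \<phi> V = kernel_sections G H \<psi> V"
    "image_sections X G H \<psi> V = \<Gamma> H V" if "openin X V" for V
    using assms that by (simp_all add: right_exact_seq_def)
  show "openin X V \<Longrightarrow> t \<in> \<Gamma> G V \<and> \<psi> V t = \<zero>\<^bsub>sec H V\<^esub> \<longleftrightarrow>
      t \<in> \<Gamma> G V \<and> (\<forall>x\<in>V. \<exists>W. openin X W \<and> x \<in> W \<and> W \<subseteq> V \<and> res G V W t \<in> \<phi> W ` \<Gamma> F W)"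
    using im(1)[of V] by (auto simp: image_sections_def kernel_sections_def)
  show "\<exists>W. openin X W \<and> x \<in> W \<and> W \<subseteq> V \<and> (\<exists>t\<in>\<Gamma> G W. res H V W q = \<psi> W t)"
    if "openin X V" "q \<in> \<Gamma> H V" "x \<in> V"
  proof -
    have "q \<in> image_sections X G H \<psi> V"
      using im(2)[OF that(1)] that(2) by blast
    then show ?thesis
      using that(3) unfolding image_sections_def by blast
  qed
qed

lemma right_exact_comp_zero:
  assumes G: "presheaf k X G" and ex: "right_exact_seq k X F G H \<phi> \<psi>" and V: "openin X V" and s: "s \<in> \<Gamma> F V"
  shows "\<psi> V (\<phi> V s) = \<zero>\<^bsub>sec H V\<^esub>"
proof -
  have \<phi>: "\<phi> \<in> sheaf_hom k X F G"
    by (rule right_exact_hom[OF ex])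
  have "res G V V (\<phi> V s) \<in> \<phi> V ` \<Gamma> F V"
    using presheaf_res_self[OF G V hom_closed[OF \<phi> V s]] s by auto
  then show ?thesis
    using right_exact_kernel[OF ex V, of "\<phi> V s"] hom_closed[OF \<phi> V s] V by blast
qed

locale right_exact_rigid =
  fixes k :: "('k, 'r) ring_scheme" and X :: "'x topology"
    and F :: "('x, 'k, 'a) presheaf" and G :: "('x, 'k, 'b) presheaf" and H :: "('x, 'k, 'c) presheaf"
    and \<phi> \<psi> U
  assumes X: "locally_connected_space X"
    and F: "presheaf k X F" and G: "presheaf k X G" and H: "sheaf k X H"
    and ex: "right_exact_seq k X F G H \<phi> \<psi>"
    and FU: "rigid_on X F U" and GU: "rigid_on X G U"
begin

lemma \<phi>: "\<phi> \<in> sheaf_hom k X F G" and \<psi>: "\<psi> \<in> sheaf_hom k X G H"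
  using right_exact_hom[OF ex] by auto

text \<open>An element of the kernel comes from \<open>F\<close> near some point. By rigidity of \<open>F\<close> the preimage extends to
  \<open>W\<close>, and by rigidity of \<open>G\<close> the extension is still a preimage. Hence the image in \<open>H\<close>
  of a section over \<open>W\<close> vanishes as soon as it vanishes on a nonempty open subset.\<close>

lemma lift_kernel:
  assumes W: "openin X W" "connectedin X W" "W \<subseteq> U" and t: "t \<in> \<Gamma> G W"
    and A: "openin X A" "A \<noteq> {}" "A \<subseteq> W" and z: "\<psi> A (res G W A t) = \<zero>\<^bsub>sec H A\<^esub>"
  obtains s where "s \<in> \<Gamma> F W" "\<phi> W s = t"
proof -
  have ne: "W \<noteq> {}"
    using A by blast
  have FW: "rigid_on X F W" and GW: "rigid_on X G W"
    by (rule rigid_on_mono[OF F FU W(1,2) ne W(3)] rigid_on_mono[OF G GU W(1,2) ne W(3)])+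
  obtain x where x: "x \<in> A"
    using A by blast
  obtain B s where B: "openin X B" "x \<in> B" "B \<subseteq> A" and s: "s \<in> \<Gamma> F B" "res G A B (res G W A t) = \<phi> B s"
    using right_exact_kernel[OF ex A(1), of "res G W A t"] presheaf_res_closed[OF G W(1) A(1,3) t] z x by blast
  obtain C where C: "openin X C" "connectedin X C" "x \<in> C" "C \<subseteq> B"
    using locally_connected_obtain[OF X B(1,2)] by blast
  have CW: "C \<subseteq> W" and Cne: "C \<noteq> {}"
    using A B C by auto
  have tB: "res G W B t = \<phi> B s"
    using s(2) presheaf_res_res[OF G W(1) A(1) B(1,3) A(3) t] by simp
  obtain s' where s': "s' \<in> \<Gamma> F W" "res F W C s' = res F B C s"
    using rigid_on_extend[OF FW C(1,2) Cne CW presheaf_res_closed[OF F B(1) C(1,4) s(1)]] by blast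
  have "res G W C (\<phi> W s') = \<phi> C (res F B C s)"
    using hom_res[OF \<phi> W(1) C(1) CW s'(1)] s'(2) by simp
  also have "\<dots> = res G B C (res G W B t)"
    using hom_res[OF \<phi> B(1) C(1,4) s(1)] tB by simp
  also have "\<dots> = res G W C t"
    by (rule presheaf_res_res[OF G W(1) B(1) C(1,4) _ t]) (use A B in blast)
  finally have "\<phi> W s' = t"
    by (intro rigid_on_eqI[OF GW C(1,2) Cne CW hom_closed[OF \<phi> W(1) s'(1)] t])
  with s'(1) show ?thesis
    by (rule that)
qed

text \<open>A section over a connected set lifts near one point, and the lift extends to the whole set. The
  points near which the extension is still a lift form an open set, and so do the others: two
  local lifts that agree somewhere as sections of \<open>H\<close> differ by an element of the kernel, which comes
  from \<open>F\<close> on the whole set.\<close>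

lemma lift_section:
  assumes W: "openin X W" "connectedin X W" "W \<noteq> {}" "W \<subseteq> U" and q: "q \<in> \<Gamma> H W"
  obtains t where "t \<in> \<Gamma> G W" "\<psi> W t = q"
proof -
  have GW: "rigid_on X G W"
    by (rule rigid_on_mono[OF G GU W])
  interpret GW: left_module k "sec G W"
    by (rule presheaf_sec[OF G W(1)])
  have near: "\<exists>C t. openin X C \<and> y \<in> C \<and> C \<subseteq> W \<and> t \<in> \<Gamma> G W \<and> res H W C q = res H W C (\<psi> W t)"
    if y: "y \<in> W" for y
  proof -
    obtain B u where B: "openin X B" "y \<in> B" "B \<subseteq> W" and u: "u \<in> \<Gamma> G B" "res H W B q = \<psi> B u"
      using right_exact_surj[OF ex W(1) q y] by blast
    obtain C where C: "openin X C" "connectedin X C" "y \<in> C" "C \<subseteq> B"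
      using locally_connected_obtain[OF X B(1,2)] by blast
    have CW: "C \<subseteq> W" and ne: "C \<noteq> {}"
      using B C by auto
    obtain t where t: "t \<in> \<Gamma> G W" "res G W C t = res G B C u"
      using rigid_on_extend[OF GW C(1,2) ne CW presheaf_res_closed[OF G B(1) C(1,4) u(1)]] by blast
    have "res H W C q = res H B C (\<psi> B u)"
      using sheaf_res_res[OF H W(1) B(1) C(1,4) B(3) q] u by simp
    also have "\<dots> = res H W C (\<psi> W t)"
      by (simp add: hom_res[OF \<psi>, symmetric] B(1) C(1,4) W(1) CW t u(1))
    finally show ?thesis
      using C CW t(1) by blast
  qed
  obtain x where x: "x \<in> W"
    using W(3) by blast
  then obtain t A where t: "t \<in> \<Gamma> G W"
    and A: "openin X A" "x \<in> A" "A \<subseteq> W" "res H W A q = res H W A (\<psi> W t)"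
    using near by blast
  define \<S> where "\<S> = {B. openin X B \<and> B \<subseteq> W \<and> res H W B q = res H W B (\<psi> W t)}"
  define \<T> where "\<T> = {C. openin X C \<and> C \<subseteq> W \<and> C \<inter> \<Union>\<S> = {}}"
  have \<psi>t: "\<psi> W t \<in> \<Gamma> H W"
    by (rule hom_closed[OF \<psi> W(1) t])
  have cover: "y \<in> \<Union>\<S> \<union> \<Union>\<T>" if y: "y \<in> W" for y
  proof -
    obtain C u where C: "openin X C" "y \<in> C" "C \<subseteq> W" and u: "u \<in> \<Gamma> G W" "res H W C q = res H W C (\<psi> W u)"
      using near[OF y] by blast
    show ?thesis
    proof (cases "C \<inter> \<Union>\<S> = {}")
      case True
      then show ?thesis
        using C by (auto simp: \<T>_def)
    next
      case False
      then obtain z B where z: "z \<in> C" "z \<in> B" and B: "openin X B" "B \<subseteq> W" "res H W B q = res H W B (\<psi> W t)"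
        by (auto simp: \<S>_def)
      let ?D = "B \<inter> C" and ?d = "u \<ominus>\<^bsub>sec G W\<^esub> t"
      have D: "openin X ?D" "?D \<noteq> {}" "?D \<subseteq> W"
        using z B C by auto
      have d: "?d \<in> \<Gamma> G W"
        using u t by simp
      have \<psi>u: "\<psi> W u \<in> \<Gamma> H W"
        by (rule hom_closed[OF \<psi> W(1) u(1)])
      have "res H W ?D (\<psi> W u) = res H C ?D (res H W C (\<psi> W u))"
        using sheaf_res_res[OF H W(1) C(1) D(1) _ C(3) \<psi>u] by simp
      also have "\<dots> = res H W ?D q"
        using sheaf_res_res[OF H W(1) C(1) D(1) _ C(3) q] by (simp add: u(2)[symmetric])
      also have "\<dots> = res H B ?D (res H W B (\<psi> W t))"
        using sheaf_res_res[OF H W(1) B(1) D(1) _ B(2) q] by (simp add: B(3)[symmetric])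
      also have "\<dots> = res H W ?D (\<psi> W t)"
        using sheaf_res_res[OF H W(1) B(1) D(1) _ B(2) \<psi>t] by simp
      finally have eqD: "res H W ?D (\<psi> W u) = res H W ?D (\<psi> W t)" .
      have "\<psi> ?D (res G W ?D ?d) = res H W ?D (\<psi> W u \<ominus>\<^bsub>sec H W\<^esub> \<psi> W t)"
        using hom_res[OF \<psi> W(1) D(1,3) d] hom_minus[OF G sheaf_presheaf[OF H] \<psi> W(1) u(1) t] by simp
      also have "\<dots> = \<zero>\<^bsub>sec H ?D\<^esub>"
        using res_minus[OF sheaf_presheaf[OF H] W(1) D(1,3) \<psi>u \<psi>t] eqD
          left_module_minus_eq_zero[OF sheaf_sec[OF H D(1)]] sheaf_res_closed[OF H W(1) D(1,3) \<psi>t] by simp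
      finally obtain s where s: "s \<in> \<Gamma> F W" "\<phi> W s = ?d"
        using lift_kernel[OF W(1,2,4) d D] by blast
      have "\<psi> W u \<ominus>\<^bsub>sec H W\<^esub> \<psi> W t = \<zero>\<^bsub>sec H W\<^esub>"
        using right_exact_comp_zero[OF G ex W(1) s(1)] s(2)
          hom_minus[OF G sheaf_presheaf[OF H] \<psi> W(1) u(1) t] by simp
      then have "\<psi> W u = \<psi> W t"
        using left_module_minus_eq_zero[OF sheaf_sec[OF H W(1)] \<psi>u \<psi>t] by simp
      then have "C \<in> \<S>"
        using C u(2) by (simp add: \<S>_def)
      then show ?thesis
        using C(2) by blast
    qed
  qed
  have "openin X (\<Union>\<S>)" "openin X (\<Union>\<T>)" "\<Union>\<S> \<inter> \<Union>\<T> = {}"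
    by (auto simp: \<S>_def \<T>_def)
  moreover have "x \<in> \<Union>\<S> \<inter> W"
    using A x by (auto simp: \<S>_def)
  moreover have "W \<subseteq> \<Union>\<S> \<union> \<Union>\<T>"
    using cover by blast
  ultimately have "\<Union>\<T> \<inter> W = {}"
    using W(2) unfolding connectedin by blast
  then have "W \<subseteq> \<Union>\<S>"
    using cover by blast
  have "\<psi> W t = q"
  proof (rule sheaf_separate[OF H W(1) \<psi>t q])
    fix y assume "y \<in> W"
    then obtain B where "B \<in> \<S>" "y \<in> B"
      using \<open>W \<subseteq> \<Union>\<S>\<close> by blast
    then show "\<exists>B. openin X B \<and> y \<in> B \<and> B \<subseteq> W \<and> res H W B (\<psi> W t) = res H W B q"
      by (auto simp: \<S>_def)
  qed
  with t show ?thesis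
    by (rule that)
qed

text \<open>Over connected sets \<open>H\<close> is thus the cokernel of \<open>F \<rightarrow> G\<close> on sections, and \<open>F\<close> and \<open>G\<close> have the same
  sections over \<open>U\<close> and \<open>W\<close>.\<close>

lemma rigid_on_cokernel: "rigid_on X H U"
  unfolding rigid_on_def
proof (intro conjI allI impI; (elim conjE)?)
  show U: "openin X U" "connectedin X U"
    using FU by (simp_all add: rigid_on_def)
  fix W assume W: "openin X W" "connectedin X W" "W \<noteq> {}" "W \<subseteq> U"
  have ne: "U \<noteq> {}"
    using W by blast
  show "bij_betw (res H U W) (\<Gamma> H U) (\<Gamma> H W)"
    unfolding bij_betw_def
  proof (intro conjI inj_onI subset_antisym subsetI)
    fix q r assume qr: "q \<in> \<Gamma> H U" "r \<in> \<Gamma> H U" and eq: "res H U W q = res H U W r"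
    interpret GU: left_module k "sec G U"
      by (rule presheaf_sec[OF G U(1)])
    obtain t where t: "t \<in> \<Gamma> G U" "\<psi> U t = q"
      using lift_section[OF U ne subset_refl qr(1)] by blast
    obtain u where u: "u \<in> \<Gamma> G U" "\<psi> U u = r"
      using lift_section[OF U ne subset_refl qr(2)] by blast
    let ?d = "t \<ominus>\<^bsub>sec G U\<^esub> u"
    have d: "?d \<in> \<Gamma> G U"
      using t u by simp
    have \<psi>d: "\<psi> U ?d = q \<ominus>\<^bsub>sec H U\<^esub> r"
      using hom_minus[OF G sheaf_presheaf[OF H] \<psi> U(1) t(1) u(1)] t u by simp
    have "\<psi> W (res G U W ?d) = res H U W (q \<ominus>\<^bsub>sec H U\<^esub> r)"
      using hom_res[OF \<psi> U(1) W(1,4) d] \<psi>d by simp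
    also have "\<dots> = \<zero>\<^bsub>sec H W\<^esub>"
      using res_minus[OF sheaf_presheaf[OF H] U(1) W(1,4) qr] eq
        left_module_minus_eq_zero[OF sheaf_sec[OF H W(1)]] sheaf_res_closed[OF H U(1) W(1,4) qr(2)] by simp
    finally obtain s where "s \<in> \<Gamma> F U" "\<phi> U s = ?d"
      using lift_kernel[OF U subset_refl d W(1,3,4)] by blast
    then have "q \<ominus>\<^bsub>sec H U\<^esub> r = \<zero>\<^bsub>sec H U\<^esub>"
      using right_exact_comp_zero[OF G ex U(1)] \<psi>d by metis
    then show "q = r"
      using left_module_minus_eq_zero[OF sheaf_sec[OF H U(1)] qr] by simp
  next
    fix r assume "r \<in> res H U W ` \<Gamma> H U"
    then show "r \<in> \<Gamma> H W"
      using sheaf_res_closed[OF H U(1) W(1,4)] by blast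
  next
    fix r assume "r \<in> \<Gamma> H W"
    then obtain t where t: "t \<in> \<Gamma> G W" "\<psi> W t = r"
      using lift_section[OF W] by blast
    obtain u where u: "u \<in> \<Gamma> G U" "res G U W u = t"
      using rigid_on_extend[OF GU W t(1)] by blast
    have "res H U W (\<psi> U u) = r"
      using hom_res[OF \<psi> U(1) W(1,4) u(1)] u t by simp
    then show "r \<in> res H U W ` \<Gamma> H U"
      using hom_closed[OF \<psi> U(1) u(1)] by blast
  qed
qed

end

lemmas rigid_on_cokernel = right_exact_rigid.rigid_on_cokernel[OF right_exact_rigid.intro]

section \<open>Transport of structure\<close>

lemma left_module_image:
  assumes M: "left_module k M" and f: "linear_map k M N f"
    and surj: "f ` carrier M = carrier N" and zero: "\<zero>\<^bsub>N\<^esub> = f \<zero>\<^bsub>M\<^esub>"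
  shows "left_module k N"
proof -
  interpret M: left_module k M by fact
  note add = linear_map_add[OF f, symmetric] and sm = linear_map_smult[OF f, symmetric]
  have cl: "f x \<in> carrier N" if "x \<in> carrier M" for x
    using linear_map_closed[OF f that] .
  have ex: "\<exists>x\<in>carrier M. y = f x" if "y \<in> carrier N" for y
    using that surj by auto
  show ?thesis
  proof (rule left_moduleI[OF M.R.ring_axioms], goal_cases)
    case 1 show ?case by (simp add: zero cl)
  next
    case (2 x y) then show ?case by (auto dest!: ex simp: add cl)
  next
    case (3 a x) then show ?case by (auto dest!: ex simp: sm cl M.smult_closed)
  next
    case (4 x y z) then show ?case by (auto dest!: ex simp: add M.M.a_assoc)
  next
    case (5 x y) then show ?case by (auto dest!: ex simp: add M.M.a_comm)
  next
    case (6 x) then show ?case by (auto dest!: ex simp: zero add)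
  next
    case (7 x) then show ?case by (auto dest!: ex simp: zero sm M.zero_smult)
  next
    case (8 a b x) then show ?case by (auto dest!: ex simp: add sm M.smult_closed M.smult_l_distr)
  next
    case (9 a x y) then show ?case by (auto dest!: ex simp: add sm M.smult_closed M.smult_r_distr)
  next
    case (10 a b x) then show ?case by (auto dest!: ex simp: sm M.smult_closed M.smult_assoc)
  next
    case (11 x) then show ?case by (auto dest!: ex simp: sm M.smult_one)
  qed
qed

text \<open>A bijective family of maps \<open>\<phi>\<close> carries the module axioms and the sheaf axioms along. Linear maps
  say nothing of the designated zero of a structure that is not yet known to be a module, hence the
  separate hypothesis.\<close>

lemma presheaf_transport:
  assumes F: "presheaf k X F" and \<phi>: "bijective_hom k X F G \<phi>"
    and zero: "\<And>V. openin X V \<Longrightarrow> \<zero>\<^bsub>sec G V\<^esub> = \<phi> V \<zero>\<^bsub>sec F V\<^esub>"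
  shows "presheaf k X G"
proof -
  have hom: "\<phi> \<in> sheaf_hom k X F G" and bij: "\<And>V. openin X V \<Longrightarrow> bij_betw (\<phi> V) (\<Gamma> F V) (\<Gamma> G V)"
    using \<phi> by (auto simp: bijective_hom_def)
  have ex: "\<exists>s\<in>\<Gamma> F V. t = \<phi> V s" if "openin X V" "t \<in> \<Gamma> G V" for V t
    using bij_betw_imp_surj_on[OF bij[OF that(1)]] that(2) by auto
  note resF = presheaf_res_closed[OF F]
  have r: "res G V W (\<phi> V s) = \<phi> W (res F V W s)" if "openin X V" "openin X W" "W \<subseteq> V" "s \<in> \<Gamma> F V" for V W s
    by (rule hom_res[OF hom that, symmetric])
  show ?thesis
  proof (rule presheafI)
    fix V assume V: "openin X V"
    show mod: "left_module k (sec G V)"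
      by (rule left_module_image[OF presheaf_sec[OF F V] hom_linear[OF hom V]
            bij_betw_imp_surj_on[OF bij[OF V]] zero[OF V]])
    show "res G V V s = s" if "s \<in> \<Gamma> G V" for s
      using ex[OF V that] V by (auto simp: r presheaf_res_self[OF F])
    fix W assume W: "openin X W" "W \<subseteq> V"
    interpret FV: left_module k "sec F V" by (rule presheaf_sec[OF F V])
    note lin = presheaf_res_linear[OF F V W]
    show "linear_map k (sec G V) (sec G W) (res G V W)"
      unfolding linear_map_def
    proof (intro conjI ballI)
      show "res G V W \<in> \<Gamma> G V \<rightarrow> \<Gamma> G W"
        by (auto dest!: ex[OF V] simp: r V W resF hom_closed[OF hom])
      fix s assume s: "s \<in> \<Gamma> G V"
      show "res G V W (s \<oplus>\<^bsub>sec G V\<^esub> t) = res G V W s \<oplus>\<^bsub>sec G W\<^esub> res G V W t" if "t \<in> \<Gamma> G V" for t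
        using s that by (auto dest!: ex[OF V] simp: r V W resF hom_add[OF hom, symmetric] linear_map_add[OF lin])
      show "res G V W (c \<odot>\<^bsub>sec G V\<^esub> s) = c \<odot>\<^bsub>sec G W\<^esub> res G V W s" if "c \<in> carrier k" for c
        using s that by (auto dest!: ex[OF V] simp: r V W resF hom_smult[OF hom, symmetric]
            linear_map_smult[OF lin] FV.smult_closed)
    qed
    fix W' s assume "openin X W'" "W' \<subseteq> W" "s \<in> \<Gamma> G V"
    then show "res G W W' (res G V W s) = res G V W' s"
      using W by (auto dest!: ex[OF V] simp: r V resF presheaf_res_res[OF F])
  qed
qed

lemma sheaf_transport:
  assumes F: "sheaf k X F" and \<phi>: "bijective_hom k X F G \<phi>"
    and zero: "\<And>V. openin X V \<Longrightarrow> \<zero>\<^bsub>sec G V\<^esub> = \<phi> V \<zero>\<^bsub>sec F V\<^esub>"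
  shows "sheaf k X G"
proof (rule sheafI)
  have hom: "\<phi> \<in> sheaf_hom k X F G"
    using \<phi> by (auto simp: bijective_hom_def)
  let ?\<psi> = "inv_hom X F G \<phi>"
  note \<psi> = inv_hom[OF sheaf_presheaf[OF F] \<phi>]
  show "presheaf k X G"
    by (rule presheaf_transport[OF sheaf_presheaf[OF F] \<phi> zero])
  fix \<U> assume op: "\<And>U. U \<in> \<U> \<Longrightarrow> openin X U"
  have V: "openin X (\<Union>\<U>)"
    using op by blast
  show "s = t" if s: "s \<in> \<Gamma> G (\<Union>\<U>)" and t: "t \<in> \<Gamma> G (\<Union>\<U>)"
    and eq: "\<And>U. U \<in> \<U> \<Longrightarrow> res G (\<Union>\<U>) U s = res G (\<Union>\<U>) U t" for s t
  proof -
    have "?\<psi> (\<Union>\<U>) s = ?\<psi> (\<Union>\<U>) t"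
    proof (rule sheaf_separate[OF F V hom_closed[OF \<psi>(1) V s] hom_closed[OF \<psi>(1) V t]])
      fix x assume "x \<in> \<Union>\<U>"
      then obtain U where U: "U \<in> \<U>" "x \<in> U"
        by blast
      then have "U \<subseteq> \<Union>\<U>"
        by blast
      then have "res F (\<Union>\<U>) U (?\<psi> (\<Union>\<U>) s) = res F (\<Union>\<U>) U (?\<psi> (\<Union>\<U>) t)"
        using eq[OF U(1)] by (simp add: hom_res[OF \<psi>(1) V op[OF U(1)], symmetric] s t)
      with U \<open>U \<subseteq> \<Union>\<U>\<close> op[OF U(1)] show "\<exists>W. openin X W \<and> x \<in> W \<and> W \<subseteq> \<Union>\<U> \<and>
          res F (\<Union>\<U>) W (?\<psi> (\<Union>\<U>) s) = res F (\<Union>\<U>) W (?\<psi> (\<Union>\<U>) t)"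
        by (intro exI[of _ U]) simp
    qed
    then have "\<phi> (\<Union>\<U>) (?\<psi> (\<Union>\<U>) s) = \<phi> (\<Union>\<U>) (?\<psi> (\<Union>\<U>) t)"
      by simp
    then show "s = t"
      by (simp add: \<psi>(3)[OF V] s t)
  qed
  show "\<exists>s\<in>\<Gamma> G (\<Union>\<U>). \<forall>U\<in>\<U>. res G (\<Union>\<U>) U s = \<sigma> U"
    if \<sigma>: "\<And>U. U \<in> \<U> \<Longrightarrow> \<sigma> U \<in> \<Gamma> G U"
      and compat: "\<And>U V. \<lbrakk>U \<in> \<U>; V \<in> \<U>\<rbrakk> \<Longrightarrow> res G U (U \<inter> V) (\<sigma> U) = res G V (U \<inter> V) (\<sigma> V)" for \<sigma>
  proof -
    obtain s where s: "s \<in> \<Gamma> F (\<Union>\<U>)" "\<And>U. U \<in> \<U> \<Longrightarrow> res F (\<Union>\<U>) U s = ?\<psi> U (\<sigma> U)"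
    proof (rule sheaf_glue[OF F op, of \<U> "\<lambda>U. ?\<psi> U (\<sigma> U)"])
      fix U V assume UV: "U \<in> \<U>" "V \<in> \<U>"
      then have I: "openin X (U \<inter> V)"
        using op by blast
      show "res F U (U \<inter> V) (?\<psi> U (\<sigma> U)) = res F V (U \<inter> V) (?\<psi> V (\<sigma> V))"
        using compat[OF UV] by (simp add: hom_res[OF \<psi>(1) op _ _ \<sigma>, symmetric] I UV)
    qed (use hom_closed[OF \<psi>(1) op] \<sigma> in auto)
    show ?thesis
    proof (intro bexI[of _ "\<phi> (\<Union>\<U>) s"] ballI)
      fix U assume U: "U \<in> \<U>"
      then have "U \<subseteq> \<Union>\<U>"
        by blast
      then show "res G (\<Union>\<U>) U (\<phi> (\<Union>\<U>) s) = \<sigma> U"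
        using s U by (simp add: hom_res[OF hom V op[OF U] _ s(1), symmetric] \<psi>(3)[OF op] \<sigma>)
    qed (rule hom_closed[OF hom V s(1)])
  qed
qed

lemma right_exact_seqI:
  assumes "\<phi> \<in> sheaf_hom k X F G" "\<psi> \<in> sheaf_hom k X G H"
    and "\<And>V t. \<lbrakk>openin X V; t \<in> \<Gamma> G V; \<psi> V t = \<zero>\<^bsub>sec H V\<^esub>\<rbrakk> \<Longrightarrow>
      \<forall>x\<in>V. \<exists>W. openin X W \<and> x \<in> W \<and> W \<subseteq> V \<and> res G V W t \<in> \<phi> W ` \<Gamma> F W"
    and "\<And>V t. \<lbrakk>openin X V; t \<in> \<Gamma> G V;
        \<forall>x\<in>V. \<exists>W. openin X W \<and> x \<in> W \<and> W \<subseteq> V \<and> res G V W t \<in> \<phi> W ` \<Gamma> F W\<rbrakk> \<Longrightarrow> \<psi> V t = \<zero>\<^bsub>sec H V\<^esub>"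
    and "\<And>V q x. \<lbrakk>openin X V; q \<in> \<Gamma> H V; x \<in> V\<rbrakk> \<Longrightarrow>
      \<exists>W. openin X W \<and> x \<in> W \<and> W \<subseteq> V \<and> res H V W q \<in> \<psi> W ` \<Gamma> G W"
  shows "right_exact_seq k X F G H \<phi> \<psi>"
  unfolding right_exact_seq_def
proof (intro conjI assms(1,2) allI impI)
  fix V assume V: "openin X V"
  show "image_sections X F G \<phi> V = kernel_sections G H \<psi> V"
    unfolding image_sections_def kernel_sections_def using assms(3,4)[OF V] by (intro Collect_cong) blast
  show "image_sections X G H \<psi> V = \<Gamma> H V"
    unfolding image_sections_def using assms(5)[OF V] by blast
qed

lemma right_exact_kernelD:
  assumes "right_exact_seq k X F G H \<phi> \<psi>" "openin X V" "t \<in> \<Gamma> G V" "\<psi> V t = \<zero>\<^bsub>sec H V\<^esub>" "x \<in> V"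
  shows "\<exists>W. openin X W \<and> x \<in> W \<and> W \<subseteq> V \<and> res G V W t \<in> \<phi> W ` \<Gamma> F W"
  using right_exact_kernel[OF assms(1,2), THEN iffD1, OF conjI[OF assms(3,4)]] assms(5) by blast

lemma right_exact_kernelI:
  assumes "right_exact_seq k X F G H \<phi> \<psi>" "openin X V" "t \<in> \<Gamma> G V"
    "\<And>x. x \<in> V \<Longrightarrow> \<exists>W. openin X W \<and> x \<in> W \<and> W \<subseteq> V \<and> res G V W t \<in> \<phi> W ` \<Gamma> F W"
  shows "\<psi> V t = \<zero>\<^bsub>sec H V\<^esub>"
  using right_exact_kernel[OF assms(1,2), THEN iffD2, OF conjI[OF assms(3) ballI[OF assms(4)]]] by blast

lemma right_exact_iso_target:
  assumes G: "presheaf k X G" and H: "presheaf k X H" and H': "presheaf k X H'"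
    and ex: "right_exact_seq k X F G H \<phi> \<psi>" and \<gamma>: "bijective_hom k X H H' \<gamma>"
  shows "right_exact_seq k X F G H' \<phi> (sheaf_comp X G \<gamma> \<psi>)"
proof -
  note \<phi> = right_exact_hom(1)[OF ex] and \<psi> = right_exact_hom(2)[OF ex]
  have hom: "\<gamma> \<in> sheaf_hom k X H H'" and bij: "\<And>V. openin X V \<Longrightarrow> bij_betw (\<gamma> V) (\<Gamma> H V) (\<Gamma> H' V)"
    using \<gamma> by (auto simp: bijective_hom_def)
  note \<delta> = inv_hom[OF H \<gamma>]
  have zero: "sheaf_comp X G \<gamma> \<psi> V t = \<zero>\<^bsub>sec H' V\<^esub> \<longleftrightarrow> \<psi> V t = \<zero>\<^bsub>sec H V\<^esub>" if V: "openin X V" and t: "t \<in> \<Gamma> G V" for V t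
  proof -
    interpret H: left_module k "sec H V" by (rule presheaf_sec[OF H V])
    have "\<gamma> V (\<psi> V t) = \<gamma> V \<zero>\<^bsub>sec H V\<^esub> \<longleftrightarrow> \<psi> V t = \<zero>\<^bsub>sec H V\<^esub>"
      by (rule inj_on_eq_iff[OF bij_betw_imp_inj_on[OF bij[OF V]] hom_closed[OF \<psi> V t]]) simp
    then show ?thesis
      by (simp add: sheaf_comp_eq V t hom_zero[OF H H' hom V])
  qed
  show ?thesis
  proof (rule right_exact_seqI[OF \<phi> sheaf_comp_hom[OF G \<psi> hom]])
    fix V q x assume V: "openin X V" and q: "q \<in> \<Gamma> H' V" and x: "x \<in> V"
    obtain W t where W: "openin X W" "x \<in> W" "W \<subseteq> V" and t: "t \<in> \<Gamma> G W" "res H V W (inv_hom X H H' \<gamma> V q) = \<psi> W t"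
      using right_exact_surj[OF ex V hom_closed[OF \<delta>(1) V q] x] by blast
    have "res H' V W q = \<gamma> W (\<psi> W t)"
      using hom_res[OF hom V W(1,3) hom_closed[OF \<delta>(1) V q]] by (simp add: \<delta>(3)[OF V q] t(2))
    then have "res H' V W q \<in> sheaf_comp X G \<gamma> \<psi> W ` \<Gamma> G W"
      using t(1) W(1) by (auto simp: sheaf_comp_eq intro!: image_eqI[of _ _ t])
    then show "\<exists>W. openin X W \<and> x \<in> W \<and> W \<subseteq> V \<and> res H' V W q \<in> sheaf_comp X G \<gamma> \<psi> W ` \<Gamma> G W"
      using W by (intro exI[of _ W]) simp
  qed (simp_all add: zero right_exact_kernelD[OF ex] right_exact_kernelI[OF ex])
qed

lemma right_exact_iso_source:
  assumes F': "presheaf k X F'" and ex: "right_exact_seq k X F G H \<phi> \<psi>" and \<alpha>: "bijective_hom k X F' F \<alpha>"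
  shows "right_exact_seq k X F' G H (sheaf_comp X F' \<phi> \<alpha>) \<psi>"
proof -
  have hom: "\<alpha> \<in> sheaf_hom k X F' F" and bij: "\<And>V. openin X V \<Longrightarrow> bij_betw (\<alpha> V) (\<Gamma> F' V) (\<Gamma> F V)"
    using \<alpha> by (auto simp: bijective_hom_def)
  have im: "sheaf_comp X F' \<phi> \<alpha> W ` \<Gamma> F' W = \<phi> W ` \<Gamma> F W" if "openin X W" for W
    using that unfolding bij_betw_imp_surj_on[OF bij[OF that], symmetric] by (auto simp: sheaf_comp_eq)
  have eq: "openin X W \<and> x \<in> W \<and> W \<subseteq> V \<and> res G V W t \<in> sheaf_comp X F' \<phi> \<alpha> W ` \<Gamma> F' W \<longleftrightarrow>
      openin X W \<and> x \<in> W \<and> W \<subseteq> V \<and> res G V W t \<in> \<phi> W ` \<Gamma> F W" for W x V t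
    using im by blast
  show ?thesis
    using ex sheaf_comp_hom[OF F' hom right_exact_hom(1)[OF ex]]
    unfolding right_exact_seq_def image_sections_def eq by simp
qed

lemma right_exact_iso_middle:
  assumes F: "presheaf k X F" and G: "presheaf k X G" and G': "presheaf k X G'"
    and ex: "right_exact_seq k X F G H \<phi> \<psi>" and \<beta>: "bijective_hom k X G G' \<beta>"
  shows "right_exact_seq k X F G' H (sheaf_comp X F \<beta> \<phi>) (sheaf_comp X G' \<psi> (inv_hom X G G' \<beta>))"
proof -
  note \<phi> = right_exact_hom(1)[OF ex] and \<psi> = right_exact_hom(2)[OF ex]
  have hom: "\<beta> \<in> sheaf_hom k X G G'"
    using \<beta> by (auto simp: bijective_hom_def)
  let ?\<delta> = "inv_hom X G G' \<beta>"
  note \<delta> = inv_hom[OF G \<beta>]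
  have im: "res G' V W t \<in> sheaf_comp X F \<beta> \<phi> W ` \<Gamma> F W \<longleftrightarrow> res G V W (?\<delta> V t) \<in> \<phi> W ` \<Gamma> F W"
    if V: "openin X V" and W: "openin X W" "W \<subseteq> V" and t: "t \<in> \<Gamma> G' V" for V W t
  proof -
    have r: "?\<delta> W (res G' V W t) = res G V W (?\<delta> V t)"
      by (rule hom_res[OF \<delta>(1) V W t])
    have rt: "res G' V W t \<in> \<Gamma> G' W"
      by (rule presheaf_res_closed[OF G' V W t])
    have "res G' V W t = \<beta> W (\<phi> W s) \<longleftrightarrow> res G V W (?\<delta> V t) = \<phi> W s" if "s \<in> \<Gamma> F W" for s
      using \<delta>(2)[OF W(1) hom_closed[OF \<phi> W(1) that]] \<delta>(3)[OF W(1) rt] r by metis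
    then show ?thesis
      using W(1) by (auto simp: sheaf_comp_eq image_iff)
  qed
  have eq: "openin X W \<and> x \<in> W \<and> W \<subseteq> V \<and> res G' V W t \<in> sheaf_comp X F \<beta> \<phi> W ` \<Gamma> F W \<longleftrightarrow>
      openin X W \<and> x \<in> W \<and> W \<subseteq> V \<and> res G V W (?\<delta> V t) \<in> \<phi> W ` \<Gamma> F W"
    if "openin X V" "t \<in> \<Gamma> G' V" for W x V t
    using im[OF that(1) _ _ that(2)] by blast
  show ?thesis
  proof (rule right_exact_seqI[OF sheaf_comp_hom[OF F \<phi> hom] sheaf_comp_hom[OF G' \<delta>(1) \<psi>]])
    fix V q x assume V: "openin X V" and q: "q \<in> \<Gamma> H V" and x: "x \<in> V"
    obtain W t where W: "openin X W" "x \<in> W" "W \<subseteq> V" and t: "t \<in> \<Gamma> G W" "res H V W q = \<psi> W t"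
      using right_exact_surj[OF ex V q x] by blast
    have "res H V W q \<in> sheaf_comp X G' \<psi> ?\<delta> W ` \<Gamma> G' W"
      using t W(1) hom_closed[OF hom W(1) t(1)]
      by (auto simp: sheaf_comp_eq \<delta>(2) intro!: image_eqI[of _ _ "\<beta> W t"])
    then show "\<exists>W. openin X W \<and> x \<in> W \<and> W \<subseteq> V \<and> res H V W q \<in> sheaf_comp X G' \<psi> ?\<delta> W ` \<Gamma> G' W"
      using W by (intro exI[of _ W]) simp
  next
    fix V t assume V: "openin X V" and t: "t \<in> \<Gamma> G' V"
    note dt = hom_closed[OF \<delta>(1) V t]
    have z: "sheaf_comp X G' \<psi> ?\<delta> V t = \<psi> V (?\<delta> V t)"
      using V t by (simp add: sheaf_comp_eq)
    show "\<forall>x\<in>V. \<exists>W. openin X W \<and> x \<in> W \<and> W \<subseteq> V \<and> res G' V W t \<in> sheaf_comp X F \<beta> \<phi> W ` \<Gamma> F W"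
      if "sheaf_comp X G' \<psi> ?\<delta> V t = \<zero>\<^bsub>sec H V\<^esub>"
      unfolding eq[OF V t] using right_exact_kernelD[OF ex V dt] that unfolding z by blast
    show "sheaf_comp X G' \<psi> ?\<delta> V t = \<zero>\<^bsub>sec H V\<^esub>"
      if "\<forall>x\<in>V. \<exists>W. openin X W \<and> x \<in> W \<and> W \<subseteq> V \<and> res G' V W t \<in> sheaf_comp X F \<beta> \<phi> W ` \<Gamma> F W"
      unfolding z by (rule right_exact_kernelI[OF ex V dt]) (use that[unfolded eq[OF V t]] in blast)
  qed
qed

section \<open>Free modules and exactness of the constant sheaf\<close>

definition free_module :: "('k, 'r) ring_scheme \<Rightarrow> 'i set \<Rightarrow> ('k, 'i \<Rightarrow> 'k) module" where
  "free_module k I = prod_module I (\<lambda>_. regular_module k)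
     \<lparr>carrier := {f \<in> I \<rightarrow>\<^sub>E carrier k. finite {i \<in> I. f i \<noteq> \<zero>\<^bsub>k\<^esub>}}\<rparr>"

lemma free_module_simps [simp]:
  "carrier (free_module k I) = {f \<in> I \<rightarrow>\<^sub>E carrier k. finite {i \<in> I. f i \<noteq> \<zero>\<^bsub>k\<^esub>}}"
  "\<zero>\<^bsub>free_module k I\<^esub> = (\<lambda>i\<in>I. \<zero>\<^bsub>k\<^esub>)"
  "f \<oplus>\<^bsub>free_module k I\<^esub> g = (\<lambda>i\<in>I. f i \<oplus>\<^bsub>k\<^esub> g i)"
  "c \<odot>\<^bsub>free_module k I\<^esub> f = (\<lambda>i\<in>I. c \<otimes>\<^bsub>k\<^esub> f i)"
  by (simp_all add: free_module_def prod_module_def)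

lemma left_module_free:
  assumes k: "ring k"
  shows "left_module k (free_module k I)"
  unfolding free_module_def
proof (rule left_module_submodule[OF left_module_prod[OF k left_module_regular[OF k]]])
  interpret k: ring k by fact
  show "\<zero>\<^bsub>prod_module I (\<lambda>_. regular_module k)\<^esub> \<in> {f \<in> I \<rightarrow>\<^sub>E carrier k. finite {i \<in> I. f i \<noteq> \<zero>\<^bsub>k\<^esub>}}"
    by auto
  fix f assume f: "f \<in> {f \<in> I \<rightarrow>\<^sub>E carrier k. finite {i \<in> I. f i \<noteq> \<zero>\<^bsub>k\<^esub>}}"
  show "f \<oplus>\<^bsub>prod_module I (\<lambda>_. regular_module k)\<^esub> g \<in> {f \<in> I \<rightarrow>\<^sub>E carrier k. finite {i \<in> I. f i \<noteq> \<zero>\<^bsub>k\<^esub>}}"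
    if g: "g \<in> {f \<in> I \<rightarrow>\<^sub>E carrier k. finite {i \<in> I. f i \<noteq> \<zero>\<^bsub>k\<^esub>}}" for g
  proof -
    have "finite {i \<in> I. f i \<oplus>\<^bsub>k\<^esub> g i \<noteq> \<zero>\<^bsub>k\<^esub>}"
      by (rule finite_subset[of _ "{i \<in> I. f i \<noteq> \<zero>\<^bsub>k\<^esub>} \<union> {i \<in> I. g i \<noteq> \<zero>\<^bsub>k\<^esub>}"]) (use f g in auto)
    moreover have "{i \<in> I. (\<lambda>i\<in>I. f i \<oplus>\<^bsub>k\<^esub> g i) i \<noteq> \<zero>\<^bsub>k\<^esub>} = {i \<in> I. f i \<oplus>\<^bsub>k\<^esub> g i \<noteq> \<zero>\<^bsub>k\<^esub>}"
      by auto
    ultimately show ?thesis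
      using f g by auto
  qed
  show "c \<odot>\<^bsub>prod_module I (\<lambda>_. regular_module k)\<^esub> f \<in> {f \<in> I \<rightarrow>\<^sub>E carrier k. finite {i \<in> I. f i \<noteq> \<zero>\<^bsub>k\<^esub>}}"
    if c: "c \<in> carrier k" for c
  proof -
    have "finite {i \<in> I. c \<otimes>\<^bsub>k\<^esub> f i \<noteq> \<zero>\<^bsub>k\<^esub>}"
      by (rule finite_subset[of _ "{i \<in> I. f i \<noteq> \<zero>\<^bsub>k\<^esub>}"]) (use f c in auto)
    moreover have "{i \<in> I. (\<lambda>i\<in>I. c \<otimes>\<^bsub>k\<^esub> f i) i \<noteq> \<zero>\<^bsub>k\<^esub>} = {i \<in> I. c \<otimes>\<^bsub>k\<^esub> f i \<noteq> \<zero>\<^bsub>k\<^esub>}"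
      by auto
    ultimately show ?thesis
      using f c by auto
  qed
qed auto

definition lincomb :: "('k, 'r) ring_scheme \<Rightarrow> ('k, 'm) module \<Rightarrow> 'i set \<Rightarrow> ('i \<Rightarrow> 'm) \<Rightarrow> ('i \<Rightarrow> 'k) \<Rightarrow> 'm" where
  "lincomb k M I a f = finsum M (\<lambda>i. f i \<odot>\<^bsub>M\<^esub> a i) {i \<in> I. f i \<noteq> \<zero>\<^bsub>k\<^esub>}"

context
  fixes R :: "('k, 'r) ring_scheme" and M :: "('k, 'm) module"
  assumes M: "left_module R M"
begin

interpretation left_module R M
  by (rule M)

lemma lincomb_eq_finsum:
  assumes a: "a \<in> I \<rightarrow> carrier M" and f: "f \<in> I \<rightarrow> carrier R"
    and S: "finite S" "S \<subseteq> I" "{i \<in> I. f i \<noteq> \<zero>\<^bsub>R\<^esub>} \<subseteq> S"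
  shows "lincomb R M I a f = finsum M (\<lambda>i. f i \<odot>\<^bsub>M\<^esub> a i) S"
  unfolding lincomb_def
proof (rule M.add.finprod_mono_neutral_cong_left[OF S(1,3)])
  fix i assume "i \<in> S - {i \<in> I. f i \<noteq> \<zero>\<^bsub>R\<^esub>}"
  then have "i \<in> I" "f i = \<zero>\<^bsub>R\<^esub>"
    using S(2) by auto
  then show "f i \<odot>\<^bsub>M\<^esub> a i = \<zero>\<^bsub>M\<^esub>"
    using a by (simp add: Pi_iff zero_smult)
next
  show "(\<lambda>i. f i \<odot>\<^bsub>M\<^esub> a i) \<in> S \<rightarrow> carrier M"
    using S(2) a f by (auto intro!: smult_closed)
qed simp

lemma finsum_smult:
  assumes S: "finite S" and g: "g \<in> S \<rightarrow> carrier M" and c: "c \<in> carrier R"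
  shows "c \<odot>\<^bsub>M\<^esub> finsum M g S = finsum M (\<lambda>i. c \<odot>\<^bsub>M\<^esub> g i) S"
  using S g
proof (induction S rule: finite_induct)
  case empty
  then show ?case
    by (simp add: smult_zero c)
next
  case (insert i S)
  then have "g i \<in> carrier M" "g \<in> S \<rightarrow> carrier M"
    by auto
  with insert show ?case
    using c by (simp add: M.finsum_insert smult_r_distr smult_closed Pi_iff)
qed

lemma lincomb_linear:
  assumes a: "a \<in> I \<rightarrow> carrier M"
  shows "linear_map R (free_module R I) M (lincomb R M I a)"
  unfolding linear_map_def
proof (intro conjI ballI)
  have tm: "f i \<odot>\<^bsub>M\<^esub> a i \<in> carrier M" if "f \<in> carrier (free_module R I)" "i \<in> I" for f i
    using that a by (auto intro!: smult_closed)
  show "lincomb R M I a \<in> carrier (free_module R I) \<rightarrow> carrier M"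
    unfolding lincomb_def using tm by (auto intro!: M.finsum_closed simp del: free_module_simps)
  fix f assume f: "f \<in> carrier (free_module R I)"
  have f': "f \<in> I \<rightarrow> carrier R"
    using f by auto
  show "lincomb R M I a (f \<oplus>\<^bsub>free_module R I\<^esub> g) = lincomb R M I a f \<oplus>\<^bsub>M\<^esub> lincomb R M I a g"
    if g: "g \<in> carrier (free_module R I)" for g
  proof -
    define S where "S = {i \<in> I. f i \<noteq> \<zero>\<^bsub>R\<^esub>} \<union> {i \<in> I. g i \<noteq> \<zero>\<^bsub>R\<^esub>}"
    have S: "finite S" "S \<subseteq> I" "{i \<in> I. f i \<noteq> \<zero>\<^bsub>R\<^esub>} \<subseteq> S" "{i \<in> I. g i \<noteq> \<zero>\<^bsub>R\<^esub>} \<subseteq> S"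
      using f g by (auto simp: S_def)
    have g': "g \<in> I \<rightarrow> carrier R"
      using g by auto
    have fg: "f \<oplus>\<^bsub>free_module R I\<^esub> g \<in> I \<rightarrow> carrier R"
      using f' g' by auto
    have "{i \<in> I. (f \<oplus>\<^bsub>free_module R I\<^esub> g) i \<noteq> \<zero>\<^bsub>R\<^esub>} \<subseteq> S"
      using f' g' by (auto simp: S_def)
    then have "lincomb R M I a (f \<oplus>\<^bsub>free_module R I\<^esub> g) =
        finsum M (\<lambda>i. (f \<oplus>\<^bsub>free_module R I\<^esub> g) i \<odot>\<^bsub>M\<^esub> a i) S"
      by (rule lincomb_eq_finsum[OF a fg S(1,2)])
    also have "\<dots> = finsum M (\<lambda>i. f i \<odot>\<^bsub>M\<^esub> a i \<oplus>\<^bsub>M\<^esub> g i \<odot>\<^bsub>M\<^esub> a i) S"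
    proof (rule M.finsum_cong')
      show "(f \<oplus>\<^bsub>free_module R I\<^esub> g) i \<odot>\<^bsub>M\<^esub> a i = f i \<odot>\<^bsub>M\<^esub> a i \<oplus>\<^bsub>M\<^esub> g i \<odot>\<^bsub>M\<^esub> a i" if "i \<in> S" for i
        using that S(2) a f' g' by (auto simp: Pi_iff smult_l_distr subset_iff)
    qed (use tm[OF f] tm[OF g] S(2) in auto)
    also have "\<dots> = finsum M (\<lambda>i. f i \<odot>\<^bsub>M\<^esub> a i) S \<oplus>\<^bsub>M\<^esub> finsum M (\<lambda>i. g i \<odot>\<^bsub>M\<^esub> a i) S"
      by (rule M.finsum_addf) (use tm[OF f] tm[OF g] S(2) in auto)
    finally show ?thesis
      by (simp add: lincomb_eq_finsum[OF a f' S(1,2,3)] lincomb_eq_finsum[OF a g' S(1,2,4)])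
  qed
  show "lincomb R M I a (c \<odot>\<^bsub>free_module R I\<^esub> f) = c \<odot>\<^bsub>M\<^esub> lincomb R M I a f"
    if c: "c \<in> carrier R" for c
  proof -
    define S where "S = {i \<in> I. f i \<noteq> \<zero>\<^bsub>R\<^esub>}"
    have S: "finite S" "S \<subseteq> I" "{i \<in> I. f i \<noteq> \<zero>\<^bsub>R\<^esub>} \<subseteq> S"
      using f by (auto simp: S_def)
    have cf: "c \<odot>\<^bsub>free_module R I\<^esub> f \<in> I \<rightarrow> carrier R"
      using f' c by auto
    have "{i \<in> I. (c \<odot>\<^bsub>free_module R I\<^esub> f) i \<noteq> \<zero>\<^bsub>R\<^esub>} \<subseteq> S"
      using c by (auto simp: S_def)
    then have "lincomb R M I a (c \<odot>\<^bsub>free_module R I\<^esub> f) =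
        finsum M (\<lambda>i. (c \<odot>\<^bsub>free_module R I\<^esub> f) i \<odot>\<^bsub>M\<^esub> a i) S"
      by (rule lincomb_eq_finsum[OF a cf S(1,2)])
    also have "\<dots> = finsum M (\<lambda>i. c \<odot>\<^bsub>M\<^esub> (f i \<odot>\<^bsub>M\<^esub> a i)) S"
    proof (rule M.finsum_cong')
      show "(c \<odot>\<^bsub>free_module R I\<^esub> f) i \<odot>\<^bsub>M\<^esub> a i = c \<odot>\<^bsub>M\<^esub> (f i \<odot>\<^bsub>M\<^esub> a i)" if "i \<in> S" for i
        using that S(2) a f' c by (auto simp: Pi_iff smult_assoc subset_iff)
    qed (use tm[OF f] S(2) in \<open>auto intro!: smult_closed[OF c]\<close>)
    also have "\<dots> = c \<odot>\<^bsub>M\<^esub> finsum M (\<lambda>i. f i \<odot>\<^bsub>M\<^esub> a i) S"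
      by (rule finsum_smult[symmetric]) (use S tm[OF f] c in auto)
    finally show ?thesis
      by (simp add: lincomb_eq_finsum[OF a f' S])
  qed
qed

text \<open>The image of \<open>lincomb\<close> is the submodule generated by the \<open>a i\<close>: it contains them, and it lies in
  every submodule that does.\<close>

lemma lincomb_unit:
  assumes a: "a \<in> I \<rightarrow> carrier M" and i: "i \<in> I"
  shows "\<exists>f\<in>carrier (free_module R I). lincomb R M I a f = a i"
proof -
  define f where "f = (\<lambda>j\<in>I. if j = i then \<one>\<^bsub>R\<^esub> else \<zero>\<^bsub>R\<^esub>)"
  have sub: "{j \<in> I. f j \<noteq> \<zero>\<^bsub>R\<^esub>} \<subseteq> {i}"
    by (auto simp: f_def)
  have ai: "a i \<in> carrier M"
    using a i by blast
  have "f \<in> carrier (free_module R I)"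
    using finite_subset[OF sub] by (auto simp: f_def)
  moreover have "lincomb R M I a f = finsum M (\<lambda>j. f j \<odot>\<^bsub>M\<^esub> a j) {i}"
    by (rule lincomb_eq_finsum[OF a _ _ _ sub]) (use i in \<open>auto simp: f_def\<close>)
  moreover have "\<dots> = a i"
    using ai i by (simp add: f_def M.finsum_insert smult_one)
  ultimately show ?thesis
    by metis
qed

lemma lincomb_in:
  assumes C: "C \<subseteq> carrier M" "\<zero>\<^bsub>M\<^esub> \<in> C"
    and add: "\<And>x y. \<lbrakk>x \<in> C; y \<in> C\<rbrakk> \<Longrightarrow> x \<oplus>\<^bsub>M\<^esub> y \<in> C"
    and sm: "\<And>c x. \<lbrakk>c \<in> carrier R; x \<in> C\<rbrakk> \<Longrightarrow> c \<odot>\<^bsub>M\<^esub> x \<in> C"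
    and a: "a \<in> I \<rightarrow> C" and f: "f \<in> carrier (free_module R I)"
  shows "lincomb R M I a f \<in> C"
proof -
  have "finsum M (\<lambda>i. f i \<odot>\<^bsub>M\<^esub> a i) S \<in> C" if "finite S" "S \<subseteq> I" for S
    using that
  proof (induction S rule: finite_induct)
    case (insert i S)
    have t: "f j \<odot>\<^bsub>M\<^esub> a j \<in> C" if "j \<in> I" for j
      using that a f by (auto intro!: sm)
    then have "finsum M (\<lambda>i. f i \<odot>\<^bsub>M\<^esub> a i) (insert i S) =
        f i \<odot>\<^bsub>M\<^esub> a i \<oplus>\<^bsub>M\<^esub> finsum M (\<lambda>i. f i \<odot>\<^bsub>M\<^esub> a i) S"
      using insert C by (intro M.finsum_insert) (auto simp: subset_iff)
    then show ?case
      using insert t by (auto intro!: add)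
  qed (use C in simp)
  then show ?thesis
    unfolding lincomb_def using f by auto
qed

end

definition const_map :: "'x topology \<Rightarrow> ('k, 'm) module \<Rightarrow> ('m \<Rightarrow> 'n) \<Rightarrow> 'x set \<Rightarrow> ('x \<Rightarrow> 'm) \<Rightarrow> 'x \<Rightarrow> 'n" where
  "const_map X M f = family_hom X (const_sheaf X M) (\<lambda>V s. \<lambda>x\<in>V. f (s x))"

lemma const_section_map:
  assumes V: "openin X V" and f: "f \<in> carrier M \<rightarrow> carrier N" and s: "s \<in> \<Gamma> (const_sheaf X M) V"
  shows "(\<lambda>x\<in>V. f (s x)) \<in> \<Gamma> (const_sheaf X N) V"
proof (rule const_sheaf_carrierI[OF V])
  show "(\<lambda>x\<in>V. f (s x)) \<in> V \<rightarrow>\<^sub>E carrier N"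
    using const_sheaf_fun[OF V s] f by auto
  fix x assume x: "x \<in> V"
  obtain W c where "openin X W" "x \<in> W" "W \<subseteq> V" "\<And>y. y \<in> W \<Longrightarrow> s y = c"
    using const_sheaf_locally[OF V s x] by metis
  then show "\<exists>W. openin X W \<and> x \<in> W \<and> W \<subseteq> V \<and> (\<forall>y\<in>W. (\<lambda>x\<in>V. f (s x)) y = (\<lambda>x\<in>V. f (s x)) x)"
    by (intro exI[of _ W]) (auto simp: subset_iff)
qed

lemma const_map_hom:
  assumes M: "left_module k M" and f: "linear_map k M N f"
  shows "const_map X M f \<in> sheaf_hom k X (const_sheaf X M) (const_sheaf X N)"
  unfolding const_map_def
proof (rule family_hom_in[OF _ _ _ _ sheaf_presheaf[OF const_sheaf_sheaf[OF M]]])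
  have val: "s x \<in> carrier M" if "openin X V" "s \<in> \<Gamma> (const_sheaf X M) V" "x \<in> V" for V s x
    using const_sheaf_fun[OF that(1,2)] that(3) by auto
  fix V s assume V: "openin X V" and s: "s \<in> \<Gamma> (const_sheaf X M) V"
  show "(\<lambda>x\<in>V. f (s x)) \<in> \<Gamma> (const_sheaf X N) V"
    by (rule const_section_map[OF V _ s]) (use linear_map_closed[OF f] in blast)
  show "(\<lambda>x\<in>V. f ((s \<oplus>\<^bsub>sec (const_sheaf X M) V\<^esub> t) x)) =
      (\<lambda>x\<in>V. f (s x)) \<oplus>\<^bsub>sec (const_sheaf X N) V\<^esub> (\<lambda>x\<in>V. f (t x))"
    if "t \<in> \<Gamma> (const_sheaf X M) V" for t
    by (auto simp: fun_eq_iff restrict_def val[OF V s] val[OF V that] linear_map_add[OF f])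
  show "(\<lambda>x\<in>V. f ((c \<odot>\<^bsub>sec (const_sheaf X M) V\<^esub> s) x)) = c \<odot>\<^bsub>sec (const_sheaf X N) V\<^esub> (\<lambda>x\<in>V. f (s x))"
    if "c \<in> carrier k" for c
    by (auto simp: fun_eq_iff restrict_def val[OF V s] that linear_map_smult[OF f])
qed (auto simp: fun_eq_iff restrict_def subset_iff)

text \<open>Near each point a section is constant, so that its value there can be lifted once and for all.\<close>

lemma const_section_lift:
  assumes V: "openin X V" and t: "t \<in> \<Gamma> (const_sheaf X N) V" and x: "x \<in> V" and h: "t x \<in> h ` carrier M"
  shows "\<exists>W. openin X W \<and> x \<in> W \<and> W \<subseteq> V \<and>
    res (const_sheaf X N) V W t \<in> const_map X M h W ` \<Gamma> (const_sheaf X M) W"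
proof -
  obtain c where c: "c \<in> carrier M" "t x = h c"
    using h by blast
  obtain W b where W: "openin X W" "x \<in> W" "W \<subseteq> V" "\<And>y. y \<in> W \<Longrightarrow> t y = b"
    using const_sheaf_locally[OF V t x] by metis
  have "b = h c"
    using W(2) W(4)[OF W(2)] c(2) by simp
  then have "res (const_sheaf X N) V W t = const_map X M h W (\<lambda>y\<in>W. c)"
    unfolding const_map_def family_hom_apply[OF W(1) const_section[OF W(1) c(1)]]
    using W(4) by (auto simp: fun_eq_iff restrict_def)
  then show ?thesis
    using W const_section[OF W(1) c(1)] by blast
qed

lemma const_sheaf_right_exact:
  assumes L: "left_module k L" and M: "left_module k M" and N: "left_module k N"
    and f: "linear_map k L M f" and g: "linear_map k M N g"
    and ker: "f ` carrier L = {m \<in> carrier M. g m = \<zero>\<^bsub>N\<^esub>}" and surj: "g ` carrier M = carrier N"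
  shows "right_exact_seq k X (const_sheaf X L) (const_sheaf X M) (const_sheaf X N) (const_map X L f) (const_map X M g)"
proof (rule right_exact_seqI[OF const_map_hom[OF L f] const_map_hom[OF M g]])
  fix V assume V: "openin X V"
  show "\<forall>x\<in>V. \<exists>W. openin X W \<and> x \<in> W \<and> W \<subseteq> V \<and> res (const_sheaf X M) V W t \<in> const_map X L f W ` \<Gamma> (const_sheaf X L) W"
    if t: "t \<in> \<Gamma> (const_sheaf X M) V" and z: "const_map X M g V t = \<zero>\<^bsub>sec (const_sheaf X N) V\<^esub>" for t
  proof
    fix x assume x: "x \<in> V"
    have "g (t x) = \<zero>\<^bsub>N\<^esub>"
      using fun_cong[OF z, of x] V t x by (simp add: const_map_def)
    moreover have "t x \<in> carrier M"
      using const_sheaf_fun[OF V t] x by auto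
    ultimately have "t x \<in> f ` carrier L"
      using ker by blast
    then show "\<exists>W. openin X W \<and> x \<in> W \<and> W \<subseteq> V \<and> res (const_sheaf X M) V W t \<in> const_map X L f W ` \<Gamma> (const_sheaf X L) W"
      by (rule const_section_lift[OF V t x])
  qed
  show "const_map X M g V t = \<zero>\<^bsub>sec (const_sheaf X N) V\<^esub>"
    if t: "t \<in> \<Gamma> (const_sheaf X M) V"
      and loc: "\<forall>x\<in>V. \<exists>W. openin X W \<and> x \<in> W \<and> W \<subseteq> V \<and> res (const_sheaf X M) V W t \<in> const_map X L f W ` \<Gamma> (const_sheaf X L) W" for t
  proof -
    have "g (t x) = \<zero>\<^bsub>N\<^esub>" if x: "x \<in> V" for x
    proof -
      obtain W s where W: "openin X W" "x \<in> W" and s: "s \<in> \<Gamma> (const_sheaf X L) W"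
        and eq: "res (const_sheaf X M) V W t = const_map X L f W s"
        using loc x by blast
      have "t x = f (s x)"
        using fun_cong[OF eq, of x] W s by (simp add: const_map_def)
      moreover have "s x \<in> carrier L"
        using const_sheaf_fun[OF W(1) s] W(2) by auto
      ultimately show ?thesis
        using ker by blast
    qed
    then show ?thesis
      using V t by (auto simp: const_map_def fun_eq_iff restrict_def)
  qed
  fix q x assume q: "q \<in> \<Gamma> (const_sheaf X N) V" and x: "x \<in> V"
  have "q x \<in> g ` carrier M"
    using const_sheaf_fun[OF V q] x surj by auto
  then show "\<exists>W. openin X W \<and> x \<in> W \<and> W \<subseteq> V \<and> res (const_sheaf X N) V W q \<in> const_map X M g W ` \<Gamma> (const_sheaf X M) W"
    by (rule const_section_lift[OF V q x])
qed

section \<open>Free sheaves as constant sheaves\<close>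

lemma free_sheaf_simps [simp]:
  "\<zero>\<^bsub>sec (free_sheaf k X I) V\<^esub> = (\<lambda>i\<in>I. \<lambda>x\<in>V. \<zero>\<^bsub>k\<^esub>)"
  "s \<oplus>\<^bsub>sec (free_sheaf k X I) V\<^esub> t = (\<lambda>i\<in>I. \<lambda>x\<in>V. s i x \<oplus>\<^bsub>k\<^esub> t i x)"
  "c \<odot>\<^bsub>sec (free_sheaf k X I) V\<^esub> s = (\<lambda>i\<in>I. \<lambda>x\<in>V. c \<otimes>\<^bsub>k\<^esub> s i x)"
  "res (free_sheaf k X I) V W s = (\<lambda>i\<in>I. restrict (s i) W)"
  by (simp_all add: free_sheaf_def sheaf_dsum_def)

lemma free_sheaf_carrier:
  "s \<in> \<Gamma> (free_sheaf k X I) V \<longleftrightarrow> s \<in> (\<Pi>\<^sub>E i\<in>I. \<Gamma> (const_sheaf X (regular_module k)) V) \<and>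
     (\<forall>x\<in>V. \<exists>W. openin X W \<and> x \<in> W \<and> W \<subseteq> V \<and> finite {i\<in>I. restrict (s i) W \<noteq> (\<lambda>x\<in>W. \<zero>\<^bsub>k\<^esub>)})"
  by (simp add: free_sheaf_def sheaf_dsum_def)

definition curry_hom :: "('k, 'r) ring_scheme \<Rightarrow> 'x topology \<Rightarrow> 'i set \<Rightarrow> 'x set \<Rightarrow> ('x \<Rightarrow> 'i \<Rightarrow> 'k) \<Rightarrow> 'i \<Rightarrow> 'x \<Rightarrow> 'k" where
  "curry_hom k X I = family_hom X (const_sheaf X (free_module k I)) (\<lambda>V s. \<lambda>i\<in>I. \<lambda>x\<in>V. s x i)"

text \<open>A family of locally constant functions that is locally finite is, near each point, a constant
  vector of finite support.\<close>

lemma curry_hom_bijective: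
  assumes k: "ring k"
  shows "bijective_hom k X (const_sheaf X (free_module k I)) (free_sheaf k X I) (curry_hom k X I)"
proof -
  let ?L = "free_module k I"
  let ?C = "const_sheaf X ?L" and ?K = "const_sheaf X (regular_module k)" and ?F = "free_sheaf k X I"
  have C: "presheaf k X ?C"
    by (rule sheaf_presheaf[OF const_sheaf_sheaf[OF left_module_free[OF k]]])
  have closed: "(\<lambda>i\<in>I. \<lambda>x\<in>V. s x i) \<in> \<Gamma> ?F V" if V: "openin X V" and s: "s \<in> \<Gamma> ?C V" for V s
  proof -
    have sL: "s x \<in> carrier ?L" if "x \<in> V" for x
      using const_sheaf_fun[OF V s] that by blast
    have "(\<lambda>x\<in>V. s x i) \<in> \<Gamma> ?K V" if i: "i \<in> I" for i
    proof (rule const_section_map[OF V _ s, of "\<lambda>f. f i"])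
      show "(\<lambda>f. f i) \<in> carrier ?L \<rightarrow> carrier (regular_module k)"
        using i by auto
    qed
    moreover have "\<exists>W. openin X W \<and> x \<in> W \<and> W \<subseteq> V \<and>
        finite {i\<in>I. restrict ((\<lambda>i\<in>I. \<lambda>x\<in>V. s x i) i) W \<noteq> (\<lambda>x\<in>W. \<zero>\<^bsub>k\<^esub>)}" if x: "x \<in> V" for x
    proof -
      obtain W c where W: "openin X W" "x \<in> W" "W \<subseteq> V" and c: "c \<in> carrier ?L" "\<And>y. y \<in> W \<Longrightarrow> s y = c"
        using const_sheaf_locally[OF V s x] by metis
      have "{i\<in>I. restrict ((\<lambda>i\<in>I. \<lambda>x\<in>V. s x i) i) W \<noteq> (\<lambda>x\<in>W. \<zero>\<^bsub>k\<^esub>)} \<subseteq> {i\<in>I. c i \<noteq> \<zero>\<^bsub>k\<^esub>}"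
        using c(2) W(3) by (auto simp: fun_eq_iff restrict_def split: if_splits)
      moreover have "finite {i\<in>I. c i \<noteq> \<zero>\<^bsub>k\<^esub>}"
        using c(1) by simp
      ultimately show ?thesis
        using W finite_subset by blast
    qed
    ultimately show ?thesis
      unfolding free_sheaf_carrier by auto
  qed
  have hom: "curry_hom k X I \<in> sheaf_hom k X ?C ?F"
    unfolding curry_hom_def
    by (rule family_hom_in[OF closed _ _ _ C]) (auto simp: fun_eq_iff restrict_def subset_iff)
  have inj: "s = t" if V: "openin X V" and s: "s \<in> \<Gamma> ?C V" and t: "t \<in> \<Gamma> ?C V"
    and eq: "curry_hom k X I V s = curry_hom k X I V t" for V s t
  proof -
    have s': "s \<in> V \<rightarrow>\<^sub>E carrier ?L" and t': "t \<in> V \<rightarrow>\<^sub>E carrier ?L"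
      by (rule const_sheaf_fun[OF V s], rule const_sheaf_fun[OF V t])
    have "s x i = t x i" if "x \<in> V" "i \<in> I" for x i
      using fun_cong[OF fun_cong[OF eq], of i x] that V s t by (simp add: curry_hom_def)
    moreover have "s x \<in> extensional I" "t x \<in> extensional I" if "x \<in> V" for x
      using s' t' that by (auto simp: PiE_iff)
    ultimately have "s x = t x" if "x \<in> V" for x
      using extensionalityI[of "s x" I "t x"] that by blast
    then show ?thesis
      by (rule PiE_ext[OF s' t'])
  qed
  have surj: "\<exists>s\<in>\<Gamma> ?C V. curry_hom k X I V s = t" if V: "openin X V" and t: "t \<in> \<Gamma> ?F V" for V t
  proof -
    define s where "s = (\<lambda>x\<in>V. \<lambda>i\<in>I. t i x)"
    have ti: "t i \<in> \<Gamma> ?K V" if "i \<in> I" for i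
      using t that unfolding free_sheaf_carrier by (simp add: PiE_iff)
    have tf: "t i \<in> V \<rightarrow>\<^sub>E carrier k" if "i \<in> I" for i
      using const_sheaf_fun[OF V ti[OF that]] by simp
    have loc: "\<exists>W. openin X W \<and> x \<in> W \<and> W \<subseteq> V \<and> finite {i\<in>I. restrict (t i) W \<noteq> (\<lambda>x\<in>W. \<zero>\<^bsub>k\<^esub>)}"
      if "x \<in> V" for x
      using t that unfolding free_sheaf_carrier by blast
    have "s \<in> \<Gamma> ?C V"
    proof (rule const_sheaf_carrierI[OF V])
      have "s x \<in> carrier ?L" if x: "x \<in> V" for x
      proof -
        obtain W where W: "openin X W" "x \<in> W" "W \<subseteq> V" and fin: "finite {i\<in>I. restrict (t i) W \<noteq> (\<lambda>x\<in>W. \<zero>\<^bsub>k\<^esub>)}"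
          using loc[OF x] by blast
        have "{i\<in>I. s x i \<noteq> \<zero>\<^bsub>k\<^esub>} \<subseteq> {i\<in>I. restrict (t i) W \<noteq> (\<lambda>x\<in>W. \<zero>\<^bsub>k\<^esub>)}"
          using W x by (auto simp: s_def fun_eq_iff restrict_def)
        then have "finite {i\<in>I. s x i \<noteq> \<zero>\<^bsub>k\<^esub>}"
          using fin finite_subset by blast
        moreover have "s x \<in> I \<rightarrow>\<^sub>E carrier k"
          using tf x by (auto simp: s_def)
        ultimately show ?thesis
          by simp
      qed
      then show "s \<in> V \<rightarrow>\<^sub>E carrier ?L"
        by (simp add: PiE_iff s_def del: free_module_simps)
      fix x assume x: "x \<in> V"
      obtain W where W: "openin X W" "x \<in> W" "W \<subseteq> V" and fin: "finite {i\<in>I. restrict (t i) W \<noteq> (\<lambda>x\<in>W. \<zero>\<^bsub>k\<^esub>)}"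
        using loc[OF x] by blast
      define J where "J = {i\<in>I. restrict (t i) W \<noteq> (\<lambda>x\<in>W. \<zero>\<^bsub>k\<^esub>)}"
      \<comment> \<open>On \<open>W\<close> the components outside the finite set \<open>J\<close> vanish; those in \<open>J\<close> are constant on the
        intersection of finitely many open fibres.\<close>
      define A where "A = W \<inter> (\<Inter>i\<in>J. {y \<in> V. t i y = t i x})"
      have "openin X A"
      proof (cases "J = {}")
        case False
        have "openin X (\<Inter>i\<in>J. {y \<in> V. t i y = t i x})"
        proof (rule openin_Inter)
          fix U assume "U \<in> (\<lambda>i. {y \<in> V. t i y = t i x}) ` J"
          then show "openin X U"
            using const_sheaf_fibre[OF V ti] by (auto simp: J_def)
        qed (use fin False in \<open>auto simp: J_def\<close>)
        then show ?thesis
          unfolding A_def using W(1) by blast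
      qed (use W(1) in \<open>simp add: A_def\<close>)
      moreover have "x \<in> A" "A \<subseteq> V"
        using W x by (auto simp: A_def)
      moreover have "s y = s x" if y: "y \<in> A" for y
      proof -
        have "t i y = t i x" if i: "i \<in> I" for i
        proof (cases "i \<in> J")
          case True
          then show ?thesis
            using y by (auto simp: A_def)
        next
          case False
          then have eq: "restrict (t i) W = (\<lambda>x\<in>W. \<zero>\<^bsub>k\<^esub>)"
            using i by (simp add: J_def)
          show ?thesis
            using fun_cong[OF eq, of y] fun_cong[OF eq, of x] W(2) y by (simp add: A_def)
        qed
        then show ?thesis
          using y \<open>A \<subseteq> V\<close> x by (auto simp: s_def fun_eq_iff restrict_def)
      qed
      ultimately show "\<exists>A. openin X A \<and> x \<in> A \<and> A \<subseteq> V \<and> (\<forall>y\<in>A. s y = s x)"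
        by blast
    qed
    moreover have "(\<lambda>i\<in>I. \<lambda>x\<in>V. s x i) = t"
    proof (rule extensionalityI[of _ I])
      show "t \<in> extensional I"
        using t unfolding free_sheaf_carrier by (simp add: PiE_iff)
      fix i assume i: "i \<in> I"
      show "(\<lambda>i\<in>I. \<lambda>x\<in>V. s x i) i = t i"
        by (rule extensionalityI[of _ V]) (use i tf[OF i] in \<open>auto simp: s_def PiE_def\<close>)
    qed simp
    ultimately show ?thesis
      using V by (intro bexI[of _ s]) (simp_all add: curry_hom_def)
  qed
  have "bij_betw (curry_hom k X I V) (\<Gamma> ?C V) (\<Gamma> ?F V)" if V: "openin X V" for V
    unfolding bij_betw_def
  proof (intro conjI inj_onI)
    show "curry_hom k X I V ` \<Gamma> ?C V = \<Gamma> ?F V"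
      using surj[OF V] hom_closed[OF hom V] by blast
  qed (rule inj[OF V])
  then show ?thesis
    by (simp add: bijective_hom_def hom)
qed

lemma presheaf_free_sheaf:
  assumes k: "ring k"
  shows "presheaf k X (free_sheaf k X I)"
proof (rule presheaf_transport[OF _ curry_hom_bijective[OF k]])
  show C: "presheaf k X (const_sheaf X (free_module k I))"
    by (rule sheaf_presheaf[OF const_sheaf_sheaf[OF left_module_free[OF k]]])
  fix V assume V: "openin X V"
  interpret C: left_module k "sec (const_sheaf X (free_module k I)) V"
    by (rule presheaf_sec[OF C V])
  show "\<zero>\<^bsub>sec (free_sheaf k X I) V\<^esub> = curry_hom k X I V \<zero>\<^bsub>sec (const_sheaf X (free_module k I)) V\<^esub>"
    unfolding curry_hom_def family_hom_apply[OF V C.M.zero_closed]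
    by (auto simp: fun_eq_iff restrict_def)
qed

section \<open>Locally constant and quasi-coherent sheaves\<close>

text \<open>The module \<open>M\<close> is generated by all its elements, with all the relations between them. A relation
  is a finitely supported function on \<open>M\<close>; it is given a dummy argument of type \<open>'x\<close>, evaluated at
  \<open>undefined\<close>, so that the relations live in the index type that occurs in \<open>quasi_coherent\<close>.\<close>

lemma const_sheaf_presentation:
  fixes k :: "('k, 'r) ring_scheme" and M :: "('k, 'a) module" and X :: "'x topology"
  assumes k: "ring k" and M: "left_module k M"
  shows "\<exists>(I :: ('a \<Rightarrow> 'x \<Rightarrow> 'k) set) (J :: 'a set) \<phi> \<psi>.
    right_exact_seq k X (free_sheaf k X I) (free_sheaf k X J) (const_sheaf X M) \<phi> \<psi>"
proof -
  define J where "J = carrier M"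
  let ?KJ = "free_module k J"
  define g where "g = lincomb k M J (\<lambda>m. m)"
  define R where "R = {r \<in> carrier ?KJ. g r = \<zero>\<^bsub>M\<^esub>}"
  define I where "I = (\<lambda>r m (x :: 'x). r m) ` R"
  define b where "b = (\<lambda>(i :: 'a \<Rightarrow> 'x \<Rightarrow> 'k) m. i m undefined)"
  let ?KI = "free_module k I"
  define f where "f = lincomb k ?KJ I b"
  note KI = left_module_free[OF k, of I] and KJ = left_module_free[OF k, of J]
  interpret KJ: left_module k ?KJ by (rule KJ)
  interpret M: left_module k M by (rule M)
  have g: "linear_map k ?KJ M g"
    unfolding g_def by (rule lincomb_linear[OF M]) (simp add: J_def)
  have b: "b \<in> I \<rightarrow> R"
    by (auto simp: b_def I_def)
  then have b': "b \<in> I \<rightarrow> carrier ?KJ"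
    unfolding R_def by blast
  have f: "linear_map k ?KI ?KJ f"
    unfolding f_def by (rule lincomb_linear[OF KJ b'])
  have "f ` carrier ?KI = R"
  proof (intro subset_antisym subsetI)
    fix r assume "r \<in> f ` carrier ?KI"
    then obtain c where c: "c \<in> carrier ?KI" "r = f c"
      by blast
    show "r \<in> R"
      unfolding c(2) f_def
    proof (rule lincomb_in[OF KJ _ _ _ _ b c(1)])
      show "\<zero>\<^bsub>?KJ\<^esub> \<in> R"
        unfolding R_def using linear_map_zero[OF KJ M g] KJ.M.zero_closed by blast
      show "r \<oplus>\<^bsub>?KJ\<^esub> s \<in> R" if "r \<in> R" "s \<in> R" for r s
      proof -
        have rs: "r \<in> carrier ?KJ" "s \<in> carrier ?KJ" "g r = \<zero>\<^bsub>M\<^esub>" "g s = \<zero>\<^bsub>M\<^esub>"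
          using that by (simp_all add: R_def del: free_module_simps)
        then show ?thesis
          using KJ.M.a_closed[OF rs(1,2)] linear_map_add[OF g rs(1,2)]
          by (simp add: R_def del: free_module_simps)
      qed
      show "a \<odot>\<^bsub>?KJ\<^esub> r \<in> R" if "a \<in> carrier k" "r \<in> R" for a r
      proof -
        have r: "r \<in> carrier ?KJ" "g r = \<zero>\<^bsub>M\<^esub>"
          using that by (simp_all add: R_def del: free_module_simps)
        then show ?thesis
          using KJ.smult_closed[OF that(1) r(1)] linear_map_smult[OF g that(1) r(1)] M.smult_zero[OF that(1)]
          by (simp add: R_def del: free_module_simps)
      qed
    qed (auto simp: R_def)
  next
    fix r assume r: "r \<in> R"
    have "(\<lambda>m (x :: 'x). r m) \<in> I"
      using r by (auto simp: I_def)
    from lincomb_unit[OF KJ b' this] show "r \<in> f ` carrier ?KI"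
      unfolding f_def by (force simp: b_def simp del: free_module_simps)
  qed
  moreover have "g ` carrier ?KJ = carrier M"
  proof (intro subset_antisym subsetI)
    fix m assume "m \<in> carrier M"
    then have "m \<in> J"
      by (simp add: J_def)
    from lincomb_unit[OF M _ this, of "\<lambda>m. m"] show "m \<in> g ` carrier ?KJ"
      unfolding g_def by (force simp: J_def simp del: free_module_simps)
  qed (use linear_map_closed[OF g] in blast)
  ultimately have ex: "right_exact_seq k X (const_sheaf X ?KI) (const_sheaf X ?KJ) (const_sheaf X M)
      (const_map X ?KI f) (const_map X ?KJ g)"
    by (intro const_sheaf_right_exact[OF KI KJ M f g]) (simp_all add: R_def del: free_module_simps)
  note CI = sheaf_presheaf[OF const_sheaf_sheaf[OF KI, of X]] and CJ = sheaf_presheaf[OF const_sheaf_sheaf[OF KJ, of X]]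
  note FI = presheaf_free_sheaf[OF k, of X I] and FJ = presheaf_free_sheaf[OF k, of X J]
  show ?thesis
    by (rule exI[of _ I], rule exI[of _ J], rule exI, rule exI,
        rule right_exact_iso_source[OF FI right_exact_iso_middle[OF CI CJ FJ ex curry_hom_bijective[OF k]]
          bijective_inv_hom[OF CI curry_hom_bijective[OF k]]])
qed

lemma locally_constant_imp_quasi_coherent:
  fixes k :: "('k, 'r) ring_scheme" and X :: "'x topology" and F :: "('x, 'k, 'a) presheaf"
  assumes k: "ring k" and F: "locally_constant k X F"
  shows "quasi_coherent k X F"
  unfolding quasi_coherent_def quasi_coherent_ix_def
proof (intro conjI ballI)
  show shF: "sheaf k X F"
    using F by (simp add: locally_constant_def)
  fix x assume "x \<in> topspace X"
  then obtain U and M :: "('k, 'a) module" where U: "openin X U" "x \<in> U" and M: "left_module k M"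
    and iso: "sheaf_iso k (subtopology X U) F (const_sheaf (subtopology X U) M)"
    using F unfolding locally_constant_def by blast
  let ?Y = "subtopology X U"
  have FY: "presheaf k ?Y F"
    by (rule sheaf_presheaf[OF sheaf_restrict_open[OF shF U(1)]])
  have C: "presheaf k ?Y (const_sheaf ?Y M)"
    by (rule sheaf_presheaf[OF const_sheaf_sheaf[OF M]])
  obtain \<alpha> where \<alpha>: "bijective_hom k ?Y F (const_sheaf ?Y M) \<alpha>"
    using iso sheaf_iso_iff_bijective[OF FY] by blast
  obtain I :: "('a \<Rightarrow> 'x \<Rightarrow> 'k) set" and J :: "'a set" and \<phi> \<psi>
    where ex: "right_exact_seq k ?Y (free_sheaf k ?Y I) (free_sheaf k ?Y J) (const_sheaf ?Y M) \<phi> \<psi>"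
    using const_sheaf_presentation[OF k M, of ?Y] by blast
  show "\<exists>U. openin X U \<and> x \<in> U \<and> (\<exists>(I :: ('a \<Rightarrow> 'x \<Rightarrow> 'k) set) (J :: 'a set) \<phi> \<psi>.
      right_exact_seq k (subtopology X U) (free_sheaf k (subtopology X U) I) (free_sheaf k (subtopology X U) J) F \<phi> \<psi>)"
    by (rule exI[of _ U], intro conjI U, rule exI[of _ I], rule exI[of _ J], rule exI, rule exI,
        rule right_exact_iso_target[OF presheaf_free_sheaf[OF k] C FY ex bijective_inv_hom[OF FY \<alpha>]])
qed

lemma free_sheaf_rigid:
  assumes k: "ring k" and U: "openin X U" "connectedin X U"
  shows "rigid_on X (free_sheaf k X I) U"
  by (rule rigid_on_iso[OF curry_hom_bijective[OF k] const_sheaf_rigid[OF U]])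

lemma quasi_coherent_imp_locally_constant:
  assumes k: "ring k" and X: "locally_connected_space X"
    and F: "quasi_coherent_ix TYPE('i) TYPE('j) k X F"
  shows "locally_constant k X F"
  unfolding locally_constant_iff_rigid[OF X]
proof (intro conjI ballI)
  show shF: "sheaf k X F"
    using F by (simp add: quasi_coherent_ix_def)
  fix x assume "x \<in> topspace X"
  then obtain U and I :: "'i set" and J :: "'j set" and \<phi> \<psi> where U: "openin X U" "x \<in> U" and
    ex: "right_exact_seq k (subtopology X U) (free_sheaf k (subtopology X U) I)
      (free_sheaf k (subtopology X U) J) F \<phi> \<psi>"
    using F unfolding quasi_coherent_ix_def by blast
  obtain V where V: "openin X V" "connectedin X V" "x \<in> V" "V \<subseteq> U"
    using locally_connected_obtain[OF X U] by blast
  let ?Y = "subtopology X U"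
  have VY: "openin ?Y V" "connectedin ?Y V"
    using V by (auto simp: openin_open_subtopology[OF U(1)] connectedin_subtopology)
  have "rigid_on ?Y F V"
    by (rule rigid_on_cokernel[OF locally_connected_space_open_subset[OF X U(1)] presheaf_free_sheaf[OF k]
          presheaf_free_sheaf[OF k] sheaf_restrict_open[OF shF U(1)] ex
          free_sheaf_rigid[OF k VY] free_sheaf_rigid[OF k VY]])
  then show "\<exists>U. x \<in> U \<and> rigid_on X F U"
    using rigid_on_subtopology[OF U(1)] V(3) by blast
qed

section \<open>Universal properties in categories of sheaves\<close>

abbreviation sheaf_category where
  "sheaf_category k X S \<equiv> full_subcategory (Shv k X) S"

definition zero_hom where
  "zero_hom X F G = family_hom X F (\<lambda>V s. \<zero>\<^bsub>sec G V\<^esub>)"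

definition add_hom where
  "add_hom X F G \<phi> \<psi> = family_hom X F (\<lambda>V s. \<phi> V s \<oplus>\<^bsub>sec G V\<^esub> \<psi> V s)"

lemma sheaf_category_simps [simp]:
  "Obj (sheaf_category k X S) = S"
  "Hom (sheaf_category k X S) = sheaf_hom k X"
  "Ident (sheaf_category k X S) = sheaf_id X"
  "Comp (sheaf_category k X S) F G H \<psi> \<phi> = sheaf_comp X F \<psi> \<phi>"
  "Plus (sheaf_category k X S) = add_hom X"
  "Null (sheaf_category k X S) = zero_hom X"
  by (simp_all add: full_subcategory_def Shv_def add_hom_def zero_hom_def family_hom_def fun_eq_iff)

lemma Shv_eq_sheaf_category: "Shv k X = sheaf_category k X {F. sheaf k X F}"
  by (simp add: full_subcategory_def Shv_def)

lemma zero_hom_apply [simp]: "\<lbrakk>openin X V; s \<in> \<Gamma> F V\<rbrakk> \<Longrightarrow> zero_hom X F G V s = \<zero>\<^bsub>sec G V\<^esub>"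
  by (simp add: zero_hom_def)

lemma add_hom_apply [simp]:
  "\<lbrakk>openin X V; s \<in> \<Gamma> F V\<rbrakk> \<Longrightarrow> add_hom X F G \<phi> \<psi> V s = \<phi> V s \<oplus>\<^bsub>sec G V\<^esub> \<psi> V s"
  by (simp add: add_hom_def)

lemma sheaf_comp_apply [simp]:
  "\<lbrakk>openin X V; s \<in> \<Gamma> F V\<rbrakk> \<Longrightarrow> sheaf_comp X F \<psi> \<phi> V s = \<psi> V (\<phi> V s)"
  by (simp add: sheaf_comp_eq)

lemma sheaf_id_apply [simp]: "\<lbrakk>openin X V; s \<in> \<Gamma> F V\<rbrakk> \<Longrightarrow> sheaf_id X F V s = s"
  by (simp add: sheaf_id_eq)

lemma zero_hom_in:
  assumes F: "presheaf k X F" and G: "presheaf k X G"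
  shows "zero_hom X F G \<in> sheaf_hom k X F G"
  unfolding zero_hom_def
proof (rule family_hom_in[OF _ _ _ _ F])
  fix V s assume V: "openin X V"
  interpret G: left_module k "sec G V" by (rule presheaf_sec[OF G V])
  show "\<zero>\<^bsub>sec G V\<^esub> \<in> \<Gamma> G V" by simp
  show "\<zero>\<^bsub>sec G V\<^esub> = \<zero>\<^bsub>sec G V\<^esub> \<oplus>\<^bsub>sec G V\<^esub> \<zero>\<^bsub>sec G V\<^esub>" by simp
  show "\<zero>\<^bsub>sec G V\<^esub> = c \<odot>\<^bsub>sec G V\<^esub> \<zero>\<^bsub>sec G V\<^esub>" if "c \<in> carrier k" for c
    using that by (simp add: G.smult_zero)
qed (simp add: res_zero[OF G])

lemma add_hom_in:
  assumes F: "presheaf k X F" and G: "presheaf k X G"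
    and \<phi>: "\<phi> \<in> sheaf_hom k X F G" and \<psi>: "\<psi> \<in> sheaf_hom k X F G"
  shows "add_hom X F G \<phi> \<psi> \<in> sheaf_hom k X F G"
  unfolding add_hom_def
proof (rule family_hom_in[OF _ _ _ _ F])
  fix V s assume V: "openin X V" and s: "s \<in> \<Gamma> F V"
  interpret G: left_module k "sec G V" by (rule presheaf_sec[OF G V])
  note cl = hom_closed[OF \<phi> V] hom_closed[OF \<psi> V]
  show "\<phi> V s \<oplus>\<^bsub>sec G V\<^esub> \<psi> V s \<in> \<Gamma> G V"
    using s by (simp add: cl)
  show "\<phi> V (s \<oplus>\<^bsub>sec F V\<^esub> t) \<oplus>\<^bsub>sec G V\<^esub> \<psi> V (s \<oplus>\<^bsub>sec F V\<^esub> t) =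
      \<phi> V s \<oplus>\<^bsub>sec G V\<^esub> \<psi> V s \<oplus>\<^bsub>sec G V\<^esub> (\<phi> V t \<oplus>\<^bsub>sec G V\<^esub> \<psi> V t)" if "t \<in> \<Gamma> F V" for t
    using s that by (simp add: cl hom_add[OF \<phi> V] hom_add[OF \<psi> V] G.M.a_ac)
  show "\<phi> V (c \<odot>\<^bsub>sec F V\<^esub> s) \<oplus>\<^bsub>sec G V\<^esub> \<psi> V (c \<odot>\<^bsub>sec F V\<^esub> s) =
      c \<odot>\<^bsub>sec G V\<^esub> (\<phi> V s \<oplus>\<^bsub>sec G V\<^esub> \<psi> V s)" if "c \<in> carrier k" for c
    using s that by (simp add: cl hom_smult[OF \<phi> V] hom_smult[OF \<psi> V] G.smult_r_distr)
  fix W assume W: "openin X W" "W \<subseteq> V"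
  show "\<phi> W (res F V W s) \<oplus>\<^bsub>sec G W\<^esub> \<psi> W (res F V W s) = res G V W (\<phi> V s \<oplus>\<^bsub>sec G V\<^esub> \<psi> V s)"
    using s by (simp add: cl hom_res[OF \<phi> V W] hom_res[OF \<psi> V W]
        linear_map_add[OF presheaf_res_linear[OF G V W]])
qed

lemma comm_group_homs:
  assumes F: "presheaf k X F" and G: "presheaf k X G"
  shows "comm_group (Hom_group (sheaf_category k X S) F G)"
proof (rule comm_groupI)
  let ?H = "Hom_group (sheaf_category k X S) F G"
  have H: "carrier ?H = sheaf_hom k X F G" "\<And>\<phi> \<psi>. \<phi> \<otimes>\<^bsub>?H\<^esub> \<psi> = add_hom X F G \<phi> \<psi>" "\<one>\<^bsub>?H\<^esub> = zero_hom X F G"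
    by (simp_all add: Hom_group_def)
  note add = add_hom_in[OF F G] and zero = zero_hom_in[OF F G]
  show "\<one>\<^bsub>?H\<^esub> \<in> carrier ?H"
    by (simp add: H zero)
  fix \<phi> assume \<phi>: "\<phi> \<in> carrier ?H"
  then have \<phi>': "\<phi> \<in> sheaf_hom k X F G"
    by (simp add: H)
  have mod: "abelian_group (sec G V)" if "openin X V" for V
    using presheaf_sec[OF G that] by (simp add: left_module_def)
  then have mon: "abelian_monoid (sec G V)" if "openin X V" for V
    using that by (simp add: abelian_group_def)
  show "\<one>\<^bsub>?H\<^esub> \<otimes>\<^bsub>?H\<^esub> \<phi> = \<phi>"
    unfolding H by (rule hom_eqI[OF add[OF zero \<phi>'] \<phi>'])
      (simp add: hom_closed[OF \<phi>'] abelian_monoid.l_zero[OF mon])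
  show "\<phi> \<otimes>\<^bsub>?H\<^esub> \<psi> \<in> carrier ?H" if "\<psi> \<in> carrier ?H" for \<psi>
    using \<phi> that by (simp add: H add)
  show "\<phi> \<otimes>\<^bsub>?H\<^esub> \<psi> = \<psi> \<otimes>\<^bsub>?H\<^esub> \<phi>" if "\<psi> \<in> carrier ?H" for \<psi>
  proof -
    have \<psi>: "\<psi> \<in> sheaf_hom k X F G"
      using that by (simp add: H)
    show ?thesis
      unfolding H by (rule hom_eqI[OF add[OF \<phi>' \<psi>] add[OF \<psi> \<phi>']])
        (simp add: hom_closed[OF \<phi>'] hom_closed[OF \<psi>] abelian_monoid.a_comm[OF mon])
  qed
  show "\<phi> \<otimes>\<^bsub>?H\<^esub> \<psi> \<otimes>\<^bsub>?H\<^esub> \<omega> = \<phi> \<otimes>\<^bsub>?H\<^esub> (\<psi> \<otimes>\<^bsub>?H\<^esub> \<omega>)" if "\<psi> \<in> carrier ?H" "\<omega> \<in> carrier ?H" for \<psi> \<omega>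
  proof -
    have \<psi>: "\<psi> \<in> sheaf_hom k X F G" and \<omega>: "\<omega> \<in> sheaf_hom k X F G"
      using that by (simp_all add: H)
    show ?thesis
      unfolding H by (rule hom_eqI[OF add[OF add[OF \<phi>' \<psi>] \<omega>] add[OF \<phi>' add[OF \<psi> \<omega>]]])
        (simp add: hom_closed[OF \<phi>'] hom_closed[OF \<psi>] hom_closed[OF \<omega>] abelian_monoid.a_assoc[OF mon])
  qed
  let ?n = "family_hom X F (\<lambda>V s. \<ominus>\<^bsub>sec G V\<^esub> \<phi> V s)"
  have n: "?n \<in> sheaf_hom k X F G"
  proof (rule family_hom_in[OF _ _ _ _ F])
    fix V s assume V: "openin X V" and s: "s \<in> \<Gamma> F V"
    interpret G: left_module k "sec G V" by (rule presheaf_sec[OF G V])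
    note cl = hom_closed[OF \<phi>' V]
    show "\<ominus>\<^bsub>sec G V\<^esub> \<phi> V s \<in> \<Gamma> G V"
      using s by (simp add: cl)
    show "\<ominus>\<^bsub>sec G V\<^esub> \<phi> V (s \<oplus>\<^bsub>sec F V\<^esub> t) = \<ominus>\<^bsub>sec G V\<^esub> \<phi> V s \<oplus>\<^bsub>sec G V\<^esub> \<ominus>\<^bsub>sec G V\<^esub> \<phi> V t"
      if "t \<in> \<Gamma> F V" for t
      using s that by (simp add: cl hom_add[OF \<phi>' V] G.M.minus_add)
    show "\<ominus>\<^bsub>sec G V\<^esub> \<phi> V (c \<odot>\<^bsub>sec F V\<^esub> s) = c \<odot>\<^bsub>sec G V\<^esub> (\<ominus>\<^bsub>sec G V\<^esub> \<phi> V s)" if "c \<in> carrier k" for c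
      using s that by (simp add: cl hom_smult[OF \<phi>' V] G.smult_neg)
    fix W assume W: "openin X W" "W \<subseteq> V"
    interpret GW: left_module k "sec G W" by (rule presheaf_sec[OF G W(1)])
    note lin = presheaf_res_linear[OF G V W]
    show "\<ominus>\<^bsub>sec G W\<^esub> \<phi> W (res F V W s) = res G V W (\<ominus>\<^bsub>sec G V\<^esub> \<phi> V s)"
      using s by (simp add: cl hom_res[OF \<phi>' V W] G.neg_eq_smult GW.neg_eq_smult linear_map_closed[OF lin]
          linear_map_smult[OF lin])
  qed
  have "add_hom X F G ?n \<phi> = zero_hom X F G"
    by (rule hom_eqI[OF add[OF n \<phi>'] zero]) (simp add: hom_closed[OF \<phi>'] abelian_group.l_neg[OF mod])
  then show "\<exists>\<psi>\<in>carrier ?H. \<psi> \<otimes>\<^bsub>?H\<^esub> \<phi> = \<one>\<^bsub>?H\<^esub>"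
    unfolding H using n by blast
qed

lemma preadditive_sheaf_category:
  assumes S: "S \<subseteq> {F. sheaf k X F}"
  shows "preadditive_category (sheaf_category k X S)"
proof (rule preadditive_category.intro, unfold sheaf_category_simps, goal_cases)
  have pre: "presheaf k X F" if "F \<in> S" for F
    using that S by (auto intro: sheaf_presheaf)
  note comp = sheaf_comp_hom[OF pre] and id = sheaf_id_hom[OF pre] and add = add_hom_in[OF pre pre]
  {
    case (1 A)
    then show ?case by (rule id)
  next
    case (2 A B C f g)
    then show ?case by (intro comp)
  next
    case (3 A B f)
    then show ?case
      by (intro hom_eqI[OF comp[OF _ id]]) simp_all
  next
    case (4 A B f)
    then show ?case
      by (intro hom_eqI[OF comp[OF _ _ id]]) (simp_all add: hom_closed)
  next
    case (5 A B C E f g h)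
    then show ?case
      by (intro hom_eqI[OF comp[OF _ comp] comp[OF _ _ comp]]) (simp_all add: hom_closed)
  next
    case (6 A B)
    then show ?case by (intro comm_group_homs pre)
  next
    case (7 A B C f f' g)
    then show ?case
      by (intro hom_eqI[OF comp[OF _ add] add[OF _ _ comp comp]]) (simp_all add: hom_closed hom_add)
  next
    case (8 A B C f g g')
    then show ?case
      by (intro hom_eqI[OF comp[OF _ _ add] add[OF _ _ comp comp]]) (simp_all add: hom_closed)
  }
qed

text \<open>The morphisms in the universal properties below are all described on sections by a relation that
  determines the value.\<close>

lemma hom_of_relation:
  assumes T: "presheaf k X T" and P: "presheaf k X P"
    and ex: "\<And>V t. \<lbrakk>openin X V; t \<in> \<Gamma> T V\<rbrakk> \<Longrightarrow> \<exists>s\<in>\<Gamma> P V. R V t s"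
    and uniq: "\<And>V t s s'. \<lbrakk>openin X V; t \<in> \<Gamma> T V; s \<in> \<Gamma> P V; s' \<in> \<Gamma> P V; R V t s; R V t s'\<rbrakk> \<Longrightarrow> s = s'"
    and add: "\<And>V t t' s s'. \<lbrakk>openin X V; t \<in> \<Gamma> T V; t' \<in> \<Gamma> T V; s \<in> \<Gamma> P V; s' \<in> \<Gamma> P V; R V t s; R V t' s'\<rbrakk> \<Longrightarrow>
      R V (t \<oplus>\<^bsub>sec T V\<^esub> t') (s \<oplus>\<^bsub>sec P V\<^esub> s')"
    and smult: "\<And>V c t s. \<lbrakk>openin X V; c \<in> carrier k; t \<in> \<Gamma> T V; s \<in> \<Gamma> P V; R V t s\<rbrakk> \<Longrightarrow>
      R V (c \<odot>\<^bsub>sec T V\<^esub> t) (c \<odot>\<^bsub>sec P V\<^esub> s)"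
    and res: "\<And>V W t s. \<lbrakk>openin X V; openin X W; W \<subseteq> V; t \<in> \<Gamma> T V; s \<in> \<Gamma> P V; R V t s\<rbrakk> \<Longrightarrow>
      R W (res T V W t) (res P V W s)"
  obtains h where "h \<in> sheaf_hom k X T P" "\<And>V t. \<lbrakk>openin X V; t \<in> \<Gamma> T V\<rbrakk> \<Longrightarrow> R V t (h V t)"
proof -
  define f where "f V t = (SOME s. s \<in> \<Gamma> P V \<and> R V t s)" for V t
  have f: "f V t \<in> \<Gamma> P V \<and> R V t (f V t)" if "openin X V" "t \<in> \<Gamma> T V" for V t
    unfolding f_def by (rule someI_ex) (use ex[OF that] in blast)
  note cl = f[THEN conjunct1] and R = f[THEN conjunct2]
  have "family_hom X T f \<in> sheaf_hom k X T P"
  proof (rule family_hom_in[OF cl _ _ _ T])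
    fix V t assume V: "openin X V" and t: "t \<in> \<Gamma> T V"
    show "f V (t \<oplus>\<^bsub>sec T V\<^esub> t') = f V t \<oplus>\<^bsub>sec P V\<^esub> f V t'" if t': "t' \<in> \<Gamma> T V" for t'
      by (rule uniq[OF V presheaf_add_closed[OF T V t t']])
        (intro R cl add V t t' presheaf_add_closed[OF T] presheaf_add_closed[OF P])+
    show "f V (c \<odot>\<^bsub>sec T V\<^esub> t) = c \<odot>\<^bsub>sec P V\<^esub> f V t" if c: "c \<in> carrier k" for c
      by (rule uniq[OF V presheaf_smult_closed[OF T V c t]])
        (intro R cl smult V t c presheaf_smult_closed[OF T] presheaf_smult_closed[OF P])+
    fix W assume W: "openin X W" "W \<subseteq> V"
    show "f W (res T V W t) = res P V W (f V t)"
      by (rule uniq[OF W(1) presheaf_res_closed[OF T V W t]])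
        (intro R cl res V t W presheaf_res_closed[OF T] presheaf_res_closed[OF P])+
  qed
  moreover have "R V t (family_hom X T f V t)" if "openin X V" "t \<in> \<Gamma> T V" for V t
    using R[OF that] that by simp
  ultimately show ?thesis
    by (rule that)
qed

lemma zero_objectI:
  assumes S: "S \<subseteq> {F. sheaf k X F}" and Z: "Z \<in> S" "\<And>V. openin X V \<Longrightarrow> \<Gamma> Z V = {\<zero>\<^bsub>sec Z V\<^esub>}"
  shows "zero_object (sheaf_category k X S) Z"
  unfolding zero_object_def sheaf_category_simps
proof (intro conjI ballI Z(1))
  fix A assume "A \<in> S"
  then have A: "presheaf k X A" and PZ: "presheaf k X Z"
    using S Z(1) by (auto intro: sheaf_presheaf)
  show "\<exists>!f. f \<in> sheaf_hom k X A Z"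
  proof (rule ex1I[of _ "zero_hom X A Z"], rule zero_hom_in[OF A PZ])
    fix f assume f: "f \<in> sheaf_hom k X A Z"
    show "f = zero_hom X A Z"
      by (rule hom_eqI[OF f zero_hom_in[OF A PZ]]) (use hom_closed[OF f] Z(2) in auto)
  qed
  show "\<exists>!f. f \<in> sheaf_hom k X Z A"
  proof (rule ex1I[of _ "zero_hom X Z A"], rule zero_hom_in[OF PZ A])
    fix f assume f: "f \<in> sheaf_hom k X Z A"
    show "f = zero_hom X Z A"
      by (rule hom_eqI[OF f zero_hom_in[OF PZ A]]) (use hom_zero[OF PZ A f] Z(2) in auto)
  qed
qed

text \<open>In \<open>productI\<close>, \<open>kernelI\<close> and \<open>cokernelI\<close> the class \<open>S\<close> is arbitrary, so that they apply to the
  category of all sheaves as well as to its full subcategories.\<close>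

lemma productI:
  assumes S: "S \<subseteq> {F. sheaf k X F}" and obj: "A \<in> S" "B \<in> S" "P \<in> S"
    and p: "p \<in> sheaf_hom k X P A" and q: "q \<in> sheaf_hom k X P B"
    and bij: "\<And>V. openin X V \<Longrightarrow> bij_betw (\<lambda>s. (p V s, q V s)) (\<Gamma> P V) (\<Gamma> A V \<times> \<Gamma> B V)"
  shows "product (sheaf_category k X S) A B P p q"
  unfolding product_def sheaf_category_simps
proof (intro conjI ballI obj p q)
  fix T f g assume "T \<in> S" and f: "f \<in> sheaf_hom k X T A" and g: "g \<in> sheaf_hom k X T B"
  then have T: "presheaf k X T" and PP: "presheaf k X P"
    using S obj by (auto intro: sheaf_presheaf)
  have uniq: "s = s'" if "openin X V" "s \<in> \<Gamma> P V" "s' \<in> \<Gamma> P V" "p V s = p V s'" "q V s = q V s'" for V s s'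
    using inj_onD[OF bij_betw_imp_inj_on[OF bij[OF that(1)]] _ that(2,3)] that(4,5) by simp
  obtain h where h: "h \<in> sheaf_hom k X T P"
    and R: "\<And>V t. \<lbrakk>openin X V; t \<in> \<Gamma> T V\<rbrakk> \<Longrightarrow> p V (h V t) = f V t \<and> q V (h V t) = g V t"
  proof (rule hom_of_relation[OF T PP, of "\<lambda>V t s. p V s = f V t \<and> q V s = g V t"])
    fix V t assume V: "openin X V" and t: "t \<in> \<Gamma> T V"
    have "(f V t, g V t) \<in> (\<lambda>s. (p V s, q V s)) ` \<Gamma> P V"
      using bij_betw_imp_surj_on[OF bij[OF V]] hom_closed[OF f V t] hom_closed[OF g V t] by simp
    then show "\<exists>s\<in>\<Gamma> P V. p V s = f V t \<and> q V s = g V t"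
      by auto
  qed (use uniq in \<open>simp_all add: sheaf_homD[OF p] sheaf_homD[OF q] sheaf_homD[OF f] sheaf_homD[OF g]\<close>)
  show "\<exists>!h. h \<in> sheaf_hom k X T P \<and> sheaf_comp X T p h = f \<and> sheaf_comp X T q h = g"
  proof (rule ex1I[of _ h])
    show "h \<in> sheaf_hom k X T P \<and> sheaf_comp X T p h = f \<and> sheaf_comp X T q h = g"
      using h R by (auto intro!: hom_eqI[OF sheaf_comp_hom[OF T h p] f] hom_eqI[OF sheaf_comp_hom[OF T h q] g])
    fix h' assume h': "h' \<in> sheaf_hom k X T P \<and> sheaf_comp X T p h' = f \<and> sheaf_comp X T q h' = g"
    then have hom: "h' \<in> sheaf_hom k X T P" and eq: "sheaf_comp X T p h' = f" "sheaf_comp X T q h' = g"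
      by simp_all
    show "h' = h"
    proof (rule hom_eqI[OF hom h])
      fix V t assume V: "openin X V" and t: "t \<in> \<Gamma> T V"
      have "p V (h' V t) = f V t" "q V (h' V t) = g V t"
        using V t by (simp_all add: eq[symmetric])
      then show "h' V t = h V t"
        using uniq[OF V hom_closed[OF hom V t] hom_closed[OF h V t]] R[OF V t] by simp
    qed
  qed
qed

lemma kernelI:
  assumes S: "S \<subseteq> {F. sheaf k X F}" and obj: "A \<in> S" "B \<in> S" "K \<in> S"
    and f: "f \<in> sheaf_hom k X A B" and i: "i \<in> sheaf_hom k X K A"
    and inj: "\<And>V. openin X V \<Longrightarrow> inj_on (i V) (\<Gamma> K V)"
    and im: "\<And>V. openin X V \<Longrightarrow> i V ` \<Gamma> K V = kernel_sections A B f V"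
  shows "kernel_of (sheaf_category k X S) A B f K i"
  unfolding kernel_of_def sheaf_category_simps
proof (intro conjI ballI impI obj i)
  have PK: "presheaf k X K" and PB: "presheaf k X B"
    using S obj by (auto intro: sheaf_presheaf)
  show "sheaf_comp X K f i = zero_hom X K B"
    by (rule hom_eqI[OF sheaf_comp_hom[OF PK i f] zero_hom_in[OF PK PB]])
      (use im in \<open>auto simp: kernel_sections_def\<close>)
  fix T g assume "T \<in> S" and g: "g \<in> sheaf_hom k X T A" and z: "sheaf_comp X T f g = zero_hom X T B"
  then have T: "presheaf k X T"
    using S by (auto intro: sheaf_presheaf)
  have uniq: "s = s'" if "openin X V" "s \<in> \<Gamma> K V" "s' \<in> \<Gamma> K V" "i V s = i V s'" for V s s'
    using inj_onD[OF inj[OF that(1)] that(4,2,3)] .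
  obtain h where h: "h \<in> sheaf_hom k X T K" and R: "\<And>V t. \<lbrakk>openin X V; t \<in> \<Gamma> T V\<rbrakk> \<Longrightarrow> i V (h V t) = g V t"
  proof (rule hom_of_relation[OF T PK, of "\<lambda>V t s. i V s = g V t"])
    fix V t assume V: "openin X V" and t: "t \<in> \<Gamma> T V"
    have "f V (g V t) = \<zero>\<^bsub>sec B V\<^esub>"
      using fun_cong[OF fun_cong[OF z], of V t] V t by simp
    then have "g V t \<in> i V ` \<Gamma> K V"
      using im[OF V] hom_closed[OF g V t] by (simp add: kernel_sections_def)
    then show "\<exists>s\<in>\<Gamma> K V. i V s = g V t"
      by auto
  qed (use uniq in \<open>simp_all add: sheaf_homD[OF i] sheaf_homD[OF g]\<close>)
  show "\<exists>!h. h \<in> sheaf_hom k X T K \<and> sheaf_comp X T i h = g"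
  proof (rule ex1I[of _ h])
    show "h \<in> sheaf_hom k X T K \<and> sheaf_comp X T i h = g"
      using h R by (auto intro!: hom_eqI[OF sheaf_comp_hom[OF T h i] g])
    fix h' assume h': "h' \<in> sheaf_hom k X T K \<and> sheaf_comp X T i h' = g"
    then have hom: "h' \<in> sheaf_hom k X T K" and eq: "sheaf_comp X T i h' = g"
      by simp_all
    show "h' = h"
    proof (rule hom_eqI[OF hom h])
      fix V t assume V: "openin X V" and t: "t \<in> \<Gamma> T V"
      have "i V (h' V t) = g V t"
        using V t by (simp add: eq[symmetric])
      then show "h' V t = h V t"
        using uniq[OF V hom_closed[OF hom V t] hom_closed[OF h V t]] R[OF V t] by simp
    qed
  qed
qed

text \<open>A map out of the quotient is computed by lifting locally: on sections with equal images in \<open>Q\<close>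
  the given map \<open>g\<close> takes equal values, since they differ locally by sections coming from \<open>A\<close>.\<close>

lemma cokernelI:
  assumes S: "S \<subseteq> {F. sheaf k X F}" and obj: "A \<in> S" "B \<in> S" "Q \<in> S"
    and ex: "right_exact_seq k X A B Q f p"
  shows "cokernel_of (sheaf_category k X S) A B f Q p"
  unfolding cokernel_of_def sheaf_category_simps
proof (intro conjI ballI impI obj)
  have shQ: "sheaf k X Q" and shB: "sheaf k X B"
    and PA: "presheaf k X A" and PB: "presheaf k X B" and PQ: "presheaf k X Q"
    using S obj by (auto intro: sheaf_presheaf)
  note f = right_exact_hom(1)[OF ex] and p = right_exact_hom(2)[OF ex]
  show "p \<in> sheaf_hom k X B Q"
    by (rule p)
  show "sheaf_comp X A p f = zero_hom X A Q"
    by (rule hom_eqI[OF sheaf_comp_hom[OF PA f p] zero_hom_in[OF PA PQ]])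
      (simp add: right_exact_comp_zero[OF PB ex])
  fix T g assume "T \<in> S" and g: "g \<in> sheaf_hom k X B T" and z: "sheaf_comp X A g f = zero_hom X A T"
  then have shT: "sheaf k X T" and PT: "presheaf k X T"
    using S by (auto intro: sheaf_presheaf)
  have key: "g V s = g V s'"
    if V: "openin X V" and s: "s \<in> \<Gamma> B V" "s' \<in> \<Gamma> B V" and eq: "p V s = p V s'" for V s s'
  proof (rule sheaf_separate[OF shT V hom_closed[OF g V s(1)] hom_closed[OF g V s(2)]])
    fix x assume x: "x \<in> V"
    let ?d = "s \<ominus>\<^bsub>sec B V\<^esub> s'"
    have d: "?d \<in> \<Gamma> B V"
      by (rule presheaf_minus_closed[OF PB V s])
    have "p V ?d = \<zero>\<^bsub>sec Q V\<^esub>"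
      using hom_minus[OF PB PQ p V s] eq left_module_minus_eq_zero[OF presheaf_sec[OF PQ V]]
        hom_closed[OF p V s(2)] by simp
    then obtain W a where W: "openin X W" "x \<in> W" "W \<subseteq> V" and a: "a \<in> \<Gamma> A W" "res B V W ?d = f W a"
      using right_exact_kernelD[OF ex V d _ x] by blast
    have "g W (f W a) = \<zero>\<^bsub>sec T W\<^esub>"
      using fun_cong[OF fun_cong[OF z], of W a] W(1) a(1) by simp
    then have "res T V W (g V ?d) = \<zero>\<^bsub>sec T W\<^esub>"
      using hom_res[OF g V W(1,3) d] a(2) by simp
    then have "res T V W (g V s) \<ominus>\<^bsub>sec T W\<^esub> res T V W (g V s') = \<zero>\<^bsub>sec T W\<^esub>"
      using hom_minus[OF PB PT g V s] res_minus[OF PT V W(1,3) hom_closed[OF g V s(1)] hom_closed[OF g V s(2)]]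
      by simp
    then have "res T V W (g V s) = res T V W (g V s')"
      using left_module_minus_eq_zero[OF presheaf_sec[OF PT W(1)]]
        presheaf_res_closed[OF PT V W(1,3)] hom_closed[OF g V] s by simp
    then show "\<exists>W. openin X W \<and> x \<in> W \<and> W \<subseteq> V \<and> res T V W (g V s) = res T V W (g V s')"
      using W by blast
  qed
  \<comment> \<open>\<open>t\<close> is locally the value under \<open>g\<close> of a lift of \<open>q\<close>.\<close>
  define R where "R V q t \<longleftrightarrow> (\<forall>x\<in>V. \<exists>W s. openin X W \<and> x \<in> W \<and> W \<subseteq> V \<and> s \<in> \<Gamma> B W \<and>
    p W s = res Q V W q \<and> res T V W t = g W s)" for V q t
  have Rres: "R W (res Q V W q) (res T V W t)"
    if V: "openin X V" and W: "openin X W" "W \<subseteq> V" and q: "q \<in> \<Gamma> Q V" and t: "t \<in> \<Gamma> T V" and R: "R V q t" for V W q t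
    unfolding R_def
  proof
    fix x assume x: "x \<in> W"
    then obtain A' s where A: "openin X A'" "x \<in> A'" "A' \<subseteq> V" and s: "s \<in> \<Gamma> B A'" "p A' s = res Q V A' q" "res T V A' t = g A' s"
      using R W(2) unfolding R_def by blast
    let ?I = "A' \<inter> W"
    have I: "openin X ?I" "?I \<subseteq> A'" "?I \<subseteq> W"
      using A W by auto
    have "p ?I (res B A' ?I s) = res Q W ?I (res Q V W q)"
      using hom_res[OF p A(1) I(1,2) s(1)] s(2) presheaf_res_res[OF PQ V A(1) I(1,2) A(3) q]
        presheaf_res_res[OF PQ V W(1) I(1,3) W(2) q] by simp
    moreover have "res T W ?I (res T V W t) = g ?I (res B A' ?I s)"
      using hom_res[OF g A(1) I(1,2) s(1)] s(3) presheaf_res_res[OF PT V A(1) I(1,2) A(3) t]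
        presheaf_res_res[OF PT V W(1) I(1,3) W(2) t] by simp
    ultimately show "\<exists>W' s. openin X W' \<and> x \<in> W' \<and> W' \<subseteq> W \<and> s \<in> \<Gamma> B W' \<and>
        p W' s = res Q W W' (res Q V W q) \<and> res T W W' (res T V W t) = g W' s"
      using I x A(2) presheaf_res_closed[OF PB A(1) I(1,2) s(1)]
      by (intro exI[of _ ?I] exI[of _ "res B A' ?I s"]) simp
  qed
  have uniq: "t = t'" if V: "openin X V" and q: "q \<in> \<Gamma> Q V" and t: "t \<in> \<Gamma> T V" "t' \<in> \<Gamma> T V"
    and R: "R V q t" "R V q t'" for V q t t'
  proof (rule sheaf_separate[OF shT V t])
    fix x assume x: "x \<in> V"
    obtain W s where W: "openin X W" "x \<in> W" "W \<subseteq> V" and s: "s \<in> \<Gamma> B W" "p W s = res Q V W q" "res T V W t = g W s"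
      using R(1) x unfolding R_def by blast
    obtain W' s' where W': "openin X W'" "x \<in> W'" "W' \<subseteq> V" and s': "s' \<in> \<Gamma> B W'" "p W' s' = res Q V W' q" "res T V W' t' = g W' s'"
      using R(2) x unfolding R_def by blast
    let ?I = "W \<inter> W'"
    have I: "openin X ?I" "?I \<subseteq> W" "?I \<subseteq> W'" "x \<in> ?I" "?I \<subseteq> V"
      using W W' by auto
    have "p ?I (res B W ?I s) = p ?I (res B W' ?I s')"
      using hom_res[OF p W(1) I(1,2) s(1)] s(2) presheaf_res_res[OF PQ V W(1) I(1,2) W(3) q]
        hom_res[OF p W'(1) I(1,3) s'(1)] s'(2) presheaf_res_res[OF PQ V W'(1) I(1,3) W'(3) q] by simp
    then have "g ?I (res B W ?I s) = g ?I (res B W' ?I s')"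
      by (rule key[OF I(1) presheaf_res_closed[OF PB W(1) I(1,2) s(1)] presheaf_res_closed[OF PB W'(1) I(1,3) s'(1)]])
    then have "res T V ?I t = res T V ?I t'"
      using hom_res[OF g W(1) I(1,2) s(1)] s(3) presheaf_res_res[OF PT V W(1) I(1,2) W(3) t(1)]
        hom_res[OF g W'(1) I(1,3) s'(1)] s'(3) presheaf_res_res[OF PT V W'(1) I(1,3) W'(3) t(2)] by simp
    then show "\<exists>W. openin X W \<and> x \<in> W \<and> W \<subseteq> V \<and> res T V W t = res T V W t'"
      using I by blast
  qed
  have Rex: "\<exists>t\<in>\<Gamma> T V. R V q t" if V: "openin X V" and q: "q \<in> \<Gamma> Q V" for V q
  proof -
    define \<U> where "\<U> = {W. openin X W \<and> W \<subseteq> V \<and> (\<exists>s\<in>\<Gamma> B W. p W s = res Q V W q)}"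
    have "\<exists>s. s \<in> \<Gamma> B W \<and> p W s = res Q V W q" if "W \<in> \<U>" for W
      using that by (auto simp: \<U>_def)
    then obtain \<sigma> where \<sigma>: "\<And>W. W \<in> \<U> \<Longrightarrow> \<sigma> W \<in> \<Gamma> B W" "\<And>W. W \<in> \<U> \<Longrightarrow> p W (\<sigma> W) = res Q V W q"
      by metis
    have op: "openin X W" "W \<subseteq> V" if "W \<in> \<U>" for W
      using that by (auto simp: \<U>_def)
    have cov: "\<exists>W. W \<in> \<U> \<and> x \<in> W" if x: "x \<in> V" for x
    proof -
      obtain W s where "openin X W" "x \<in> W" "W \<subseteq> V" "s \<in> \<Gamma> B W" "res Q V W q = p W s"
        using right_exact_surj[OF ex V q x] by blast
      then have "W \<in> \<U>"
        unfolding \<U>_def by (auto intro!: bexI[of _ s])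
      with \<open>x \<in> W\<close> show ?thesis by blast
    qed
    then have U: "\<Union>\<U> = V"
      using op(2) by blast
    obtain t where t: "t \<in> \<Gamma> T (\<Union>\<U>)" "\<And>W. W \<in> \<U> \<Longrightarrow> res T (\<Union>\<U>) W t = g W (\<sigma> W)"
    proof (rule sheaf_glue[OF shT, of \<U> "\<lambda>W. g W (\<sigma> W)"])
      fix W W' assume W: "W \<in> \<U>" "W' \<in> \<U>"
      let ?I = "W \<inter> W'"
      have I: "openin X ?I"
        using op W by blast
      have val: "p ?I (res B A' ?I (\<sigma> A')) = res Q V ?I q" if "A' \<in> \<U>" "?I \<subseteq> A'" for A'
        using hom_res[OF p op(1)[OF that(1)] I that(2) \<sigma>(1)[OF that(1)]] \<sigma>(2)[OF that(1)]
          presheaf_res_res[OF PQ V op(1)[OF that(1)] I that(2) op(2)[OF that(1)] q] by simp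
      have cl: "res B A' ?I (\<sigma> A') \<in> \<Gamma> B ?I" if "A' \<in> \<U>" "?I \<subseteq> A'" for A'
        by (rule presheaf_res_closed[OF PB op(1)[OF that(1)] I that(2) \<sigma>(1)[OF that(1)]])
      have "g ?I (res B W ?I (\<sigma> W)) = g ?I (res B W' ?I (\<sigma> W'))"
        by (rule key[OF I cl[OF W(1)] cl[OF W(2)]]) (simp_all add: val W)
      then show "res T W ?I (g W (\<sigma> W)) = res T W' ?I (g W' (\<sigma> W'))"
        by (simp add: hom_res[OF g op(1) I _ \<sigma>(1)] W)
    qed (use op \<sigma> hom_closed[OF g] in auto)
    have "R V q t"
      unfolding R_def
    proof
      fix x assume "x \<in> V"
      then obtain W where W: "W \<in> \<U>" "x \<in> W"
        using cov by blast
      have "res T V W t = g W (\<sigma> W)"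
        using t(2)[OF W(1)] by (simp add: U)
      then show "\<exists>W s. openin X W \<and> x \<in> W \<and> W \<subseteq> V \<and> s \<in> \<Gamma> B W \<and> p W s = res Q V W q \<and> res T V W t = g W s"
        using op[OF W(1)] \<sigma>[OF W(1)] W(2) by (intro exI[of _ W] exI[of _ "\<sigma> W"]) simp
    qed
    then show ?thesis
      using t(1) by (auto simp: U)
  qed
  obtain h where h: "h \<in> sheaf_hom k X Q T" and hR: "\<And>V q. \<lbrakk>openin X V; q \<in> \<Gamma> Q V\<rbrakk> \<Longrightarrow> R V q (h V q)"
  proof (rule hom_of_relation[OF PQ PT, of R])
    show "\<exists>t\<in>\<Gamma> T V. R V q t" if "openin X V" "q \<in> \<Gamma> Q V" for V q
      by (rule Rex[OF that])
    show "t = t'" if "openin X V" "q \<in> \<Gamma> Q V" "t \<in> \<Gamma> T V" "t' \<in> \<Gamma> T V" "R V q t" "R V q t'" for V q t t'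
      by (rule uniq[OF that])
    show "R W (res Q V W q) (res T V W t)"
      if "openin X V" "openin X W" "W \<subseteq> V" "q \<in> \<Gamma> Q V" "t \<in> \<Gamma> T V" "R V q t" for V W q t
      by (rule Rres[OF that])
  next
    fix V q q' t t' assume V: "openin X V" and q: "q \<in> \<Gamma> Q V" "q' \<in> \<Gamma> Q V" and t: "t \<in> \<Gamma> T V" "t' \<in> \<Gamma> T V"
      and R: "R V q t" "R V q' t'"
    show "R V (q \<oplus>\<^bsub>sec Q V\<^esub> q') (t \<oplus>\<^bsub>sec T V\<^esub> t')"
      unfolding R_def
    proof
      fix x assume x: "x \<in> V"
      obtain W s where W: "openin X W" "x \<in> W" "W \<subseteq> V" and s: "s \<in> \<Gamma> B W" "p W s = res Q V W q" "res T V W t = g W s"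
        using R(1) x unfolding R_def by blast
      obtain W' s' where W': "openin X W'" "x \<in> W'" "W' \<subseteq> V" and s': "s' \<in> \<Gamma> B W'" "p W' s' = res Q V W' q'" "res T V W' t' = g W' s'"
        using R(2) x unfolding R_def by blast
      let ?I = "W \<inter> W'"
      have I: "openin X ?I" "?I \<subseteq> W" "?I \<subseteq> W'" "x \<in> ?I" "?I \<subseteq> V"
        using W W' by auto
      let ?s = "res B W ?I s" and ?s' = "res B W' ?I s'"
      have cl: "?s \<in> \<Gamma> B ?I" "?s' \<in> \<Gamma> B ?I"
        by (rule presheaf_res_closed[OF PB W(1) I(1,2) s(1)], rule presheaf_res_closed[OF PB W'(1) I(1,3) s'(1)])
      have pp: "p ?I ?s = res Q V ?I q" "p ?I ?s' = res Q V ?I q'"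
        using hom_res[OF p W(1) I(1,2) s(1)] s(2) presheaf_res_res[OF PQ V W(1) I(1,2) W(3) q(1)]
          hom_res[OF p W'(1) I(1,3) s'(1)] s'(2) presheaf_res_res[OF PQ V W'(1) I(1,3) W'(3) q(2)] by simp_all
      have gg: "g ?I ?s = res T V ?I t" "g ?I ?s' = res T V ?I t'"
        using hom_res[OF g W(1) I(1,2) s(1)] s(3) presheaf_res_res[OF PT V W(1) I(1,2) W(3) t(1)]
          hom_res[OF g W'(1) I(1,3) s'(1)] s'(3) presheaf_res_res[OF PT V W'(1) I(1,3) W'(3) t(2)] by simp_all
      show "\<exists>W s. openin X W \<and> x \<in> W \<and> W \<subseteq> V \<and> s \<in> \<Gamma> B W \<and>
          p W s = res Q V W (q \<oplus>\<^bsub>sec Q V\<^esub> q') \<and> res T V W (t \<oplus>\<^bsub>sec T V\<^esub> t') = g W s"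
        using I cl pp gg presheaf_add_closed[OF PB I(1) cl] hom_add[OF p I(1) cl] hom_add[OF g I(1) cl]
          linear_map_add[OF presheaf_res_linear[OF PQ V I(1,5)] q]
          linear_map_add[OF presheaf_res_linear[OF PT V I(1,5)] t]
        by (intro exI[of _ ?I] exI[of _ "?s \<oplus>\<^bsub>sec B ?I\<^esub> ?s'"]) simp
    qed
  next
    fix V c q t assume V: "openin X V" and c: "c \<in> carrier k" and q: "q \<in> \<Gamma> Q V" and t: "t \<in> \<Gamma> T V" and R: "R V q t"
    show "R V (c \<odot>\<^bsub>sec Q V\<^esub> q) (c \<odot>\<^bsub>sec T V\<^esub> t)"
      unfolding R_def
    proof
      fix x assume x: "x \<in> V"
      obtain W s where W: "openin X W" "x \<in> W" "W \<subseteq> V" and s: "s \<in> \<Gamma> B W" "p W s = res Q V W q" "res T V W t = g W s"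
        using R x unfolding R_def by blast
      show "\<exists>W s. openin X W \<and> x \<in> W \<and> W \<subseteq> V \<and> s \<in> \<Gamma> B W \<and>
          p W s = res Q V W (c \<odot>\<^bsub>sec Q V\<^esub> q) \<and> res T V W (c \<odot>\<^bsub>sec T V\<^esub> t) = g W s"
        using W s presheaf_smult_closed[OF PB W(1) c s(1)] hom_smult[OF p W(1) c s(1)] hom_smult[OF g W(1) c s(1)]
          linear_map_smult[OF presheaf_res_linear[OF PQ V W(1,3)] c q]
          linear_map_smult[OF presheaf_res_linear[OF PT V W(1,3)] c t]
        by (intro exI[of _ W] exI[of _ "c \<odot>\<^bsub>sec B W\<^esub> s"]) simp
    qed
  qed blast
  show "\<exists>!h. h \<in> sheaf_hom k X Q T \<and> sheaf_comp X B h p = g"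
  proof (rule ex1I[of _ h])
    have "sheaf_comp X B h p = g"
    proof (rule hom_eqI[OF sheaf_comp_hom[OF PB p h] g])
      fix V s assume V: "openin X V" and s: "s \<in> \<Gamma> B V"
      note ps = hom_closed[OF p V s] and gs = hom_closed[OF g V s]
      have "R V (p V s) (g V s)"
        unfolding R_def using V s presheaf_res_self[OF PQ V ps] presheaf_res_self[OF PT V gs]
        by (intro ballI exI[of _ V] exI[of _ s]) simp
      then show "sheaf_comp X B h p V s = g V s"
        using uniq[OF V ps hom_closed[OF h V ps] gs hR[OF V ps]] V s by simp
    qed
    then show "h \<in> sheaf_hom k X Q T \<and> sheaf_comp X B h p = g"
      using h by blast
    fix h' assume "h' \<in> sheaf_hom k X Q T \<and> sheaf_comp X B h' p = g"
    then have h': "h' \<in> sheaf_hom k X Q T" and eq: "sheaf_comp X B h' p = g"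
      by simp_all
    show "h' = h"
    proof (rule hom_eqI[OF h' h])
      fix V q assume V: "openin X V" and q: "q \<in> \<Gamma> Q V"
      have "R V q (h' V q)"
        unfolding R_def
      proof
        fix x assume x: "x \<in> V"
        obtain W s where W: "openin X W" "x \<in> W" "W \<subseteq> V" and s: "s \<in> \<Gamma> B W" "res Q V W q = p W s"
          using right_exact_surj[OF ex V q x] by blast
        have "h' W (p W s) = g W s"
          using W(1) s(1) by (simp add: eq[symmetric])
        then show "\<exists>W s. openin X W \<and> x \<in> W \<and> W \<subseteq> V \<and> s \<in> \<Gamma> B W \<and> p W s = res Q V W q \<and> res T V W (h' V q) = g W s"
          using W s hom_res[OF h' V W(1,3) q] by (intro exI[of _ W] exI[of _ s]) simp
      qed
      then show "h' V q = h V q"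
        by (rule uniq[OF V q hom_closed[OF h' V q] hom_closed[OF h V q] _ hR[OF V q]])
    qed
  qed
qed

section \<open>Classes of sheaves closed under products, kernels and cokernels\<close>

lemma comp_zero_right:
  assumes "presheaf k X T" "presheaf k X A" "presheaf k X B" "f \<in> sheaf_hom k X A B"
  shows "sheaf_comp X T f (zero_hom X T A) = zero_hom X T B"
  by (rule hom_eqI[OF sheaf_comp_hom[OF assms(1) zero_hom_in[OF assms(1,2)] assms(4)] zero_hom_in[OF assms(1,3)]])
    (simp add: hom_zero[OF assms(2-4)])

lemma comp_zero_left:
  assumes "presheaf k X A" "presheaf k X B" "presheaf k X T" "f \<in> sheaf_hom k X A B"
  shows "sheaf_comp X A (zero_hom X B T) f = zero_hom X A T"
  by (rule hom_eqI[OF sheaf_comp_hom[OF assms(1,4) zero_hom_in[OF assms(2,3)]] zero_hom_in[OF assms(1,3)]])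
    (simp add: hom_closed[OF assms(4)])

text \<open>Vanishing is a local condition, so \<open>g\<close> kills not only the values of \<open>f\<close> but all sections that
  locally are values of \<open>f\<close>.\<close>

lemma image_sections_sub_kernel:
  assumes B: "presheaf k X B" and E: "sheaf k X E" and g: "g \<in> sheaf_hom k X B E"
    and z: "sheaf_comp X A g f = zero_hom X A E" and V: "openin X V"
  shows "image_sections X A B f V \<subseteq> kernel_sections B E g V"
proof
  fix t assume t: "t \<in> image_sections X A B f V"
  then have tB: "t \<in> \<Gamma> B V"
    by (simp add: image_sections_def)
  have "g V t = \<zero>\<^bsub>sec E V\<^esub>"
  proof (rule sheaf_separate[OF E V hom_closed[OF g V tB] presheaf_zero_closed[OF sheaf_presheaf[OF E] V]])
    fix x assume "x \<in> V"
    then obtain W s where W: "openin X W" "x \<in> W" "W \<subseteq> V" and s: "s \<in> \<Gamma> A W" "res B V W t = f W s"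
      using t unfolding image_sections_def by blast
    have "g W (f W s) = \<zero>\<^bsub>sec E W\<^esub>"
      using fun_cong[OF fun_cong[OF z], of W s] W(1) s(1) by simp
    then have "res E V W (g V t) = res E V W \<zero>\<^bsub>sec E V\<^esub>"
      using hom_res[OF g V W(1,3) tB] s(2) res_zero[OF sheaf_presheaf[OF E] V W(1,3)] by simp
    then show "\<exists>W. openin X W \<and> x \<in> W \<and> W \<subseteq> V \<and> res E V W (g V t) = res E V W \<zero>\<^bsub>sec E V\<^esub>"
      using W by blast
  qed
  then show "t \<in> kernel_sections B E g V"
    using tB by (simp add: kernel_sections_def)
qed

lemma image_sub_image_sections:
  assumes B: "presheaf k X B" and f: "f \<in> sheaf_hom k X A B" and V: "openin X V"
  shows "f V ` \<Gamma> A V \<subseteq> image_sections X A B f V"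
proof (intro image_subsetI)
  fix s assume s: "s \<in> \<Gamma> A V"
  have "res B V V (f V s) \<in> f V ` \<Gamma> A V"
    using presheaf_res_self[OF B V hom_closed[OF f V s]] s by simp
  then show "f V s \<in> image_sections X A B f V"
    unfolding image_sections_def using V hom_closed[OF f V s] by blast
qed

text \<open>For an injective map the local preimages are unique, so they glue.\<close>

lemma image_sections_injective:
  assumes A: "sheaf k X A" and B: "sheaf k X B" and f: "f \<in> sheaf_hom k X A B"
    and inj: "\<And>V. openin X V \<Longrightarrow> inj_on (f V) (\<Gamma> A V)" and V: "openin X V"
  shows "image_sections X A B f V = f V ` \<Gamma> A V"
proof (intro subset_antisym image_sub_image_sections[OF sheaf_presheaf[OF B] f V] subsetI)
  fix t assume t: "t \<in> image_sections X A B f V"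
  then have tB: "t \<in> \<Gamma> B V"
    by (simp add: image_sections_def)
  define \<U> where "\<U> = {W. openin X W \<and> W \<subseteq> V \<and> res B V W t \<in> f W ` \<Gamma> A W}"
  have U: "\<Union>\<U> = V"
    using t unfolding image_sections_def \<U>_def by blast
  have "\<exists>s. s \<in> \<Gamma> A W \<and> f W s = res B V W t" if "W \<in> \<U>" for W
    using that by (force simp: \<U>_def)
  then obtain \<sigma> where \<sigma>: "\<And>W. W \<in> \<U> \<Longrightarrow> \<sigma> W \<in> \<Gamma> A W" "\<And>W. W \<in> \<U> \<Longrightarrow> f W (\<sigma> W) = res B V W t"
    by metis
  have op: "openin X W" "W \<subseteq> V" if "W \<in> \<U>" for W
    using that by (auto simp: \<U>_def)
  obtain s where s: "s \<in> \<Gamma> A (\<Union>\<U>)" "\<And>W. W \<in> \<U> \<Longrightarrow> res A (\<Union>\<U>) W s = \<sigma> W"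
  proof (rule sheaf_glue[OF A, of \<U> \<sigma>])
    fix W W' assume W: "W \<in> \<U>" "W' \<in> \<U>"
    let ?I = "W \<inter> W'"
    have I: "openin X ?I"
      using op W by blast
    have val: "f ?I (res A C ?I (\<sigma> C)) = res B V ?I t" if "C \<in> \<U>" "?I \<subseteq> C" for C
      using hom_res[OF f op(1)[OF that(1)] I that(2) \<sigma>(1)[OF that(1)]] \<sigma>(2)[OF that(1)]
        sheaf_res_res[OF B V op(1)[OF that(1)] I that(2) op(2)[OF that(1)] tB] by simp
    have cl: "res A C ?I (\<sigma> C) \<in> \<Gamma> A ?I" if "C \<in> \<U>" "?I \<subseteq> C" for C
      by (rule sheaf_res_closed[OF A op(1)[OF that(1)] I that(2) \<sigma>(1)[OF that(1)]])
    show "res A W ?I (\<sigma> W) = res A W' ?I (\<sigma> W')"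
      by (rule inj_onD[OF inj[OF I] _ cl[OF W(1)] cl[OF W(2)]]) (simp_all add: val W)
  qed (use op \<sigma> in auto)
  have sV: "s \<in> \<Gamma> A V"
    using s(1) U by simp
  have "f V s = t"
  proof (rule sheaf_separate[OF B V hom_closed[OF f V sV] tB])
    fix x assume "x \<in> V"
    then obtain W where W: "W \<in> \<U>" "x \<in> W"
      using U by blast
    have "res B V W (f V s) = res B V W t"
      using hom_res[OF f V op[OF W(1)] sV] s(2)[OF W(1)] \<sigma>(2)[OF W(1)] U by simp
    then show "\<exists>W. openin X W \<and> x \<in> W \<and> W \<subseteq> V \<and> res B V W (f V s) = res B V W t"
      using W op by blast
  qed
  then show "t \<in> f V ` \<Gamma> A V"
    using sV by blast
qed

text \<open>The closure conditions are stated on sections, so that they can be verified for concrete sheaves;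
  by \<open>productI\<close>, \<open>kernelI\<close> and \<open>cokernelI\<close> they yield the universal properties.\<close>

locale closed_sheaf_class =
  fixes k :: "('k, 'r) ring_scheme" and X :: "'x topology" and S :: "('x, 'k, 'u) presheaf set"
  assumes S: "S \<subseteq> {F. sheaf k X F}"
    and zero: "\<exists>Z\<in>S. \<forall>V. openin X V \<longrightarrow> \<Gamma> Z V = {\<zero>\<^bsub>sec Z V\<^esub>}"
    and products: "\<lbrakk>A \<in> S; B \<in> S\<rbrakk> \<Longrightarrow> \<exists>P\<in>S. \<exists>p\<in>sheaf_hom k X P A. \<exists>q\<in>sheaf_hom k X P B.
      \<forall>V. openin X V \<longrightarrow> bij_betw (\<lambda>s. (p V s, q V s)) (\<Gamma> P V) (\<Gamma> A V \<times> \<Gamma> B V)"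
    and kernels: "\<lbrakk>A \<in> S; B \<in> S; f \<in> sheaf_hom k X A B\<rbrakk> \<Longrightarrow> \<exists>K\<in>S. \<exists>i\<in>sheaf_hom k X K A.
      \<forall>V. openin X V \<longrightarrow> inj_on (i V) (\<Gamma> K V) \<and> i V ` \<Gamma> K V = kernel_sections A B f V"
    and cokernels: "\<lbrakk>A \<in> S; B \<in> S; f \<in> sheaf_hom k X A B\<rbrakk> \<Longrightarrow> \<exists>Q\<in>S. \<exists>p. right_exact_seq k X A B Q f p"
begin

lemma sh: "A \<in> S \<Longrightarrow> sheaf k X A"
  using S by blast

lemma pre: "A \<in> S \<Longrightarrow> presheaf k X A"
  by (rule sheaf_presheaf[OF sh])

lemma kernel_obtain:
  assumes "A \<in> S" "B \<in> S" "f \<in> sheaf_hom k X A B"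
  obtains K i where "K \<in> S" "i \<in> sheaf_hom k X K A" "\<And>V. openin X V \<Longrightarrow> inj_on (i V) (\<Gamma> K V)"
    "\<And>V. openin X V \<Longrightarrow> i V ` \<Gamma> K V = kernel_sections A B f V" "sheaf_comp X K f i = zero_hom X K B"
proof -
  obtain K i where K: "K \<in> S" "i \<in> sheaf_hom k X K A"
    and i: "\<And>V. openin X V \<Longrightarrow> inj_on (i V) (\<Gamma> K V) \<and> i V ` \<Gamma> K V = kernel_sections A B f V"
    using kernels[OF assms] by blast
  have "kernel_of (sheaf_category k X S) A B f K i"
    by (rule kernelI[OF S assms(1,2) K(1) assms(3) K(2)]) (use i in blast)+
  then have "sheaf_comp X K f i = zero_hom X K B"
    by (simp add: kernel_of_def)
  then show ?thesis
    using that[OF K] i by blast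
qed

lemma cokernel_obtain:
  assumes "A \<in> S" "B \<in> S" "f \<in> sheaf_hom k X A B"
  obtains Q p where "Q \<in> S" "right_exact_seq k X A B Q f p" "p \<in> sheaf_hom k X B Q"
    "sheaf_comp X A p f = zero_hom X A Q"
proof -
  obtain Q p where Q: "Q \<in> S" and ex: "right_exact_seq k X A B Q f p"
    using cokernels[OF assms] by blast
  have "cokernel_of (sheaf_category k X S) A B f Q p"
    by (rule cokernelI[OF S assms(1,2) Q ex])
  then have "sheaf_comp X A p f = zero_hom X A Q"
    by (simp add: cokernel_of_def)
  then show ?thesis
    using that[OF Q ex right_exact_hom(2)[OF ex]] by blast
qed

text \<open>The inclusion of the kernel of \<open>f\<close> is itself one of the maps \<open>g\<close>, so it is zero.\<close>

lemma injective_if_left_cancellable: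
  assumes obj: "A \<in> S" "B \<in> S" and f: "f \<in> sheaf_hom k X A B"
    and canc: "\<And>T g. \<lbrakk>T \<in> S; g \<in> sheaf_hom k X T A; sheaf_comp X T f g = zero_hom X T B\<rbrakk> \<Longrightarrow> g = zero_hom X T A"
    and V: "openin X V"
  shows "inj_on (f V) (\<Gamma> A V)"
proof (rule inj_onI)
  fix s t assume st: "s \<in> \<Gamma> A V" "t \<in> \<Gamma> A V" and eq: "f V s = f V t"
  obtain K i where K: "K \<in> S" "i \<in> sheaf_hom k X K A"
    and im: "\<And>V. openin X V \<Longrightarrow> i V ` \<Gamma> K V = kernel_sections A B f V" and z: "sheaf_comp X K f i = zero_hom X K B"
    using kernel_obtain[OF obj f] by metis
  have i: "i = zero_hom X K A"
    by (rule canc[OF K z])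
  have "f V (s \<ominus>\<^bsub>sec A V\<^esub> t) = \<zero>\<^bsub>sec B V\<^esub>"
    using hom_minus[OF pre[OF obj(1)] pre[OF obj(2)] f V st] eq
      left_module_minus_eq_zero[OF presheaf_sec[OF pre[OF obj(2)] V]] hom_closed[OF f V st(2)] by simp
  then have "s \<ominus>\<^bsub>sec A V\<^esub> t \<in> i V ` \<Gamma> K V"
    using im[OF V] presheaf_minus_closed[OF pre[OF obj(1)] V st] by (simp add: kernel_sections_def)
  then have "s \<ominus>\<^bsub>sec A V\<^esub> t = \<zero>\<^bsub>sec A V\<^esub>"
    using V by (auto simp: i)
  then show "s = t"
    using left_module_minus_eq_zero[OF presheaf_sec[OF pre[OF obj(1)] V] st] by simp
qed

text \<open>The projection onto the cokernel of \<open>f\<close> is one of the maps \<open>g\<close>, so it is zero.\<close>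

lemma surjective_if_right_cancellable:
  assumes obj: "A \<in> S" "B \<in> S" and f: "f \<in> sheaf_hom k X A B"
    and canc: "\<And>T g. \<lbrakk>T \<in> S; g \<in> sheaf_hom k X B T; sheaf_comp X A g f = zero_hom X A T\<rbrakk> \<Longrightarrow> g = zero_hom X B T"
    and V: "openin X V"
  shows "image_sections X A B f V = \<Gamma> B V"
proof -
  obtain Q p where Q: "Q \<in> S" and ex: "right_exact_seq k X A B Q f p" and p: "p \<in> sheaf_hom k X B Q"
    and z: "sheaf_comp X A p f = zero_hom X A Q"
    using cokernel_obtain[OF obj f] by blast
  have "p = zero_hom X B Q"
    by (rule canc[OF Q p z])
  then have "kernel_sections B Q p V = \<Gamma> B V"
    using V by (auto simp: kernel_sections_def)
  then show ?thesis
    using ex V by (simp add: right_exact_seq_def)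
qed

text \<open>A categorical kernel within the class is compared with the sheaf kernel, which belongs to the class
  and hence factors through it. The same holds for cokernels.\<close>

lemma exact_if_kernel:
  assumes obj: "A \<in> S" "B \<in> S" "E \<in> S" and f: "f \<in> sheaf_hom k X A B" and g: "g \<in> sheaf_hom k X B E"
    and ker: "kernel_of (sheaf_category k X S) B E g A f" and V: "openin X V"
  shows "inj_on (f V) (\<Gamma> A V)" "f V ` \<Gamma> A V = kernel_sections B E g V"
proof -
  have z: "sheaf_comp X A g f = zero_hom X A E"
    and univ: "\<And>T h. \<lbrakk>T \<in> S; h \<in> sheaf_hom k X T B; sheaf_comp X T g h = zero_hom X T E\<rbrakk> \<Longrightarrow>
      \<exists>!u. u \<in> sheaf_hom k X T A \<and> sheaf_comp X T f u = h"
    using ker by (auto simp: kernel_of_def)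
  show "inj_on (f V) (\<Gamma> A V)"
  proof (rule injective_if_left_cancellable[OF obj(1,2) f _ V])
    fix T u assume T: "T \<in> S" and u: "u \<in> sheaf_hom k X T A" and fu: "sheaf_comp X T f u = zero_hom X T B"
    have fz: "sheaf_comp X T f (zero_hom X T A) = zero_hom X T B"
      by (rule comp_zero_right[OF pre[OF T] pre[OF obj(1)] pre[OF obj(2)] f])
    have gz: "sheaf_comp X T g (zero_hom X T B) = zero_hom X T E"
      by (rule comp_zero_right[OF pre[OF T] pre[OF obj(2)] pre[OF obj(3)] g])
    show "u = zero_hom X T A"
      using univ[OF T zero_hom_in[OF pre[OF T] pre[OF obj(2)]] gz] u fu fz
        zero_hom_in[OF pre[OF T] pre[OF obj(1)]] by blast
  qed
  show "f V ` \<Gamma> A V = kernel_sections B E g V"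
  proof (intro subset_antisym)
    show "f V ` \<Gamma> A V \<subseteq> kernel_sections B E g V"
      using image_sub_image_sections[OF pre[OF obj(2)] f V]
        image_sections_sub_kernel[OF pre[OF obj(2)] sh[OF obj(3)] g z V] by blast
    obtain K i where K: "K \<in> S" "i \<in> sheaf_hom k X K B"
      and im: "\<And>V. openin X V \<Longrightarrow> i V ` \<Gamma> K V = kernel_sections B E g V" and gi: "sheaf_comp X K g i = zero_hom X K E"
      using kernel_obtain[OF obj(2,3) g] by metis
    obtain u where u: "u \<in> sheaf_hom k X K A" "sheaf_comp X K f u = i"
      using univ[OF K gi] by blast
    show "kernel_sections B E g V \<subseteq> f V ` \<Gamma> A V"
    proof
      fix t assume "t \<in> kernel_sections B E g V"
      then obtain r where r: "r \<in> \<Gamma> K V" "t = i V r"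
        using im[OF V] by blast
      have "t = f V (u V r)"
        using V r by (simp add: u(2)[symmetric])
      then show "t \<in> f V ` \<Gamma> A V"
        using hom_closed[OF u(1) V r(1)] by blast
    qed
  qed
qed

lemma exact_if_cokernel:
  assumes obj: "A \<in> S" "B \<in> S" "E \<in> S" and f: "f \<in> sheaf_hom k X A B" and g: "g \<in> sheaf_hom k X B E"
    and coker: "cokernel_of (sheaf_category k X S) A B f E g"
  shows "right_exact_seq k X A B E f g"
  unfolding right_exact_seq_def
proof (intro conjI f g allI impI)
  fix V assume V: "openin X V"
  have z: "sheaf_comp X A g f = zero_hom X A E"
    and univ: "\<And>T h. \<lbrakk>T \<in> S; h \<in> sheaf_hom k X B T; sheaf_comp X A h f = zero_hom X A T\<rbrakk> \<Longrightarrow>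
      \<exists>!u. u \<in> sheaf_hom k X E T \<and> sheaf_comp X B u g = h"
    using coker by (auto simp: cokernel_of_def)
  show "image_sections X B E g V = \<Gamma> E V"
  proof (rule surjective_if_right_cancellable[OF obj(2,3) g _ V])
    fix T u assume T: "T \<in> S" and u: "u \<in> sheaf_hom k X E T" and ug: "sheaf_comp X B u g = zero_hom X B T"
    have zg: "sheaf_comp X B (zero_hom X E T) g = zero_hom X B T"
      by (rule comp_zero_left[OF pre[OF obj(2)] pre[OF obj(3)] pre[OF T] g])
    have zf: "sheaf_comp X A (zero_hom X B T) f = zero_hom X A T"
      by (rule comp_zero_left[OF pre[OF obj(1)] pre[OF obj(2)] pre[OF T] f])
    show "u = zero_hom X E T"
      using univ[OF T zero_hom_in[OF pre[OF obj(2)] pre[OF T]] zf] u ug zg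
        zero_hom_in[OF pre[OF obj(3)] pre[OF T]] by blast
  qed
  show "image_sections X A B f V = kernel_sections B E g V"
  proof (intro subset_antisym)
    show "image_sections X A B f V \<subseteq> kernel_sections B E g V"
      by (rule image_sections_sub_kernel[OF pre[OF obj(2)] sh[OF obj(3)] g z V])
    obtain Q p where Q: "Q \<in> S" and ex: "right_exact_seq k X A B Q f p" and p: "p \<in> sheaf_hom k X B Q"
      and pz: "sheaf_comp X A p f = zero_hom X A Q"
      using cokernel_obtain[OF obj(1,2) f] by blast
    obtain u where u: "u \<in> sheaf_hom k X E Q" "sheaf_comp X B u g = p"
      using univ[OF Q p pz] by blast
    have "kernel_sections B E g V \<subseteq> kernel_sections B Q p V"
    proof
      fix t assume t: "t \<in> kernel_sections B E g V"
      then have tB: "t \<in> \<Gamma> B V" "g V t = \<zero>\<^bsub>sec E V\<^esub>"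
        by (simp_all add: kernel_sections_def)
      have "p V t = u V (g V t)"
        using V tB(1) by (simp add: u(2)[symmetric])
      then show "t \<in> kernel_sections B Q p V"
        using tB hom_zero[OF pre[OF obj(3)] pre[OF Q] u(1) V] by (simp add: kernel_sections_def)
    qed
    then show "kernel_sections B E g V \<subseteq> image_sections X A B f V"
      using ex V by (simp add: right_exact_seq_def)
  qed
qed

lemma abelian_category: "abelian_category (sheaf_category k X S)"
  unfolding abelian_category_def sheaf_category_simps
proof (intro conjI ballI impI)
  show "preadditive_category (sheaf_category k X S)"
    by (rule preadditive_sheaf_category[OF S])
  show "\<exists>Z. zero_object (sheaf_category k X S) Z"
    using zero zero_objectI[OF S] by blast
  fix A B assume obj: "A \<in> S" "B \<in> S"
  show "\<exists>P p q. product (sheaf_category k X S) A B P p q"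
  proof -
    obtain P p q where P: "P \<in> S" "p \<in> sheaf_hom k X P A" "q \<in> sheaf_hom k X P B"
      and bij: "\<And>V. openin X V \<Longrightarrow> bij_betw (\<lambda>s. (p V s, q V s)) (\<Gamma> P V) (\<Gamma> A V \<times> \<Gamma> B V)"
      using products[OF obj] by blast
    have "product (sheaf_category k X S) A B P p q"
      by (rule productI[OF S obj P bij])
    then show ?thesis
      by blast
  qed
  fix f assume f: "f \<in> sheaf_hom k X A B"
  obtain K i where K: "K \<in> S" "i \<in> sheaf_hom k X K A"
    and inj: "\<And>V. openin X V \<Longrightarrow> inj_on (i V) (\<Gamma> K V)"
    and im: "\<And>V. openin X V \<Longrightarrow> i V ` \<Gamma> K V = kernel_sections A B f V" and fi: "sheaf_comp X K f i = zero_hom X K B"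
    using kernel_obtain[OF obj f] by metis
  obtain Q p where Q: "Q \<in> S" and ex: "right_exact_seq k X A B Q f p" and p: "p \<in> sheaf_hom k X B Q"
    and pf: "sheaf_comp X A p f = zero_hom X A Q"
    using cokernel_obtain[OF obj f] by blast
  have "kernel_of (sheaf_category k X S) A B f K i"
    by (rule kernelI[OF S obj K(1) f K(2) inj im])
  then show "\<exists>K i. kernel_of (sheaf_category k X S) A B f K i"
    by blast
  have "cokernel_of (sheaf_category k X S) A B f Q p"
    by (rule cokernelI[OF S obj Q ex])
  then show "\<exists>Q p. cokernel_of (sheaf_category k X S) A B f Q p"
    by blast
  \<comment> \<open>A monomorphism has zero kernel, so it is injective on sections and is the kernel of its cokernel.\<close>
  show "\<exists>D\<in>S. \<exists>g\<in>sheaf_hom k X B D. kernel_of (sheaf_category k X S) B D g A f"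
    if monic: "monic (sheaf_category k X S) A B f"
  proof -
    have injf: "inj_on (f V) (\<Gamma> A V)" if V: "openin X V" for V
    proof (rule injective_if_left_cancellable[OF obj f _ V])
      fix T g assume T: "T \<in> S" and g: "g \<in> sheaf_hom k X T A" and z: "sheaf_comp X T f g = zero_hom X T B"
      have "sheaf_comp X T f g = sheaf_comp X T f (zero_hom X T A)"
        using z comp_zero_right[OF pre[OF T] pre[OF obj(1)] pre[OF obj(2)] f] by simp
      then show "g = zero_hom X T A"
        using monic T g zero_hom_in[OF pre[OF T] pre[OF obj(1)]] by (auto simp: monic_def)
    qed
    have "f V ` \<Gamma> A V = kernel_sections B Q p V" if V: "openin X V" for V
      using image_sections_injective[OF sh[OF obj(1)] sh[OF obj(2)] f injf V] ex V by (simp add: right_exact_seq_def)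
    then have "kernel_of (sheaf_category k X S) B Q p A f"
      by (intro kernelI[OF S obj(2) Q obj(1) p f injf])
    then show ?thesis
      using Q p by blast
  qed
  \<comment> \<open>An epimorphism has zero cokernel, so it is surjective as a map of sheaves and is the cokernel of
    its kernel.\<close>
  show "\<exists>D\<in>S. \<exists>g\<in>sheaf_hom k X D A. cokernel_of (sheaf_category k X S) D A g B f"
    if epic: "epic (sheaf_category k X S) A B f"
  proof -
    have surj: "image_sections X A B f V = \<Gamma> B V" if V: "openin X V" for V
    proof (rule surjective_if_right_cancellable[OF obj f _ V])
      fix T g assume T: "T \<in> S" and g: "g \<in> sheaf_hom k X B T" and z: "sheaf_comp X A g f = zero_hom X A T"
      have "sheaf_comp X A g f = sheaf_comp X A (zero_hom X B T) f"
        using z comp_zero_left[OF pre[OF obj(1)] pre[OF obj(2)] pre[OF T] f] by simp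
      then show "g = zero_hom X B T"
        using epic T g zero_hom_in[OF pre[OF obj(2)] pre[OF T]] by (auto simp: epic_def)
    qed
    have "image_sections X K A i V = kernel_sections A B f V" if V: "openin X V" for V
      using image_sub_image_sections[OF pre[OF obj(1)] K(2) V] im[OF V]
        image_sections_sub_kernel[OF pre[OF obj(1)] sh[OF obj(2)] f fi V] by blast
    then have "right_exact_seq k X K A B i f"
      unfolding right_exact_seq_def using K(2) f surj by blast
    then have "cokernel_of (sheaf_category k X S) K A i B f"
      by (rule cokernelI[OF S K(1) obj])
    then show ?thesis
      using K by blast
  qed
qed

lemma abelian_subcategory: "abelian_subcategory (sheaf_category k X S) (Shv k X)"
  unfolding abelian_subcategory_def
proof (intro conjI ballI impI)
  show "\<exists>S'\<subseteq>Obj (Shv k X). sheaf_category k X S = sheaf_category k X S'"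
    using S by (intro exI[of _ S]) (simp add: Shv_def)
  show "abelian_category (sheaf_category k X S)"
    by (rule abelian_category)
  fix A B E f g
  assume "A \<in> Obj (sheaf_category k X S)" "B \<in> Obj (sheaf_category k X S)" "E \<in> Obj (sheaf_category k X S)"
    "f \<in> Hom (sheaf_category k X S) A B" "g \<in> Hom (sheaf_category k X S) B E"
    and ex: "short_exact (sheaf_category k X S) A B E f g"
  then have obj: "A \<in> S" "B \<in> S" "E \<in> S" and f: "f \<in> sheaf_hom k X A B" and g: "g \<in> sheaf_hom k X B E"
    by simp_all
  have ker: "kernel_of (sheaf_category k X S) B E g A f" and coker: "cokernel_of (sheaf_category k X S) A B f E g"
    using ex by (simp_all add: short_exact_def)
  have obj': "A \<in> {F. sheaf k X F}" "B \<in> {F. sheaf k X F}" "E \<in> {F. sheaf k X F}"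
    using obj sh by simp_all
  show "short_exact (Shv k X) A B E f g"
    unfolding short_exact_def
  proof
    show "kernel_of (Shv k X) B E g A f"
      by (subst Shv_eq_sheaf_category)
        (rule kernelI[OF subset_refl obj'(2,3,1) g f exact_if_kernel[OF obj f g ker]])
    show "cokernel_of (Shv k X) A B f E g"
      by (subst Shv_eq_sheaf_category)
        (rule cokernelI[OF subset_refl obj' exact_if_cokernel[OF obj f g coker]])
  qed
qed

end

section \<open>Zero sheaf, kernels and products\<close>

lemma sheaf_separate_cover:
  assumes F: "sheaf k X F" and op: "\<And>U. U \<in> \<U> \<Longrightarrow> openin X U"
    and st: "s \<in> \<Gamma> F (\<Union>\<U>)" "t \<in> \<Gamma> F (\<Union>\<U>)" and eq: "\<And>U. U \<in> \<U> \<Longrightarrow> res F (\<Union>\<U>) U s = res F (\<Union>\<U>) U t"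
  shows "s = t"
proof (rule sheaf_separate[OF F _ st])
  show "openin X (\<Union>\<U>)"
    using op by blast
  fix x assume "x \<in> \<Union>\<U>"
  then obtain U where "U \<in> \<U>" "x \<in> U"
    by blast
  then show "\<exists>W. openin X W \<and> x \<in> W \<and> W \<subseteq> \<Union>\<U> \<and> res F (\<Union>\<U>) W s = res F (\<Union>\<U>) W t"
    using op eq by (intro exI[of _ U]) auto
qed

definition zero_sheaf :: "'a \<Rightarrow> ('x, 'k, 'a) presheaf" where
  "zero_sheaf c =
     \<lparr>sec = (\<lambda>V. \<lparr>carrier = {c}, mult = undefined, one = undefined, zero = c,
        add = (\<lambda>_ _. c), smult = (\<lambda>_ _. c)\<rparr>),
      res = (\<lambda>_ _ _. c)\<rparr>"

lemma zero_sheaf_simps [simp]: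
  "\<Gamma> (zero_sheaf c) V = {c}" "\<zero>\<^bsub>sec (zero_sheaf c) V\<^esub> = c"
  "s \<oplus>\<^bsub>sec (zero_sheaf c) V\<^esub> t = c" "a \<odot>\<^bsub>sec (zero_sheaf c) V\<^esub> s = c" "res (zero_sheaf c) V W s = c"
  by (simp_all add: zero_sheaf_def)

lemma zero_sheaf_sheaf:
  assumes k: "ring k"
  shows "sheaf k X (zero_sheaf c)"
proof (rule sheafI)
  show "presheaf k X (zero_sheaf c)"
    by (rule presheafI, rule left_moduleI[OF k]) (simp_all add: linear_map_def)
qed simp_all

lemma zero_sheaf_rigid: "\<lbrakk>openin X U; connectedin X U\<rbrakk> \<Longrightarrow> rigid_on X (zero_sheaf c) U"
  by (simp add: rigid_on_def bij_betw_def)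

definition kernel_sheaf ::
  "('x, 'k, 'a) presheaf \<Rightarrow> ('x, 'k, 'b) presheaf \<Rightarrow> ('x set \<Rightarrow> 'a \<Rightarrow> 'b) \<Rightarrow> ('x, 'k, 'a) presheaf" where
  "kernel_sheaf A B f = \<lparr>sec = (\<lambda>V. (sec A V)\<lparr>carrier := kernel_sections A B f V\<rparr>), res = res A\<rparr>"

lemma kernel_sheaf_simps [simp]:
  "\<Gamma> (kernel_sheaf A B f) V = kernel_sections A B f V" "\<zero>\<^bsub>sec (kernel_sheaf A B f) V\<^esub> = \<zero>\<^bsub>sec A V\<^esub>"
  "s \<oplus>\<^bsub>sec (kernel_sheaf A B f) V\<^esub> t = s \<oplus>\<^bsub>sec A V\<^esub> t"
  "a \<odot>\<^bsub>sec (kernel_sheaf A B f) V\<^esub> s = a \<odot>\<^bsub>sec A V\<^esub> s"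
  "res (kernel_sheaf A B f) = res A"
  by (simp_all add: kernel_sheaf_def)

lemma kernel_sectionsD:
  assumes "s \<in> kernel_sections A B f V"
  shows "s \<in> \<Gamma> A V" "f V s = \<zero>\<^bsub>sec B V\<^esub>"
  using assms by (simp_all add: kernel_sections_def)

lemma kernel_sections_res:
  assumes A: "presheaf k X A" and B: "presheaf k X B" and f: "f \<in> sheaf_hom k X A B"
    and V: "openin X V" "openin X W" "W \<subseteq> V" and s: "s \<in> kernel_sections A B f V"
  shows "res A V W s \<in> kernel_sections A B f W"
  using presheaf_res_closed[OF A V kernel_sectionsD(1)[OF s]] hom_res[OF f V kernel_sectionsD(1)[OF s]]
    kernel_sectionsD(2)[OF s] res_zero[OF B V] by (simp add: kernel_sections_def)

lemma kernel_sheaf_sheaf: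
  assumes A: "sheaf k X A" and B: "sheaf k X B" and f: "f \<in> sheaf_hom k X A B"
  shows "sheaf k X (kernel_sheaf A B f)"
proof (rule sheafI)
  note PA = sheaf_presheaf[OF A] and PB = sheaf_presheaf[OF B]
  show "presheaf k X (kernel_sheaf A B f)"
  proof (rule presheafI)
    fix V assume V: "openin X V"
    interpret B: left_module k "sec B V" by (rule presheaf_sec[OF PB V])
    have "left_module k ((sec A V)\<lparr>carrier := kernel_sections A B f V\<rparr>)"
    proof (rule left_module_submodule[OF presheaf_sec[OF PA V]])
      show "kernel_sections A B f V \<subseteq> \<Gamma> A V"
        by (auto simp: kernel_sections_def)
    qed (simp_all add: kernel_sections_def presheaf_zero_closed[OF PA V] hom_zero[OF PA PB f V]
        presheaf_add_closed[OF PA V] hom_add[OF f V] presheaf_smult_closed[OF PA V] hom_smult[OF f V] B.smult_zero)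
    then show "left_module k (sec (kernel_sheaf A B f) V)"
      by (simp add: kernel_sheaf_def)
    show "res (kernel_sheaf A B f) V V s = s" if "s \<in> \<Gamma> (kernel_sheaf A B f) V" for s
      using that presheaf_res_self[OF PA V] by (simp add: kernel_sections_def)
    fix W assume W: "openin X W" "W \<subseteq> V"
    show "linear_map k (sec (kernel_sheaf A B f) V) (sec (kernel_sheaf A B f) W) (res (kernel_sheaf A B f) V W)"
      unfolding linear_map_def kernel_sheaf_simps
      by (intro conjI ballI Pi_I kernel_sections_res[OF PA PB f V W] linear_map_add[OF presheaf_res_linear[OF PA V W]]
          linear_map_smult[OF presheaf_res_linear[OF PA V W]] kernel_sectionsD(1))
    show "res (kernel_sheaf A B f) W W' (res (kernel_sheaf A B f) V W s) = res (kernel_sheaf A B f) V W' s"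
      if "openin X W'" "W' \<subseteq> W" "s \<in> \<Gamma> (kernel_sheaf A B f) V" for W' s
      using that W by (simp add: presheaf_res_res[OF PA V] kernel_sectionsD(1)[of _ A B f])
  qed
  fix \<U> assume op: "\<And>U. U \<in> \<U> \<Longrightarrow> openin X U"
  have V: "openin X (\<Union>\<U>)"
    using op by blast
  show "s = t" if "s \<in> \<Gamma> (kernel_sheaf A B f) (\<Union>\<U>)" "t \<in> \<Gamma> (kernel_sheaf A B f) (\<Union>\<U>)"
    "\<And>U. U \<in> \<U> \<Longrightarrow> res (kernel_sheaf A B f) (\<Union>\<U>) U s = res (kernel_sheaf A B f) (\<Union>\<U>) U t" for s t
    using sheaf_separate_cover[OF A op, of \<U> s t] that kernel_sectionsD(1)[of s A B f] kernel_sectionsD(1)[of t A B f]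
    by simp
  show "\<exists>s\<in>\<Gamma> (kernel_sheaf A B f) (\<Union>\<U>). \<forall>U\<in>\<U>. res (kernel_sheaf A B f) (\<Union>\<U>) U s = \<sigma> U"
    if \<sigma>: "\<And>U. U \<in> \<U> \<Longrightarrow> \<sigma> U \<in> \<Gamma> (kernel_sheaf A B f) U"
      and compat: "\<And>U V. \<lbrakk>U \<in> \<U>; V \<in> \<U>\<rbrakk> \<Longrightarrow>
        res (kernel_sheaf A B f) U (U \<inter> V) (\<sigma> U) = res (kernel_sheaf A B f) V (U \<inter> V) (\<sigma> V)" for \<sigma>
  proof -
    obtain s where s: "s \<in> \<Gamma> A (\<Union>\<U>)" "\<And>U. U \<in> \<U> \<Longrightarrow> res A (\<Union>\<U>) U s = \<sigma> U"
      by (rule sheaf_glue[OF A op, of \<U> \<sigma>]) (use \<sigma> compat in \<open>simp_all add: kernel_sections_def\<close>)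
    have "f (\<Union>\<U>) s = \<zero>\<^bsub>sec B (\<Union>\<U>)\<^esub>"
    proof (rule sheaf_separate_cover[OF B op hom_closed[OF f V s(1)] presheaf_zero_closed[OF PB V]])
      fix U assume U: "U \<in> \<U>"
      then have sub: "U \<subseteq> \<Union>\<U>"
        by blast
      show "res B (\<Union>\<U>) U (f (\<Union>\<U>) s) = res B (\<Union>\<U>) U \<zero>\<^bsub>sec B (\<Union>\<U>)\<^esub>"
        using hom_res[OF f V op[OF U] sub s(1)] s(2)[OF U] \<sigma>[OF U] res_zero[OF PB V op[OF U] sub]
        by (simp add: kernel_sections_def)
    qed
    then show ?thesis
      using s by (intro bexI[of _ s]) (simp_all add: kernel_sections_def)
  qed
qed

lemma kernel_sheaf_rigid:
  assumes A: "presheaf k X A" and B: "presheaf k X B" and f: "f \<in> sheaf_hom k X A B"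
    and AU: "rigid_on X A U" and BU: "rigid_on X B U"
  shows "rigid_on X (kernel_sheaf A B f) U"
  unfolding rigid_on_def
proof (intro conjI allI impI; (elim conjE)?)
  show U: "openin X U" "connectedin X U"
    using AU by (simp_all add: rigid_on_def)
  fix W assume W: "openin X W" "connectedin X W" "W \<noteq> {}" "W \<subseteq> U"
  show "bij_betw (res (kernel_sheaf A B f) U W) (\<Gamma> (kernel_sheaf A B f) U) (\<Gamma> (kernel_sheaf A B f) W)"
    unfolding bij_betw_def kernel_sheaf_simps
  proof (intro conjI inj_onI subset_antisym image_subsetI subsetI)
    fix s t assume s: "s \<in> kernel_sections A B f U" and t: "t \<in> kernel_sections A B f U"
      and eq: "res A U W s = res A U W t"
    show "s = t"
      by (rule rigid_on_eqI[OF AU W kernel_sectionsD(1)[OF s] kernel_sectionsD(1)[OF t] eq])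
  next
    fix s assume "s \<in> kernel_sections A B f U"
    then show "res A U W s \<in> kernel_sections A B f W"
      by (rule kernel_sections_res[OF A B f U(1) W(1,4)])
  next
    fix t assume t: "t \<in> kernel_sections A B f W"
    obtain s where s: "s \<in> \<Gamma> A U" "res A U W s = t"
      using rigid_on_extend[OF AU W kernel_sectionsD(1)[OF t]] .
    have "res B U W (f U s) = res B U W \<zero>\<^bsub>sec B U\<^esub>"
      using hom_res[OF f U(1) W(1,4) s(1)] s(2) kernel_sectionsD(2)[OF t] res_zero[OF B U(1) W(1,4)] by simp
    then have "f U s = \<zero>\<^bsub>sec B U\<^esub>"
      by (rule rigid_on_eqI[OF BU W hom_closed[OF f U(1) s(1)] presheaf_zero_closed[OF B U(1)]])
    then show "t \<in> res A U W ` kernel_sections A B f U"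
      using s by (intro image_eqI[of _ _ s]) (simp_all add: kernel_sections_def)
  qed
qed

definition pair_sheaf :: "('x, 'k, 'a) presheaf \<Rightarrow> ('x, 'k, 'b) presheaf \<Rightarrow> ('x, 'k, 'a \<times> 'b) presheaf" where
  "pair_sheaf A B =
     \<lparr>sec = (\<lambda>V. \<lparr>carrier = \<Gamma> A V \<times> \<Gamma> B V, mult = undefined, one = undefined,
        zero = (\<zero>\<^bsub>sec A V\<^esub>, \<zero>\<^bsub>sec B V\<^esub>),
        add = (\<lambda>s t. (fst s \<oplus>\<^bsub>sec A V\<^esub> fst t, snd s \<oplus>\<^bsub>sec B V\<^esub> snd t)),
        smult = (\<lambda>c s. (c \<odot>\<^bsub>sec A V\<^esub> fst s, c \<odot>\<^bsub>sec B V\<^esub> snd s))\<rparr>),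
      res = (\<lambda>V W s. (res A V W (fst s), res B V W (snd s)))\<rparr>"

lemma pair_sheaf_simps [simp]:
  "\<Gamma> (pair_sheaf A B) V = \<Gamma> A V \<times> \<Gamma> B V"
  "\<zero>\<^bsub>sec (pair_sheaf A B) V\<^esub> = (\<zero>\<^bsub>sec A V\<^esub>, \<zero>\<^bsub>sec B V\<^esub>)"
  "s \<oplus>\<^bsub>sec (pair_sheaf A B) V\<^esub> t = (fst s \<oplus>\<^bsub>sec A V\<^esub> fst t, snd s \<oplus>\<^bsub>sec B V\<^esub> snd t)"
  "c \<odot>\<^bsub>sec (pair_sheaf A B) V\<^esub> s = (c \<odot>\<^bsub>sec A V\<^esub> fst s, c \<odot>\<^bsub>sec B V\<^esub> snd s)"
  "res (pair_sheaf A B) V W s = (res A V W (fst s), res B V W (snd s))"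
  by (simp_all add: pair_sheaf_def)

lemma pair_sheaf_sheaf:
  assumes A: "sheaf k X A" and B: "sheaf k X B"
  shows "sheaf k X (pair_sheaf A B)"
proof (rule sheafI)
  note PA = sheaf_presheaf[OF A] and PB = sheaf_presheaf[OF B]
  show "presheaf k X (pair_sheaf A B)"
  proof (rule presheafI)
    fix V assume V: "openin X V"
    interpret A: left_module k "sec A V" by (rule presheaf_sec[OF PA V])
    interpret B: left_module k "sec B V" by (rule presheaf_sec[OF PB V])
    show "left_module k (sec (pair_sheaf A B) V)"
      by (rule left_moduleI[OF A.R.ring_axioms])
        (auto simp: A.smult_closed B.smult_closed A.M.a_ac B.M.a_ac A.zero_smult
          B.zero_smult A.smult_l_distr B.smult_l_distr A.smult_r_distr B.smult_r_distr A.smult_assoc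
          B.smult_assoc A.smult_one B.smult_one)
    show "res (pair_sheaf A B) V V s = s" if "s \<in> \<Gamma> (pair_sheaf A B) V" for s
      using that presheaf_res_self[OF PA V] presheaf_res_self[OF PB V] by auto
    fix W assume W: "openin X W" "W \<subseteq> V"
    note lA = presheaf_res_linear[OF PA V W] and lB = presheaf_res_linear[OF PB V W]
    show "linear_map k (sec (pair_sheaf A B) V) (sec (pair_sheaf A B) W) (res (pair_sheaf A B) V W)"
      unfolding linear_map_def
      by (auto simp: linear_map_closed[OF lA] linear_map_closed[OF lB] linear_map_add[OF lA] linear_map_add[OF lB]
          linear_map_smult[OF lA] linear_map_smult[OF lB])
    show "res (pair_sheaf A B) W W' (res (pair_sheaf A B) V W s) = res (pair_sheaf A B) V W' s"
      if "openin X W'" "W' \<subseteq> W" "s \<in> \<Gamma> (pair_sheaf A B) V" for W' s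
      using that W presheaf_res_res[OF PA V] presheaf_res_res[OF PB V] by auto
  qed
  fix \<U> assume op: "\<And>U. U \<in> \<U> \<Longrightarrow> openin X U"
  show "s = t" if s: "s \<in> \<Gamma> (pair_sheaf A B) (\<Union>\<U>)" and t: "t \<in> \<Gamma> (pair_sheaf A B) (\<Union>\<U>)"
    and eq: "\<And>U. U \<in> \<U> \<Longrightarrow> res (pair_sheaf A B) (\<Union>\<U>) U s = res (pair_sheaf A B) (\<Union>\<U>) U t" for s t
  proof (rule prod_eqI)
    show "fst s = fst t"
      by (rule sheaf_separate_cover[OF A op]) (use s t eq in auto)
    show "snd s = snd t"
      by (rule sheaf_separate_cover[OF B op]) (use s t eq in auto)
  qed
  show "\<exists>s\<in>\<Gamma> (pair_sheaf A B) (\<Union>\<U>). \<forall>U\<in>\<U>. res (pair_sheaf A B) (\<Union>\<U>) U s = \<sigma> U"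
    if \<sigma>: "\<And>U. U \<in> \<U> \<Longrightarrow> \<sigma> U \<in> \<Gamma> (pair_sheaf A B) U"
      and compat: "\<And>U V. \<lbrakk>U \<in> \<U>; V \<in> \<U>\<rbrakk> \<Longrightarrow>
        res (pair_sheaf A B) U (U \<inter> V) (\<sigma> U) = res (pair_sheaf A B) V (U \<inter> V) (\<sigma> V)" for \<sigma>
  proof -
    have \<sigma>': "fst (\<sigma> U) \<in> \<Gamma> A U" "snd (\<sigma> U) \<in> \<Gamma> B U" if "U \<in> \<U>" for U
      using \<sigma>[OF that] by auto
    have cA: "res A U (U \<inter> V) (fst (\<sigma> U)) = res A V (U \<inter> V) (fst (\<sigma> V))"
      and cB: "res B U (U \<inter> V) (snd (\<sigma> U)) = res B V (U \<inter> V) (snd (\<sigma> V))" if "U \<in> \<U>" "V \<in> \<U>" for U V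
      using compat[OF that] by simp_all
    obtain s where s: "s \<in> \<Gamma> A (\<Union>\<U>)" "\<And>U. U \<in> \<U> \<Longrightarrow> res A (\<Union>\<U>) U s = fst (\<sigma> U)"
      by (rule sheaf_glue[OF A op, of \<U> "\<lambda>U. fst (\<sigma> U)"]) (use \<sigma>' cA in blast)+
    obtain t where t: "t \<in> \<Gamma> B (\<Union>\<U>)" "\<And>U. U \<in> \<U> \<Longrightarrow> res B (\<Union>\<U>) U t = snd (\<sigma> U)"
      by (rule sheaf_glue[OF B op, of \<U> "\<lambda>U. snd (\<sigma> U)"]) (use \<sigma>' cB in blast)+
    show ?thesis
      using s t by (intro bexI[of _ "(s, t)"]) simp_all
  qed
qed

lemma pair_sheaf_rigid:
  assumes A: "rigid_on X A U" and B: "rigid_on X B U"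
  shows "rigid_on X (pair_sheaf A B) U"
  unfolding rigid_on_def
proof (intro conjI allI impI; (elim conjE)?)
  show U: "openin X U" "connectedin X U"
    using A by (simp_all add: rigid_on_def)
  fix W assume W: "openin X W" "connectedin X W" "W \<noteq> {}" "W \<subseteq> U"
  have "res (pair_sheaf A B) U W = map_prod (res A U W) (res B U W)"
    by (auto simp: fun_eq_iff)
  then show "bij_betw (res (pair_sheaf A B) U W) (\<Gamma> (pair_sheaf A B) U) (\<Gamma> (pair_sheaf A B) W)"
    using bij_betw_map_prod[OF rigid_on_bij[OF A W] rigid_on_bij[OF B W]] by simp
qed

text \<open>An injection \<open>e\<close> of the type of sections into another type carries a sheaf over. In this way the
  products and quotients constructed here become objects of the category of sheaves with values in a
  given universe.\<close>

definition push_sheaf :: "('a \<Rightarrow> 'b) \<Rightarrow> ('x, 'k, 'a) presheaf \<Rightarrow> ('x, 'k, 'b) presheaf" where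
  "push_sheaf e F =
     \<lparr>sec = (\<lambda>V. \<lparr>carrier = e ` \<Gamma> F V, mult = undefined, one = undefined, zero = e \<zero>\<^bsub>sec F V\<^esub>,
        add = (\<lambda>s t. e (inv_into UNIV e s \<oplus>\<^bsub>sec F V\<^esub> inv_into UNIV e t)),
        smult = (\<lambda>c s. e (c \<odot>\<^bsub>sec F V\<^esub> inv_into UNIV e s))\<rparr>),
      res = (\<lambda>V W s. e (res F V W (inv_into UNIV e s)))\<rparr>"

lemma push_sheaf_bijective:
  assumes F: "presheaf k X F" and e: "inj e"
  shows "bijective_hom k X F (push_sheaf e F) (family_hom X F (\<lambda>_. e))"
proof -
  have "family_hom X F (\<lambda>_. e) \<in> sheaf_hom k X F (push_sheaf e F)"
    by (rule family_hom_in[OF _ _ _ _ F]) (simp_all add: push_sheaf_def inv_f_f[OF e])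
  moreover have "bij_betw (family_hom X F (\<lambda>_. e) V) (\<Gamma> F V) (\<Gamma> (push_sheaf e F) V)" if V: "openin X V" for V
  proof -
    have "bij_betw e (\<Gamma> F V) (\<Gamma> (push_sheaf e F) V)"
      using inj_on_subset[OF e subset_UNIV] by (simp add: bij_betw_def push_sheaf_def)
    then show ?thesis
      using V by (subst bij_betw_cong[of _ _ e]) simp_all
  qed
  ultimately show ?thesis
    by (simp add: bijective_hom_def)
qed

lemma push_sheaf_sheaf:
  assumes F: "sheaf k X F" and e: "inj e"
  shows "sheaf k X (push_sheaf e F)"
proof (rule sheaf_transport[OF F push_sheaf_bijective[OF sheaf_presheaf[OF F] e]])
  fix V assume "openin X V"
  then show "\<zero>\<^bsub>sec (push_sheaf e F) V\<^esub> = family_hom X F (\<lambda>_. e) V \<zero>\<^bsub>sec F V\<^esub>"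
    using presheaf_zero_closed[OF sheaf_presheaf[OF F]] by (simp add: push_sheaf_def)
qed

lemma push_pair_sheaf_product:
  assumes A: "sheaf k X A" and B: "sheaf k X B" and e: "inj e"
  shows "\<exists>p\<in>sheaf_hom k X (push_sheaf e (pair_sheaf A B)) A. \<exists>q\<in>sheaf_hom k X (push_sheaf e (pair_sheaf A B)) B.
    \<forall>V. openin X V \<longrightarrow> bij_betw (\<lambda>s. (p V s, q V s)) (\<Gamma> (push_sheaf e (pair_sheaf A B)) V) (\<Gamma> A V \<times> \<Gamma> B V)"
proof -
  let ?P = "pair_sheaf A B"
  let ?E = "push_sheaf e ?P"
  have P: "presheaf k X ?P"
    by (rule sheaf_presheaf[OF pair_sheaf_sheaf[OF A B]])
  have E: "presheaf k X ?E"
    by (rule sheaf_presheaf[OF push_sheaf_sheaf[OF pair_sheaf_sheaf[OF A B] e]])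
  define d where "d = inv_hom X ?P ?E (family_hom X ?P (\<lambda>_. e))"
  have d: "bijective_hom k X ?E ?P d"
    unfolding d_def by (rule bijective_inv_hom[OF P push_sheaf_bijective[OF P e]])
  then have hom: "d \<in> sheaf_hom k X ?E ?P" and bij: "\<And>V. openin X V \<Longrightarrow> bij_betw (d V) (\<Gamma> ?E V) (\<Gamma> ?P V)"
    by (auto simp: bijective_hom_def)
  have p: "family_hom X ?P (\<lambda>_. fst) \<in> sheaf_hom k X ?P A" and q: "family_hom X ?P (\<lambda>_. snd) \<in> sheaf_hom k X ?P B"
    by (rule family_hom_in[OF _ _ _ _ P]; auto)+
  let ?p = "sheaf_comp X ?E (family_hom X ?P (\<lambda>_. fst)) d" and ?q = "sheaf_comp X ?E (family_hom X ?P (\<lambda>_. snd)) d"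
  have "bij_betw (\<lambda>s. (?p V s, ?q V s)) (\<Gamma> ?E V) (\<Gamma> A V \<times> \<Gamma> B V)" if V: "openin X V" for V
  proof -
    have "(?p V s, ?q V s) = d V s" if "s \<in> \<Gamma> ?E V" for s
      using V that hom_closed[OF hom V that] by simp
    then show ?thesis
      using bij[OF V] by (subst bij_betw_cong[of _ _ "d V"]) simp_all
  qed
  then show ?thesis
    using sheaf_comp_hom[OF E hom p] sheaf_comp_hom[OF E hom q] by blast
qed

section \<open>Quotient modules by representatives\<close>

definition left_submodule :: "('k, 'r) ring_scheme \<Rightarrow> ('k, 'm) module \<Rightarrow> 'm set \<Rightarrow> bool" where
  "left_submodule k M N \<longleftrightarrow> N \<subseteq> carrier M \<and> \<zero>\<^bsub>M\<^esub> \<in> N \<and>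
     (\<forall>x\<in>N. \<forall>y\<in>N. x \<oplus>\<^bsub>M\<^esub> y \<in> N) \<and> (\<forall>c\<in>carrier k. \<forall>x\<in>N. c \<odot>\<^bsub>M\<^esub> x \<in> N)"

lemma left_submoduleD:
  assumes "left_submodule k M N"
  shows "N \<subseteq> carrier M" "\<zero>\<^bsub>M\<^esub> \<in> N"
    and "\<lbrakk>x \<in> N; y \<in> N\<rbrakk> \<Longrightarrow> x \<oplus>\<^bsub>M\<^esub> y \<in> N"
    and "\<lbrakk>c \<in> carrier k; x \<in> N\<rbrakk> \<Longrightarrow> c \<odot>\<^bsub>M\<^esub> x \<in> N"
  using assms by (simp_all add: left_submodule_def)

lemma left_submodule_image:
  assumes L: "left_module k L" and M: "left_module k M" and f: "linear_map k L M f"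
  shows "left_submodule k M (f ` carrier L)"
  unfolding left_submodule_def
proof (intro conjI ballI)
  interpret L: left_module k L by fact
  show "\<zero>\<^bsub>M\<^esub> \<in> f ` carrier L"
    using linear_map_zero[OF L M f, symmetric] by simp
  fix x assume "x \<in> f ` carrier L"
  then obtain a where a: "a \<in> carrier L" "x = f a"
    by (rule imageE)
  show "x \<oplus>\<^bsub>M\<^esub> y \<in> f ` carrier L" if "y \<in> f ` carrier L" for y
  proof -
    from that obtain b where b: "b \<in> carrier L" "y = f b"
      by (rule imageE)
    have "x \<oplus>\<^bsub>M\<^esub> y = f (a \<oplus>\<^bsub>L\<^esub> b)"
      by (simp only: a(2) b(2) linear_map_add[OF f a(1) b(1)])
    then show ?thesis
      using imageI[OF L.M.a_closed[OF a(1) b(1)], of f] by simp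
  qed
  show "c \<odot>\<^bsub>M\<^esub> x \<in> f ` carrier L" if "c \<in> carrier k" for c
    using imageI[OF L.smult_closed[OF that a(1)], of f] by (simp only: a(2) linear_map_smult[OF f that a(1)])
qed (use linear_map_closed[OF f] in blast)

definition coset_rep :: "('k, 'm) module \<Rightarrow> 'm set \<Rightarrow> 'm \<Rightarrow> 'm" where
  "coset_rep M N x = (SOME y. y \<in> carrier M \<and> x \<ominus>\<^bsub>M\<^esub> y \<in> N)"

text \<open>The quotient \<open>M/N\<close>, with one chosen representative for each coset. Unlike the cosets, the
  representatives are again elements of the type of \<open>M\<close>.\<close>

definition quotient_module :: "('k, 'm) module \<Rightarrow> 'm set \<Rightarrow> ('k, 'm) module" where
  "quotient_module M N =
     \<lparr>carrier = coset_rep M N ` carrier M, mult = undefined, one = undefined, zero = coset_rep M N \<zero>\<^bsub>M\<^esub>,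
      add = (\<lambda>x y. coset_rep M N (x \<oplus>\<^bsub>M\<^esub> y)), smult = (\<lambda>c x. coset_rep M N (c \<odot>\<^bsub>M\<^esub> x))\<rparr>"

context
  fixes k :: "('k, 'r) ring_scheme" and M :: "('k, 'm) module" and N :: "'m set"
  assumes M: "left_module k M" and submod: "left_submodule k M N"
begin

interpretation left_module k M
  by (rule M)

lemmas submodule_sub = left_submoduleD(1,2)[OF submod]
  and submodule_add = left_submoduleD(3)[OF submod]
  and submodule_smult = left_submoduleD(4)[OF submod]

lemma submodule_neg:
  assumes x: "x \<in> N"
  shows "\<ominus>\<^bsub>M\<^esub> x \<in> N"
proof -
  have "(\<ominus>\<^bsub>k\<^esub> \<one>\<^bsub>k\<^esub>) \<odot>\<^bsub>M\<^esub> x \<in> N"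
    by (rule submodule_smult[OF _ x]) simp
  moreover have "x \<in> carrier M"
    using submodule_sub x by blast
  ultimately show ?thesis
    by (simp add: neg_eq_smult)
qed

lemma coset_rep:
  assumes x: "x \<in> carrier M"
  shows coset_rep_closed: "coset_rep M N x \<in> carrier M" and coset_rep_diff: "x \<ominus>\<^bsub>M\<^esub> coset_rep M N x \<in> N"
proof -
  have "x \<in> carrier M \<and> x \<ominus>\<^bsub>M\<^esub> x \<in> N"
    using x submodule_sub by (simp add: a_minus_def M.r_neg)
  then have "coset_rep M N x \<in> carrier M \<and> x \<ominus>\<^bsub>M\<^esub> coset_rep M N x \<in> N"
    unfolding coset_rep_def by (rule someI)
  then show "coset_rep M N x \<in> carrier M" "x \<ominus>\<^bsub>M\<^esub> coset_rep M N x \<in> N"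
    by simp_all
qed

lemma coset_rep_eq_iff:
  assumes x: "x \<in> carrier M" and y: "y \<in> carrier M"
  shows "coset_rep M N x = coset_rep M N y \<longleftrightarrow> x \<ominus>\<^bsub>M\<^esub> y \<in> N"
proof
  have split: "a \<ominus>\<^bsub>M\<^esub> c = (a \<ominus>\<^bsub>M\<^esub> b) \<oplus>\<^bsub>M\<^esub> (b \<ominus>\<^bsub>M\<^esub> c)"
    if "a \<in> carrier M" "b \<in> carrier M" "c \<in> carrier M" for a b c
  proof -
    have "(a \<ominus>\<^bsub>M\<^esub> b) \<oplus>\<^bsub>M\<^esub> (b \<ominus>\<^bsub>M\<^esub> c) = a \<oplus>\<^bsub>M\<^esub> ((\<ominus>\<^bsub>M\<^esub> b \<oplus>\<^bsub>M\<^esub> b) \<oplus>\<^bsub>M\<^esub> \<ominus>\<^bsub>M\<^esub> c)"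
      using that by (simp add: a_minus_def M.a_assoc)
    then show ?thesis
      using that by (simp add: M.l_neg a_minus_def)
  qed
  have swap: "b \<ominus>\<^bsub>M\<^esub> a = \<ominus>\<^bsub>M\<^esub> (a \<ominus>\<^bsub>M\<^esub> b)" if "a \<in> carrier M" "b \<in> carrier M" for a b
    using that by (simp add: a_minus_def M.minus_add M.a_comm)
  {
    assume eq: "coset_rep M N x = coset_rep M N y"
    have "coset_rep M N y \<ominus>\<^bsub>M\<^esub> y \<in> N"
      using submodule_neg[OF coset_rep_diff[OF y]] swap[OF y coset_rep_closed[OF y]] by simp
    then show "x \<ominus>\<^bsub>M\<^esub> y \<in> N"
      using submodule_add[OF coset_rep_diff[OF x]] split[OF x coset_rep_closed[OF x] y] eq by simp
  }
  assume xy: "x \<ominus>\<^bsub>M\<^esub> y \<in> N"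
  then have yx: "y \<ominus>\<^bsub>M\<^esub> x \<in> N"
    using submodule_neg swap[OF x y] by simp
  have "(\<lambda>z. z \<in> carrier M \<and> x \<ominus>\<^bsub>M\<^esub> z \<in> N) = (\<lambda>z. z \<in> carrier M \<and> y \<ominus>\<^bsub>M\<^esub> z \<in> N)"
  proof (intro ext conj_cong refl iffI)
    fix z assume z: "z \<in> carrier M"
    show "y \<ominus>\<^bsub>M\<^esub> z \<in> N" if "x \<ominus>\<^bsub>M\<^esub> z \<in> N"
      using submodule_add[OF yx that] split[OF y x z] by simp
    show "x \<ominus>\<^bsub>M\<^esub> z \<in> N" if "y \<ominus>\<^bsub>M\<^esub> z \<in> N"
      using submodule_add[OF xy that] split[OF x y z] by simp
  qed
  then show "coset_rep M N x = coset_rep M N y"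
    by (simp add: coset_rep_def)
qed

lemma coset_rep_linear: "linear_map k M (quotient_module M N) (coset_rep M N)"
  unfolding linear_map_def
proof (intro conjI ballI)
  show "coset_rep M N \<in> carrier M \<rightarrow> carrier (quotient_module M N)"
    by (simp add: quotient_module_def)
  fix x assume x: "x \<in> carrier M"
  note rx = coset_rep_closed[OF x]
  show "coset_rep M N (x \<oplus>\<^bsub>M\<^esub> y) = coset_rep M N x \<oplus>\<^bsub>quotient_module M N\<^esub> coset_rep M N y"
    if y: "y \<in> carrier M" for y
  proof -
    note ry = coset_rep_closed[OF y]
    have "(x \<oplus>\<^bsub>M\<^esub> y) \<ominus>\<^bsub>M\<^esub> (coset_rep M N x \<oplus>\<^bsub>M\<^esub> coset_rep M N y) =
        (x \<ominus>\<^bsub>M\<^esub> coset_rep M N x) \<oplus>\<^bsub>M\<^esub> (y \<ominus>\<^bsub>M\<^esub> coset_rep M N y)"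
      using x y rx ry by (simp add: a_minus_def M.minus_add M.a_ac)
    also have "\<dots> \<in> N"
      by (rule submodule_add[OF coset_rep_diff[OF x] coset_rep_diff[OF y]])
    finally show ?thesis
      using x y rx ry by (simp add: quotient_module_def coset_rep_eq_iff)
  qed
  show "coset_rep M N (c \<odot>\<^bsub>M\<^esub> x) = c \<odot>\<^bsub>quotient_module M N\<^esub> coset_rep M N x" if c: "c \<in> carrier k" for c
  proof -
    have "(c \<odot>\<^bsub>M\<^esub> x) \<ominus>\<^bsub>M\<^esub> (c \<odot>\<^bsub>M\<^esub> coset_rep M N x) = c \<odot>\<^bsub>M\<^esub> (x \<ominus>\<^bsub>M\<^esub> coset_rep M N x)"
      using x rx c by (simp add: a_minus_def smult_r_distr smult_neg)
    also have "\<dots> \<in> N"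
      by (rule submodule_smult[OF c coset_rep_diff[OF x]])
    finally show ?thesis
      using x rx c by (simp add: quotient_module_def coset_rep_eq_iff smult_closed)
  qed
qed

lemma left_module_quotient: "left_module k (quotient_module M N)"
  by (rule left_module_image[OF M coset_rep_linear]) (simp_all add: quotient_module_def)

lemma coset_rep_eq_zero_iff:
  assumes x: "x \<in> carrier M"
  shows "coset_rep M N x = \<zero>\<^bsub>quotient_module M N\<^esub> \<longleftrightarrow> x \<in> N"
proof -
  have "x \<ominus>\<^bsub>M\<^esub> \<zero>\<^bsub>M\<^esub> = x"
    using x by (simp add: a_minus_def)
  then show ?thesis
    using coset_rep_eq_iff[OF x M.zero_closed] by (simp add: quotient_module_def)
qed

end

section \<open>Sheaves of functions with prescribed germs\<close>

text \<open>Sheafification in the style of the espace etale: given modules \<open>M y\<close> and compatible linear maps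
  \<open>\<gamma> y W : G(W) \<rightarrow> M y\<close> for \<open>y \<in> W\<close>, the functions that near each point are of the form \<open>y \<mapsto> \<gamma> y W t\<close> for
  a section \<open>t\<close> of \<open>G\<close> form a sheaf.\<close>

definition germ_sheaf ::
  "'x topology \<Rightarrow> ('x, 'k, 'b) presheaf \<Rightarrow> ('x \<Rightarrow> ('k, 'm) module) \<Rightarrow> ('x \<Rightarrow> 'x set \<Rightarrow> 'b \<Rightarrow> 'm) \<Rightarrow>
    ('x, 'k, 'x \<Rightarrow> 'm) presheaf" where
  "germ_sheaf X G M \<gamma> =
     \<lparr>sec = (\<lambda>V. (prod_module V M)\<lparr>carrier := {q \<in> (\<Pi>\<^sub>E y\<in>V. carrier (M y)).
        \<forall>x\<in>V. \<exists>W t. openin X W \<and> x \<in> W \<and> W \<subseteq> V \<and> t \<in> \<Gamma> G W \<and> (\<forall>y\<in>W. q y = \<gamma> y W t)}\<rparr>),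
      res = (\<lambda>V W q. restrict q W)\<rparr>"

locale germ_family =
  fixes k :: "('k, 'r) ring_scheme" and X :: "'x topology" and G :: "('x, 'k, 'b) presheaf"
    and M :: "'x \<Rightarrow> ('k, 'm) module" and \<gamma> :: "'x \<Rightarrow> 'x set \<Rightarrow> 'b \<Rightarrow> 'm"
  assumes k: "ring k" and G: "presheaf k X G"
    and M: "\<And>y. y \<in> topspace X \<Longrightarrow> left_module k (M y)"
    and linear: "\<And>y W. \<lbrakk>openin X W; y \<in> W\<rbrakk> \<Longrightarrow> linear_map k (sec G W) (M y) (\<gamma> y W)"
    and restrict: "\<And>y W W' t. \<lbrakk>openin X W; openin X W'; y \<in> W'; W' \<subseteq> W; t \<in> \<Gamma> G W\<rbrakk> \<Longrightarrow>
      \<gamma> y W' (res G W W' t) = \<gamma> y W t"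
begin

abbreviation Q :: "('x, 'k, 'x \<Rightarrow> 'm) presheaf" where
  "Q \<equiv> germ_sheaf X G M \<gamma>"

definition from_germs :: "'x set \<Rightarrow> ('x \<Rightarrow> 'm) \<Rightarrow> bool" where
  "from_germs V q \<longleftrightarrow> (\<forall>x\<in>V. \<exists>W t. openin X W \<and> x \<in> W \<and> W \<subseteq> V \<and> t \<in> \<Gamma> G W \<and> (\<forall>y\<in>W. q y = \<gamma> y W t))"

lemma carrier_Q: "\<Gamma> Q V = {q \<in> (\<Pi>\<^sub>E y\<in>V. carrier (M y)). from_germs V q}"
  by (simp add: germ_sheaf_def from_germs_def)

lemma Q_simps [simp]:
  "\<zero>\<^bsub>sec Q V\<^esub> = (\<lambda>y\<in>V. \<zero>\<^bsub>M y\<^esub>)"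
  "s \<oplus>\<^bsub>sec Q V\<^esub> t = (\<lambda>y\<in>V. s y \<oplus>\<^bsub>M y\<^esub> t y)"
  "c \<odot>\<^bsub>sec Q V\<^esub> s = (\<lambda>y\<in>V. c \<odot>\<^bsub>M y\<^esub> s y)"
  "res Q V W s = restrict s W"
  by (simp_all add: germ_sheaf_def prod_module_def)

lemma from_germsD:
  assumes "from_germs V q" "x \<in> V"
  obtains W t where "openin X W" "x \<in> W" "W \<subseteq> V" "t \<in> \<Gamma> G W" "\<And>y. y \<in> W \<Longrightarrow> q y = \<gamma> y W t"
  using assms unfolding from_germs_def by meson

lemma from_germsI:
  assumes "\<And>x. x \<in> V \<Longrightarrow> \<exists>W t. openin X W \<and> x \<in> W \<and> W \<subseteq> V \<and> t \<in> \<Gamma> G W \<and> (\<forall>y\<in>W. q y = \<gamma> y W t)"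
  shows "from_germs V q"
  unfolding from_germs_def by (rule ballI) (rule assms)

lemma from_germs_shrink:
  assumes q: "from_germs V q" and W: "openin X W" "W \<subseteq> V" and eq: "\<And>y. y \<in> W \<Longrightarrow> r y = q y"
  shows "from_germs W r"
proof (rule from_germsI)
  fix x assume x: "x \<in> W"
  then have "x \<in> V"
    using W by blast
  then obtain A t where A: "openin X A" "x \<in> A" "A \<subseteq> V" and t: "t \<in> \<Gamma> G A" "\<And>y. y \<in> A \<Longrightarrow> q y = \<gamma> y A t"
    by (rule from_germsD[OF q]) blast
  have I: "openin X (A \<inter> W)" "A \<inter> W \<subseteq> A"
    using A W by auto
  show "\<exists>W' t. openin X W' \<and> x \<in> W' \<and> W' \<subseteq> W \<and> t \<in> \<Gamma> G W' \<and> (\<forall>y\<in>W'. r y = \<gamma> y W' t)"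
    using I A(2) x eq t(2) restrict[OF A(1) I(1) _ I(2) t(1)] presheaf_res_closed[OF G A(1) I t(1)]
    by (intro exI[of _ "A \<inter> W"] exI[of _ "res G A (A \<inter> W) t"]) auto
qed

lemma from_germs_zero: "openin X V \<Longrightarrow> (\<And>y. y \<in> V \<Longrightarrow> q y = \<zero>\<^bsub>M y\<^esub>) \<Longrightarrow> from_germs V q"
proof (rule from_germsI)
  fix x assume V: "openin X V" and z: "\<And>y. y \<in> V \<Longrightarrow> q y = \<zero>\<^bsub>M y\<^esub>" and x: "x \<in> V"
  have "q y = \<gamma> y V \<zero>\<^bsub>sec G V\<^esub>" if "y \<in> V" for y
    using linear_map_zero[OF presheaf_sec[OF G V] M linear[OF V that]] z[OF that] that openin_subset[OF V] by auto
  then show "\<exists>W t. openin X W \<and> x \<in> W \<and> W \<subseteq> V \<and> t \<in> \<Gamma> G W \<and> (\<forall>y\<in>W. q y = \<gamma> y W t)"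
    using V x presheaf_zero_closed[OF G V] by blast
qed

lemma from_germs_add:
  assumes V: "openin X V" and q: "from_germs V q" and r: "from_germs V r"
    and eq: "\<And>y. y \<in> V \<Longrightarrow> p y = q y \<oplus>\<^bsub>M y\<^esub> r y"
  shows "from_germs V p"
proof (rule from_germsI)
  fix x assume x: "x \<in> V"
  obtain A t where A: "openin X A" "x \<in> A" "A \<subseteq> V" and t: "t \<in> \<Gamma> G A" "\<And>y. y \<in> A \<Longrightarrow> q y = \<gamma> y A t"
    by (rule from_germsD[OF q x]) blast
  obtain B u where B: "openin X B" "x \<in> B" "B \<subseteq> V" and u: "u \<in> \<Gamma> G B" "\<And>y. y \<in> B \<Longrightarrow> r y = \<gamma> y B u"
    by (rule from_germsD[OF r x]) blast
  let ?I = "A \<inter> B"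
  have I: "openin X ?I" "?I \<subseteq> A" "?I \<subseteq> B"
    using A B by auto
  have cl: "res G A ?I t \<in> \<Gamma> G ?I" "res G B ?I u \<in> \<Gamma> G ?I"
    by (rule presheaf_res_closed[OF G A(1) I(1,2) t(1)], rule presheaf_res_closed[OF G B(1) I(1,3) u(1)])
  have "p y = \<gamma> y ?I (res G A ?I t \<oplus>\<^bsub>sec G ?I\<^esub> res G B ?I u)" if y: "y \<in> ?I" for y
    using linear_map_add[OF linear[OF I(1) y] cl] restrict[OF A(1) I(1) y I(2) t(1)]
      restrict[OF B(1) I(1) y I(3) u(1)] t(2) u(2) eq y A(3) by auto
  then show "\<exists>W t. openin X W \<and> x \<in> W \<and> W \<subseteq> V \<and> t \<in> \<Gamma> G W \<and> (\<forall>y\<in>W. p y = \<gamma> y W t)"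
    using I A B presheaf_add_closed[OF G I(1) cl] by blast
qed

lemma from_germs_smult:
  assumes q: "from_germs V q" and c: "c \<in> carrier k" and eq: "\<And>y. y \<in> V \<Longrightarrow> p y = c \<odot>\<^bsub>M y\<^esub> q y"
  shows "from_germs V p"
proof (rule from_germsI)
  fix x assume x: "x \<in> V"
  obtain A t where A: "openin X A" "x \<in> A" "A \<subseteq> V" and t: "t \<in> \<Gamma> G A" "\<And>y. y \<in> A \<Longrightarrow> q y = \<gamma> y A t"
    by (rule from_germsD[OF q x]) blast
  have "p y = \<gamma> y A (c \<odot>\<^bsub>sec G A\<^esub> t)" if y: "y \<in> A" for y
    using linear_map_smult[OF linear[OF A(1) y] c t(1)] t(2) eq y A(3) by auto
  then show "\<exists>W t. openin X W \<and> x \<in> W \<and> W \<subseteq> V \<and> t \<in> \<Gamma> G W \<and> (\<forall>y\<in>W. p y = \<gamma> y W t)"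
    using A presheaf_smult_closed[OF G A(1) c t(1)] by blast
qed

lemma germ_sheaf_sheaf: "sheaf k X Q"
proof (rule sheafI)
  have mod: "left_module k (M y)" if "openin X V" "y \<in> V" for V y
    by (rule M) (use that openin_subset in blast)
  show "presheaf k X Q"
  proof (rule presheafI)
    fix V assume V: "openin X V"
    have prod: "left_module k (prod_module V M)"
      by (rule left_module_prod[OF k mod[OF V]])
    interpret P: left_module k "prod_module V M"
      by (rule prod)
    have "left_module k ((prod_module V M)\<lparr>carrier := \<Gamma> Q V\<rparr>)"
    proof (rule left_module_submodule[OF prod])
      show "\<Gamma> Q V \<subseteq> carrier (prod_module V M)"
        by (auto simp: carrier_Q)
      show "\<zero>\<^bsub>prod_module V M\<^esub> \<in> \<Gamma> Q V"
        unfolding carrier_Q using P.M.zero_closed from_germs_zero[OF V] by simp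
      show "q \<oplus>\<^bsub>prod_module V M\<^esub> r \<in> \<Gamma> Q V" if "q \<in> \<Gamma> Q V" "r \<in> \<Gamma> Q V" for q r
        using that P.M.a_closed[of q r] from_germs_add[OF V, of q r] unfolding carrier_Q by simp
      show "c \<odot>\<^bsub>prod_module V M\<^esub> q \<in> \<Gamma> Q V" if "c \<in> carrier k" "q \<in> \<Gamma> Q V" for c q
        using that P.smult_closed[of c q] from_germs_smult[of V q c] unfolding carrier_Q by simp
    qed
    then show "left_module k (sec Q V)"
      by (simp add: germ_sheaf_def)
    show "res Q V V q = q" if "q \<in> \<Gamma> Q V" for q
      using that unfolding carrier_Q by (auto simp: PiE_def extensional_restrict)
    fix W assume W: "openin X W" "W \<subseteq> V"
    have "restrict q W \<in> \<Gamma> Q W" if "q \<in> \<Gamma> Q V" for q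
      using that from_germs_shrink[OF _ W, of q "restrict q W"] W(2) unfolding carrier_Q by auto
    then show "linear_map k (sec Q V) (sec Q W) (res Q V W)"
      using W(2) by (auto simp: linear_map_def fun_eq_iff restrict_def subset_iff)
    show "res Q W W' (res Q V W q) = res Q V W' q" if "W' \<subseteq> W" for W' q
      using that by (auto simp: fun_eq_iff restrict_def subset_iff)
  qed
  fix \<U> assume op: "\<And>U. U \<in> \<U> \<Longrightarrow> openin X U"
  show "q = r" if q: "q \<in> \<Gamma> Q (\<Union>\<U>)" and r: "r \<in> \<Gamma> Q (\<Union>\<U>)"
    and eq: "\<And>U. U \<in> \<U> \<Longrightarrow> res Q (\<Union>\<U>) U q = res Q (\<Union>\<U>) U r" for q r
  proof (rule PiE_ext[of _ "\<Union>\<U>" "\<lambda>y. carrier (M y)"])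
    fix x assume "x \<in> \<Union>\<U>"
    then obtain U where U: "U \<in> \<U>" "x \<in> U"
      by blast
    show "q x = r x"
      using fun_cong[OF eq[OF U(1)], of x] U(2) by simp
  qed (use q r in \<open>simp_all add: carrier_Q\<close>)
  show "\<exists>q\<in>\<Gamma> Q (\<Union>\<U>). \<forall>U\<in>\<U>. res Q (\<Union>\<U>) U q = \<sigma> U"
    if \<sigma>: "\<And>U. U \<in> \<U> \<Longrightarrow> \<sigma> U \<in> \<Gamma> Q U"
      and compat: "\<And>U V. \<lbrakk>U \<in> \<U>; V \<in> \<U>\<rbrakk> \<Longrightarrow> res Q U (U \<inter> V) (\<sigma> U) = res Q V (U \<inter> V) (\<sigma> V)" for \<sigma>
  proof -
    define q where "q = (\<lambda>x\<in>\<Union>\<U>. \<sigma> (SOME U. U \<in> \<U> \<and> x \<in> U) x)"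
    have \<sigma>P: "\<sigma> U \<in> (\<Pi>\<^sub>E y\<in>U. carrier (M y))" and \<sigma>g: "from_germs U (\<sigma> U)" if "U \<in> \<U>" for U
      using \<sigma>[OF that] by (simp_all add: carrier_Q)
    have q: "q x = \<sigma> U x" if U: "U \<in> \<U>" "x \<in> U" for U x
    proof -
      define V where "V = (SOME U. U \<in> \<U> \<and> x \<in> U)"
      have V: "V \<in> \<U> \<and> x \<in> V"
        unfolding V_def by (rule someI[of _ U]) (use that in simp)
      have "\<sigma> U x = \<sigma> V x"
        using fun_cong[OF compat[OF U(1), of V], of x] V U by simp
      then show ?thesis
        using that V by (auto simp: q_def V_def)
    qed
    have "q x \<in> carrier (M x)" if x: "x \<in> \<Union>\<U>" for x
    proof -
      obtain U where U: "U \<in> \<U>" "x \<in> U"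
        using x by blast
      then show ?thesis
        using q[OF U] PiE_mem[OF \<sigma>P[OF U(1)] U(2)] by simp
    qed
    then have "q \<in> (\<Pi>\<^sub>E y\<in>\<Union>\<U>. carrier (M y))"
      by (simp add: PiE_def q_def)
    moreover have "from_germs (\<Union>\<U>) q"
    proof (rule from_germsI)
      fix x assume "x \<in> \<Union>\<U>"
      then obtain U where U: "U \<in> \<U>" "x \<in> U"
        by blast
      obtain W t where W: "openin X W" "x \<in> W" "W \<subseteq> U" and t: "t \<in> \<Gamma> G W" "\<And>y. y \<in> W \<Longrightarrow> \<sigma> U y = \<gamma> y W t"
        by (rule from_germsD[OF \<sigma>g[OF U(1)] U(2)]) blast
      have "q y = \<gamma> y W t" if "y \<in> W" for y
        using q[OF U(1), of y] t(2)[OF that] that W(3) by auto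
      then show "\<exists>W t. openin X W \<and> x \<in> W \<and> W \<subseteq> \<Union>\<U> \<and> t \<in> \<Gamma> G W \<and> (\<forall>y\<in>W. q y = \<gamma> y W t)"
        using W t(1) U(1) by blast
    qed
    moreover have "restrict q U = \<sigma> U" if U: "U \<in> \<U>" for U
      by (rule extensionalityI[of _ U]) (use \<sigma>P[OF U] q[OF U] in \<open>auto simp: PiE_def\<close>)
    ultimately show ?thesis
      by (intro bexI[of _ q]) (simp_all add: carrier_Q)
  qed
qed

definition to_germs :: "'x set \<Rightarrow> 'b \<Rightarrow> 'x \<Rightarrow> 'm" where
  "to_germs = family_hom X G (\<lambda>V t. \<lambda>y\<in>V. \<gamma> y V t)"

lemma to_germs_hom: "to_germs \<in> sheaf_hom k X G Q"
  unfolding to_germs_def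
proof (rule family_hom_in[OF _ _ _ _ G])
  fix V t assume V: "openin X V" and t: "t \<in> \<Gamma> G V"
  have "from_germs V (\<lambda>y\<in>V. \<gamma> y V t)"
    by (rule from_germsI) (use V t in auto)
  then show "(\<lambda>y\<in>V. \<gamma> y V t) \<in> \<Gamma> Q V"
    using linear_map_closed[OF linear[OF V] t] by (simp add: carrier_Q PiE_def)
  show "(\<lambda>y\<in>V. \<gamma> y V (t \<oplus>\<^bsub>sec G V\<^esub> u)) = (\<lambda>y\<in>V. \<gamma> y V t) \<oplus>\<^bsub>sec Q V\<^esub> (\<lambda>y\<in>V. \<gamma> y V u)" if "u \<in> \<Gamma> G V" for u
    using linear_map_add[OF linear[OF V] t that] by (auto simp: fun_eq_iff restrict_def)
  show "(\<lambda>y\<in>V. \<gamma> y V (c \<odot>\<^bsub>sec G V\<^esub> t)) = c \<odot>\<^bsub>sec Q V\<^esub> (\<lambda>y\<in>V. \<gamma> y V t)" if "c \<in> carrier k" for c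
    using linear_map_smult[OF linear[OF V] that t] by (auto simp: fun_eq_iff restrict_def)
  show "(\<lambda>y\<in>W. \<gamma> y W (res G V W t)) = res Q V W (\<lambda>y\<in>V. \<gamma> y V t)" if "openin X W" "W \<subseteq> V" for W
    using that by (auto simp: fun_eq_iff restrict_def restrict[OF V that(1) _ that(2) t])
qed

lemma right_exact_germ_sheaf:
  assumes f: "f \<in> sheaf_hom k X A G"
    and ker: "\<And>V t y. \<lbrakk>openin X V; t \<in> \<Gamma> G V; y \<in> V\<rbrakk> \<Longrightarrow> \<gamma> y V t = \<zero>\<^bsub>M y\<^esub> \<longleftrightarrow>
      (\<exists>W. openin X W \<and> y \<in> W \<and> W \<subseteq> V \<and> res G V W t \<in> f W ` \<Gamma> A W)"
  shows "right_exact_seq k X A G Q f to_germs"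
proof (rule right_exact_seqI[OF f to_germs_hom])
  fix V assume V: "openin X V"
  have zero: "to_germs V t = \<zero>\<^bsub>sec Q V\<^esub> \<longleftrightarrow> (\<forall>y\<in>V. \<gamma> y V t = \<zero>\<^bsub>M y\<^esub>)" if t: "t \<in> \<Gamma> G V" for t
    using V t by (auto simp: to_germs_def fun_eq_iff restrict_def)
  show "\<forall>x\<in>V. \<exists>W. openin X W \<and> x \<in> W \<and> W \<subseteq> V \<and> res G V W t \<in> f W ` \<Gamma> A W"
    if t: "t \<in> \<Gamma> G V" and z: "to_germs V t = \<zero>\<^bsub>sec Q V\<^esub>" for t
    using z ker[OF V t] unfolding zero[OF t] by blast
  show "to_germs V t = \<zero>\<^bsub>sec Q V\<^esub>"
    if t: "t \<in> \<Gamma> G V" and loc: "\<forall>x\<in>V. \<exists>W. openin X W \<and> x \<in> W \<and> W \<subseteq> V \<and> res G V W t \<in> f W ` \<Gamma> A W" for t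
    using loc ker[OF V t] unfolding zero[OF t] by blast
  fix q x assume q: "q \<in> \<Gamma> Q V" and x: "x \<in> V"
  have "from_germs V q"
    using q by (simp add: carrier_Q)
  then obtain W t where W: "openin X W" "x \<in> W" "W \<subseteq> V" and t: "t \<in> \<Gamma> G W" "\<And>y. y \<in> W \<Longrightarrow> q y = \<gamma> y W t"
    using x by (rule from_germsD) blast
  have "res Q V W q = to_germs W t"
    using W(1) t by (auto simp: to_germs_def fun_eq_iff restrict_def)
  then show "\<exists>W. openin X W \<and> x \<in> W \<and> W \<subseteq> V \<and> res Q V W q \<in> to_germs W ` \<Gamma> G W"
    using W t(1) by blast
qed

end

section \<open>Construction of cokernels\<close>

text \<open>Let \<open>f : A \<rightarrow> B\<close> be a map of sheaves that are rigid on a neighbourhood \<open>U y\<close> of each point \<open>y\<close>. Then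
  \<open>B(U y)\<close> is the stalk of \<open>B\<close> at \<open>y\<close>, and the stalk of the cokernel is \<open>B(U y) / f(A(U y))\<close>.\<close>

locale rigid_cover =
  fixes k :: "('k, 'r) ring_scheme" and X :: "'x topology"
    and A :: "('x, 'k, 'a) presheaf" and B :: "('x, 'k, 'b) presheaf" and f
    and U :: "'x \<Rightarrow> 'x set"
  assumes X: "locally_connected_space X" and A: "sheaf k X A" and B: "sheaf k X B"
    and f: "f \<in> sheaf_hom k X A B"
    and U: "\<And>y. y \<in> topspace X \<Longrightarrow> y \<in> U y"
    and AU: "\<And>y. y \<in> topspace X \<Longrightarrow> rigid_on X A (U y)"
    and BU: "\<And>y. y \<in> topspace X \<Longrightarrow> rigid_on X B (U y)"
begin

lemmas PA = sheaf_presheaf[OF A] and PB = sheaf_presheaf[OF B]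

lemma point: "openin X W \<Longrightarrow> y \<in> W \<Longrightarrow> y \<in> topspace X"
  using openin_subset by blast

lemma opU: "y \<in> topspace X \<Longrightarrow> openin X (U y)"
  by (rule rigid_on_open[OF AU])

text \<open>\<open>g\<close> is the element of \<open>B(U y)\<close> that represents the germ of \<open>t\<close> at \<open>y\<close>.\<close>

definition same_germ :: "'x \<Rightarrow> 'x set \<Rightarrow> 'b \<Rightarrow> 'b \<Rightarrow> bool" where
  "same_germ y W t g \<longleftrightarrow> g \<in> \<Gamma> B (U y) \<and>
     (\<exists>C. openin X C \<and> y \<in> C \<and> C \<subseteq> W \<and> C \<subseteq> U y \<and> res B (U y) C g = res B W C t)"

lemma same_germ_unique:
  assumes W: "openin X W" "y \<in> W" and t: "t \<in> \<Gamma> B W" and g: "same_germ y W t g" and h: "same_germ y W t h"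
  shows "g = h"
proof -
  have y: "y \<in> topspace X"
    using point W by blast
  obtain C where C: "openin X C" "y \<in> C" "C \<subseteq> W" "C \<subseteq> U y" "res B (U y) C g = res B W C t" and gB: "g \<in> \<Gamma> B (U y)"
    using g unfolding same_germ_def by blast
  obtain D where D: "openin X D" "y \<in> D" "D \<subseteq> W" "D \<subseteq> U y" "res B (U y) D h = res B W D t" and hB: "h \<in> \<Gamma> B (U y)"
    using h unfolding same_germ_def by blast
  have "openin X (C \<inter> D)" "y \<in> C \<inter> D"
    using C D by auto
  then obtain E where E: "openin X E" "connectedin X E" "y \<in> E" "E \<subseteq> C \<inter> D"
    using locally_connected_obtain[OF X] by metis
  have sub: "E \<subseteq> C" "E \<subseteq> D" and EU: "E \<subseteq> U y" and ne: "E \<noteq> {}"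
    using E C(4) by auto
  have "res B (U y) E g = res B W E t"
    using presheaf_res_res[OF PB opU[OF y] C(1) E(1) sub(1) C(4) gB]
      presheaf_res_res[OF PB W(1) C(1) E(1) sub(1) C(3) t] C(5) by simp
  moreover have "res B (U y) E h = res B W E t"
    using presheaf_res_res[OF PB opU[OF y] D(1) E(1) sub(2) D(4) hB]
      presheaf_res_res[OF PB W(1) D(1) E(1) sub(2) D(3) t] D(5) by simp
  ultimately have "res B (U y) E g = res B (U y) E h"
    by simp
  then show ?thesis
    by (rule rigid_on_eqI[OF BU[OF y] E(1,2) ne EU gB hB])
qed

lemma same_germ_exists:
  assumes W: "openin X W" "y \<in> W" and t: "t \<in> \<Gamma> B W"
  shows "\<exists>g. same_germ y W t g"
proof -
  have y: "y \<in> topspace X"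
    using point W by blast
  have "openin X (W \<inter> U y)" "y \<in> W \<inter> U y"
    using W U[OF y] opU[OF y] by auto
  then obtain C where C: "openin X C" "connectedin X C" "y \<in> C" "C \<subseteq> W \<inter> U y"
    using locally_connected_obtain[OF X] by metis
  have sub: "C \<subseteq> W" "C \<subseteq> U y" and ne: "C \<noteq> {}"
    using C by auto
  obtain g where "g \<in> \<Gamma> B (U y)" "res B (U y) C g = res B W C t"
    using rigid_on_extend[OF BU[OF y] C(1,2) ne sub(2) presheaf_res_closed[OF PB W(1) C(1) sub(1) t]] .
  then show ?thesis
    unfolding same_germ_def using C(1,3) sub by blast
qed

definition germ :: "'x \<Rightarrow> 'x set \<Rightarrow> 'b \<Rightarrow> 'b" where
  "germ y W t = (SOME g. same_germ y W t g)"

lemma same_germ: "\<lbrakk>openin X W; y \<in> W; t \<in> \<Gamma> B W\<rbrakk> \<Longrightarrow> same_germ y W t (germ y W t)"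
  unfolding germ_def by (rule someI_ex[OF same_germ_exists])

lemma germ_closed: "\<lbrakk>openin X W; y \<in> W; t \<in> \<Gamma> B W\<rbrakk> \<Longrightarrow> germ y W t \<in> \<Gamma> B (U y)"
  using same_germ unfolding same_germ_def by blast

lemma germI: "\<lbrakk>openin X W; y \<in> W; t \<in> \<Gamma> B W; same_germ y W t g\<rbrakk> \<Longrightarrow> germ y W t = g"
  using same_germ_unique same_germ by metis

lemma germ_res:
  assumes W: "openin X W" and W': "openin X W'" "y \<in> W'" "W' \<subseteq> W" and t: "t \<in> \<Gamma> B W"
  shows "germ y W' (res B W W' t) = germ y W t"
proof -
  have yW: "y \<in> W"
    using W' by blast
  have y: "y \<in> topspace X"
    using point W yW by blast
  obtain C where C: "openin X C" "y \<in> C" "C \<subseteq> W" "C \<subseteq> U y" "res B (U y) C (germ y W t) = res B W C t"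
    using same_germ[OF W yW t] unfolding same_germ_def by blast
  note g = germ_closed[OF W yW t]
  let ?D = "C \<inter> W'"
  have D: "openin X ?D" "y \<in> ?D" "?D \<subseteq> W'" "?D \<subseteq> C" "?D \<subseteq> U y"
    using C W' by auto
  have "res B (U y) ?D (germ y W t) = res B W' ?D (res B W W' t)"
    using presheaf_res_res[OF PB opU[OF y] C(1) D(1,4) C(4) g] presheaf_res_res[OF PB W C(1) D(1,4) C(3) t]
      presheaf_res_res[OF PB W W'(1) D(1,3) W'(3) t] C(5) by simp
  then have "same_germ y W' (res B W W' t) (germ y W t)"
    unfolding same_germ_def using D g by blast
  then show ?thesis
    by (rule germI[OF W'(1,2) presheaf_res_closed[OF PB W W'(1,3) t]])
qed

lemma germ_linear:
  assumes W: "openin X W" "y \<in> W"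
  shows "linear_map k (sec B W) (sec B (U y)) (germ y W)"
  unfolding linear_map_def
proof (intro conjI ballI)
  have y: "y \<in> topspace X"
    using point W by blast
  show "germ y W \<in> \<Gamma> B W \<rightarrow> \<Gamma> B (U y)"
    using germ_closed[OF W] by blast
  fix s assume s: "s \<in> \<Gamma> B W"
  note gs = germ_closed[OF W s]
  obtain C where C: "openin X C" "y \<in> C" "C \<subseteq> W" "C \<subseteq> U y" "res B (U y) C (germ y W s) = res B W C s"
    using same_germ[OF W s] unfolding same_germ_def by blast
  show "germ y W (s \<oplus>\<^bsub>sec B W\<^esub> t) = germ y W s \<oplus>\<^bsub>sec B (U y)\<^esub> germ y W t" if t: "t \<in> \<Gamma> B W" for t
  proof (rule germI[OF W presheaf_add_closed[OF PB W(1) s t]])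
    note gt = germ_closed[OF W t]
    obtain D where D: "openin X D" "y \<in> D" "D \<subseteq> W" "D \<subseteq> U y" "res B (U y) D (germ y W t) = res B W D t"
      using same_germ[OF W t] unfolding same_germ_def by blast
    let ?E = "C \<inter> D"
    have E: "openin X ?E" "y \<in> ?E" "?E \<subseteq> W" "?E \<subseteq> U y" "?E \<subseteq> C" "?E \<subseteq> D"
      using C D by auto
    have "res B (U y) ?E (germ y W s) = res B W ?E s"
      using presheaf_res_res[OF PB opU[OF y] C(1) E(1,5) C(4) gs] presheaf_res_res[OF PB W(1) C(1) E(1,5) C(3) s] C(5)
      by simp
    moreover have "res B (U y) ?E (germ y W t) = res B W ?E t"
      using presheaf_res_res[OF PB opU[OF y] D(1) E(1,6) D(4) gt] presheaf_res_res[OF PB W(1) D(1) E(1,6) D(3) t] D(5)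
      by simp
    ultimately have "res B (U y) ?E (germ y W s \<oplus>\<^bsub>sec B (U y)\<^esub> germ y W t) = res B W ?E (s \<oplus>\<^bsub>sec B W\<^esub> t)"
      using linear_map_add[OF presheaf_res_linear[OF PB opU[OF y] E(1,4)] gs gt]
        linear_map_add[OF presheaf_res_linear[OF PB W(1) E(1,3)] s t] by simp
    then show "same_germ y W (s \<oplus>\<^bsub>sec B W\<^esub> t) (germ y W s \<oplus>\<^bsub>sec B (U y)\<^esub> germ y W t)"
      unfolding same_germ_def using E presheaf_add_closed[OF PB opU[OF y] gs gt] by blast
  qed
  show "germ y W (c \<odot>\<^bsub>sec B W\<^esub> s) = c \<odot>\<^bsub>sec B (U y)\<^esub> germ y W s" if c: "c \<in> carrier k" for c
  proof (rule germI[OF W presheaf_smult_closed[OF PB W(1) c s]])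
    have "res B (U y) C (c \<odot>\<^bsub>sec B (U y)\<^esub> germ y W s) = res B W C (c \<odot>\<^bsub>sec B W\<^esub> s)"
      using linear_map_smult[OF presheaf_res_linear[OF PB opU[OF y] C(1,4)] c gs]
        linear_map_smult[OF presheaf_res_linear[OF PB W(1) C(1,3)] c s] C(5) by simp
    then show "same_germ y W (c \<odot>\<^bsub>sec B W\<^esub> s) (c \<odot>\<^bsub>sec B (U y)\<^esub> germ y W s)"
      unfolding same_germ_def using C presheaf_smult_closed[OF PB opU[OF y] c gs] by blast
  qed
qed

text \<open>The stalk of the image sheaf is the image of the stalk: a local preimage extends to \<open>U y\<close> by the
  rigidity of \<open>A\<close>.\<close>

lemma germ_in_image_iff:
  assumes W: "openin X W" "y \<in> W" and t: "t \<in> \<Gamma> B W"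
  shows "germ y W t \<in> f (U y) ` \<Gamma> A (U y) \<longleftrightarrow>
    (\<exists>C. openin X C \<and> y \<in> C \<and> C \<subseteq> W \<and> res B W C t \<in> f C ` \<Gamma> A C)"
proof
  have y: "y \<in> topspace X"
    using point W by blast
  {
    assume "germ y W t \<in> f (U y) ` \<Gamma> A (U y)"
    then obtain a where a: "a \<in> \<Gamma> A (U y)" "germ y W t = f (U y) a"
      by blast
    obtain C where C: "openin X C" "y \<in> C" "C \<subseteq> W" "C \<subseteq> U y" "res B (U y) C (germ y W t) = res B W C t"
      using same_germ[OF W t] unfolding same_germ_def by blast
    have "res B W C t = f C (res A (U y) C a)"
      using C(5) a(2) hom_res[OF f opU[OF y] C(1,4) a(1)] by simp
    then have "res B W C t \<in> f C ` \<Gamma> A C"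
      using presheaf_res_closed[OF PA opU[OF y] C(1,4) a(1)] by blast
    then show "\<exists>C. openin X C \<and> y \<in> C \<and> C \<subseteq> W \<and> res B W C t \<in> f C ` \<Gamma> A C"
      using C by blast
  }
  assume "\<exists>C. openin X C \<and> y \<in> C \<and> C \<subseteq> W \<and> res B W C t \<in> f C ` \<Gamma> A C"
  then obtain C s where C: "openin X C" "y \<in> C" "C \<subseteq> W" and s: "s \<in> \<Gamma> A C" "res B W C t = f C s"
    by blast
  have "openin X (C \<inter> U y)" "y \<in> C \<inter> U y"
    using C U[OF y] opU[OF y] by auto
  then obtain D where D: "openin X D" "connectedin X D" "y \<in> D" "D \<subseteq> C \<inter> U y"
    using locally_connected_obtain[OF X] by metis
  have sub: "D \<subseteq> C" "D \<subseteq> U y" "D \<subseteq> W" and ne: "D \<noteq> {}"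
    using D C by auto
  obtain a where a: "a \<in> \<Gamma> A (U y)" "res A (U y) D a = res A C D s"
    using rigid_on_extend[OF AU[OF y] D(1,2) ne sub(2) presheaf_res_closed[OF PA C(1) D(1) sub(1) s(1)]] .
  have "res B (U y) D (f (U y) a) = res B W D t"
    using hom_res[OF f opU[OF y] D(1) sub(2) a(1)] a(2) hom_res[OF f C(1) D(1) sub(1) s(1)] s(2)
      presheaf_res_res[OF PB W(1) C(1) D(1) sub(1) C(3) t] by simp
  then have "same_germ y W t (f (U y) a)"
    unfolding same_germ_def using D(1,3) sub hom_closed[OF f opU[OF y] a(1)] by blast
  then have "germ y W t = f (U y) a"
    by (rule germI[OF W t])
  then show "germ y W t \<in> f (U y) ` \<Gamma> A (U y)"
    using a(1) by blast
qed

definition image_at :: "'x \<Rightarrow> 'b set" where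
  "image_at y = f (U y) ` \<Gamma> A (U y)"

definition coker_stalk :: "'x \<Rightarrow> ('k, 'b) module" where
  "coker_stalk y = quotient_module (sec B (U y)) (image_at y)"

definition coker_germ :: "'x \<Rightarrow> 'x set \<Rightarrow> 'b \<Rightarrow> 'b" where
  "coker_germ y W t = coset_rep (sec B (U y)) (image_at y) (germ y W t)"

lemma stalk_module: "y \<in> topspace X \<Longrightarrow> left_module k (sec B (U y))"
  by (rule presheaf_sec[OF PB opU])

lemma image_at_submodule:
  assumes y: "y \<in> topspace X"
  shows "left_submodule k (sec B (U y)) (image_at y)"
  unfolding image_at_def
  by (rule left_submodule_image[OF presheaf_sec[OF PA opU[OF y]] stalk_module[OF y] hom_linear[OF f opU[OF y]]])

lemma coker_right_exact:
  assumes k: "ring k"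
  shows "\<exists>Q :: ('x, 'k, 'x \<Rightarrow> 'b) presheaf. \<exists>p. sheaf k X Q \<and> right_exact_seq k X A B Q f p"
proof -
  interpret germ_family k X B coker_stalk coker_germ
  proof (rule germ_family.intro)
    show "ring k"
      by (rule k)
    show "presheaf k X B"
      by (rule PB)
    show "left_module k (coker_stalk y)" if "y \<in> topspace X" for y
      unfolding coker_stalk_def by (rule left_module_quotient[OF stalk_module[OF that] image_at_submodule[OF that]])
    show "linear_map k (sec B W) (coker_stalk y) (coker_germ y W)" if W: "openin X W" "y \<in> W" for y W
    proof -
      have y: "y \<in> topspace X"
        using point W by blast
      note lin = coset_rep_linear[OF stalk_module[OF y] image_at_submodule[OF y]] and g = germ_linear[OF W]
      show ?thesis
        unfolding linear_map_def coker_germ_def coker_stalk_def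
        by (auto simp: linear_map_closed[OF g] linear_map_closed[OF lin] linear_map_add[OF g] linear_map_add[OF lin]
            linear_map_smult[OF g] linear_map_smult[OF lin])
    qed
    show "coker_germ y W' (res B W W' t) = coker_germ y W t"
      if "openin X W" "openin X W'" "y \<in> W'" "W' \<subseteq> W" "t \<in> \<Gamma> B W" for y W W' t
      unfolding coker_germ_def by (simp only: germ_res[OF that])
  qed
  have "right_exact_seq k X A B Q f to_germs"
  proof (rule right_exact_germ_sheaf[OF f])
    fix V t y assume V: "openin X V" and t: "t \<in> \<Gamma> B V" and yV: "y \<in> V"
    have y: "y \<in> topspace X"
      using point V yV by blast
    show "coker_germ y V t = \<zero>\<^bsub>coker_stalk y\<^esub> \<longleftrightarrow>
        (\<exists>W. openin X W \<and> y \<in> W \<and> W \<subseteq> V \<and> res B V W t \<in> f W ` \<Gamma> A W)"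
      unfolding coker_germ_def coker_stalk_def
        coset_rep_eq_zero_iff[OF stalk_module[OF y] image_at_submodule[OF y] germ_closed[OF V yV t]]
      unfolding image_at_def by (rule germ_in_image_iff[OF V yV t])
  qed
  then show ?thesis
    using germ_sheaf_sheaf by blast
qed

end

section \<open>Locally constant sheaves on a locally connected space\<close>

lemma common_rigid:
  assumes X: "locally_connected_space X" and A: "locally_constant k X A" and B: "locally_constant k X B"
    and x: "x \<in> topspace X"
  shows "\<exists>U. x \<in> U \<and> rigid_on X A U \<and> rigid_on X B U"
proof -
  have shA: "sheaf k X A" and shB: "sheaf k X B"
    using A B by (simp_all add: locally_constant_def)
  obtain U where U: "x \<in> U" "rigid_on X A U"
    using A x unfolding locally_constant_iff_rigid[OF X] by blast
  obtain V where V: "x \<in> V" "rigid_on X B V"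
    using B x unfolding locally_constant_iff_rigid[OF X] by blast
  have "openin X (U \<inter> V)" "x \<in> U \<inter> V"
    using rigid_on_open[OF U(2)] rigid_on_open[OF V(2)] U V by auto
  then obtain W where W: "openin X W" "connectedin X W" "x \<in> W" "W \<subseteq> U \<inter> V"
    using locally_connected_obtain[OF X] by metis
  have sub: "W \<subseteq> U" "W \<subseteq> V" and ne: "W \<noteq> {}"
    using W by auto
  show ?thesis
    using W(3) rigid_on_mono[OF sheaf_presheaf[OF shA] U(2) W(1,2) ne sub(1)]
      rigid_on_mono[OF sheaf_presheaf[OF shB] V(2) W(1,2) ne sub(2)] by blast
qed

text \<open>The first injection of the universe encodes the sections of a product, the second those of a
  cokernel, which are functions on the space.\<close>

lemma locally_constant_closed:
  fixes k :: "('k, 'r) ring_scheme" and X :: "'x topology"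
  assumes k: "ring k" and X: "locally_connected_space X" and univ: "sheaf_universe TYPE('x) TYPE('u)"
  shows "closed_sheaf_class k X {F :: ('x, 'k, 'u) presheaf. locally_constant k X F}"
proof
  obtain e :: "'u \<times> 'u \<Rightarrow> 'u" where e: "inj e"
    using univ unfolding sheaf_universe_def by blast
  obtain d :: "('x \<Rightarrow> 'u) \<Rightarrow> 'u" where d: "inj d"
    using univ unfolding sheaf_universe_def by blast
  let ?S = "{F :: ('x, 'k, 'u) presheaf. locally_constant k X F}"
  show "?S \<subseteq> {F. sheaf k X F}"
    by (auto simp: locally_constant_def)
  have lcI: "locally_constant k X F" if "sheaf k X F" "\<And>x. x \<in> topspace X \<Longrightarrow> \<exists>U. x \<in> U \<and> rigid_on X F U"
    for F :: "('x, 'k, 'u) presheaf"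
    unfolding locally_constant_iff_rigid[OF X] using that by blast
  show "\<exists>Z\<in>?S. \<forall>V. openin X V \<longrightarrow> \<Gamma> Z V = {\<zero>\<^bsub>sec Z V\<^esub>}"
  proof (intro bexI[of _ "zero_sheaf undefined"])
    have "\<exists>U. x \<in> U \<and> rigid_on X (zero_sheaf undefined :: ('x, 'k, 'u) presheaf) U" if "x \<in> topspace X" for x
      using locally_connected_obtain[OF X openin_topspace that] zero_sheaf_rigid by metis
    then show "zero_sheaf undefined \<in> ?S"
      using lcI[OF zero_sheaf_sheaf[OF k]] by simp
  qed simp
  fix A B :: "('x, 'k, 'u) presheaf"
  assume "A \<in> ?S" "B \<in> ?S"
  then have A: "locally_constant k X A" and B: "locally_constant k X B"
    by simp_all
  then have shA: "sheaf k X A" and shB: "sheaf k X B"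
    by (simp_all add: locally_constant_def)
  note PA = sheaf_presheaf[OF shA] and PB = sheaf_presheaf[OF shB]
  have rigid: "\<exists>U. x \<in> U \<and> rigid_on X A U \<and> rigid_on X B U" if "x \<in> topspace X" for x
    by (rule common_rigid[OF X A B that])
  show "\<exists>P\<in>?S. \<exists>p\<in>sheaf_hom k X P A. \<exists>q\<in>sheaf_hom k X P B.
      \<forall>V. openin X V \<longrightarrow> bij_betw (\<lambda>s. (p V s, q V s)) (\<Gamma> P V) (\<Gamma> A V \<times> \<Gamma> B V)"
  proof (rule bexI[of _ "push_sheaf e (pair_sheaf A B)"])
    note P = pair_sheaf_sheaf[OF shA shB]
    have "\<exists>U. x \<in> U \<and> rigid_on X (push_sheaf e (pair_sheaf A B)) U" if "x \<in> topspace X" for x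
      using rigid[OF that] rigid_on_iso[OF push_sheaf_bijective[OF sheaf_presheaf[OF P] e]] pair_sheaf_rigid by metis
    then show "push_sheaf e (pair_sheaf A B) \<in> ?S"
      using lcI[OF push_sheaf_sheaf[OF P e]] by simp
  qed (rule push_pair_sheaf_product[OF shA shB e])
  fix f assume f: "f \<in> sheaf_hom k X A B"
  show "\<exists>K\<in>?S. \<exists>i\<in>sheaf_hom k X K A. \<forall>V. openin X V \<longrightarrow> inj_on (i V) (\<Gamma> K V) \<and> i V ` \<Gamma> K V = kernel_sections A B f V"
  proof (intro bexI[of _ "kernel_sheaf A B f"] bexI[of _ "family_hom X (kernel_sheaf A B f) (\<lambda>V s. s)"] allI impI)
    note K = kernel_sheaf_sheaf[OF shA shB f]
    show "family_hom X (kernel_sheaf A B f) (\<lambda>V s. s) \<in> sheaf_hom k X (kernel_sheaf A B f) A"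
      by (rule family_hom_in[OF _ _ _ _ sheaf_presheaf[OF K]]) (simp_all add: kernel_sections_def)
    have "\<exists>U. x \<in> U \<and> rigid_on X (kernel_sheaf A B f) U" if "x \<in> topspace X" for x
      using rigid[OF that] kernel_sheaf_rigid[OF PA PB f] by metis
    then show "kernel_sheaf A B f \<in> ?S"
      using lcI[OF K] by simp
    fix V assume V: "openin X V"
    have "family_hom X (kernel_sheaf A B f) (\<lambda>V s. s) V s = s" if "s \<in> kernel_sections A B f V" for s
      using that V by simp
    then show "inj_on (family_hom X (kernel_sheaf A B f) (\<lambda>V s. s) V) (\<Gamma> (kernel_sheaf A B f) V) \<and>
        family_hom X (kernel_sheaf A B f) (\<lambda>V s. s) V ` \<Gamma> (kernel_sheaf A B f) V = kernel_sections A B f V"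
      by (simp add: inj_on_def)
  qed
  show "\<exists>Q\<in>?S. \<exists>p. right_exact_seq k X A B Q f p"
  proof -
    obtain U where U: "\<And>y. y \<in> topspace X \<Longrightarrow> y \<in> U y \<and> rigid_on X A (U y) \<and> rigid_on X B (U y)"
      using rigid by metis
    interpret rigid_cover k X A B f U
      by unfold_locales (use X shA shB f U in auto)
    obtain Q :: "('x, 'k, 'x \<Rightarrow> 'u) presheaf" and p where Q: "sheaf k X Q" and ex: "right_exact_seq k X A B Q f p"
      using coker_right_exact[OF k] by blast
    let ?Q = "push_sheaf d Q"
    have Q': "sheaf k X ?Q"
      by (rule push_sheaf_sheaf[OF Q d])
    note ex' = right_exact_iso_target[OF PB sheaf_presheaf[OF Q] sheaf_presheaf[OF Q'] ex
        push_sheaf_bijective[OF sheaf_presheaf[OF Q] d]]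
    have "\<exists>U. x \<in> U \<and> rigid_on X ?Q U" if "x \<in> topspace X" for x
      using rigid[OF that] rigid_on_cokernel[OF X PA PB Q' ex'] by metis
    then have "?Q \<in> ?S"
      using lcI[OF Q'] by simp
    then show ?thesis
      using ex' by blast
  qed
qed

theorem proposition1p3:
  fixes k :: "('k, 'r) ring_scheme" and X :: "'x topology"
  assumes "ring k"
  shows
    "(\<forall>F :: ('x, 'k, 'u) presheaf. locally_constant k X F \<longrightarrow> quasi_coherent k X F) \<and>
     (locally_connected_space X \<longrightarrow>
        (\<forall>F :: ('x, 'k, 'u) presheaf.
           quasi_coherent_ix TYPE('i) TYPE('j) k X F \<longrightarrow> locally_constant k X F) \<and>
        (Qcoh k X :: (('x, 'k, 'u) presheaf, 'x set \<Rightarrow> 'u \<Rightarrow> 'u) preadditive) = LConst k X \<and>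
        (sheaf_universe TYPE('x) TYPE('u) \<longrightarrow>
           abelian_subcategory
             (LConst k X :: (('x, 'k, 'u) presheaf, 'x set \<Rightarrow> 'u \<Rightarrow> 'u) preadditive) (Shv k X)))"
proof (intro conjI allI impI)
  fix F :: "('x, 'k, 'u) presheaf"
  show "quasi_coherent k X F" if "locally_constant k X F"
    by (rule locally_constant_imp_quasi_coherent[OF assms that])
next
  assume X: "locally_connected_space X"
  show "locally_constant k X F" if "quasi_coherent_ix TYPE('i) TYPE('j) k X F" for F :: "('x, 'k, 'u) presheaf"
    by (rule quasi_coherent_imp_locally_constant[OF assms X that])
  have "quasi_coherent k X F \<longleftrightarrow> locally_constant k X F" for F :: "('x, 'k, 'u) presheaf"
    using locally_constant_imp_quasi_coherent[OF assms]
    by (auto simp: quasi_coherent_def intro: quasi_coherent_imp_locally_constant[OF assms X])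
  then show "(Qcoh k X :: (('x, 'k, 'u) presheaf, 'x set \<Rightarrow> 'u \<Rightarrow> 'u) preadditive) = LConst k X"
    by (simp add: Qcoh_def LConst_def)
  assume "sheaf_universe TYPE('x) TYPE('u)"
  then show "abelian_subcategory
      (LConst k X :: (('x, 'k, 'u) presheaf, 'x set \<Rightarrow> 'u \<Rightarrow> 'u) preadditive) (Shv k X)"
    unfolding LConst_def by (rule closed_sheaf_class.abelian_subcategory[OF locally_constant_closed[OF assms X]])
qed

end
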